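(* If $\hat\rho_1\in\mathcal A_1$ (i.e. $\rho_1$ is $G$-invariant), then $$S(\rho_0\,\|\,\rho_1)=S_M(\rho_0\,\|\,\rho_1)=\lim_{n\to\infty}\frac1n\sup\bigl\{S(\rho_{0,n}|_{\mathcal B}\,\|\,\rho_{1,n}|_{\mathcal B}):\ \mathcal B\text{ is an abelian subalgebra of }\mathcal A_n\bigr\}.$$
   Context: Let $\mathcal H$ be a finite-dimensional complex Hilbert space, $G$ a compact group and $g\mapsto u_g$ a continuous unitary representation of $G$ on $\mathcal H$. For $n\in\mathbb N$ let $\mathcal A_n=\{A\in\mathcal B(\mathcal H^{\otimes n}):Au_g^{\otimes n}=u_g^{\otimes n}A\ \forall g\in G\}$ and $E_{\mathcal A_n}(X)=\int_G u_g^{\otimes n}Xu_g^{*\otimes n}\,dg$ (normalized Haar measure). Let $\rho_0,\rho_1$ be states on $\mathcal B(\mathcal H)$ with density matrices $\hat\rho_0,\hat\rho_1$, and let $\rho_{k,n}$ be the state on $\mathcal B(\mathcal H^{\otimes n})$ with density $\hat\rho_{k,n}:=E_{\mathcal A_n}(\hat\rho_k^{\otimes n})$, $k=0,1$. Relative entropy: $S(\rho\|\sigma)=\operatorname{Tr}\hat\rho(\log\hat\rho-\log\hat\sigma)$ if $\operatorname{supp}\rho\le\operatorname{supp}\sigma$, $+\infty$ otherwise; for a unital *-subalgebra $\mathcal B$, $\rho|_{\mathcal B}$ denotes the restriction, and the relative entropy of restrictions is computed from their densities in $\mathcal B$ with respect to the trace (for abelian $\mathcal B$ this is the classical relative entropy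 of the probability vectors on the minimal projections of $\mathcal B$). $S_M(\rho_0\|\rho_1):=\lim_{n\to\infty}\frac1nS(\rho_{0,n}\|\rho_{1,n})$ (this limit exists). *)

theory Defs
  imports "HOL-Probability.Probability" "Jordan_Normal_Form.Matrix"
begin

definition adj :: "complex mat \<Rightarrow> complex mat" where
  "adj A = mat (dim_col A) (dim_row A) (\<lambda>(i,j). cnj (A $$ (j,i)))"

definition mtrace :: "complex mat \<Rightarrow> complex" where
  "mtrace A = (\<Sum>i<dim_row A. A $$ (i,i))"

definition unitary_mat :: "nat \<Rightarrow> complex mat \<Rightarrow> bool" where
  "unitary_mat d U \<longleftrightarrow> U \<in> carrier_mat d d \<and> adj U * U = 1\<^sub>m d \<and> U * adj U = 1\<^sub>m d"

definition kron :: "complex mat \<Rightarrow> complex mat \<Rightarrow> complex mat" where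
  "kron A B = mat (dim_row A * dim_row B) (dim_col A * dim_col B)
     (\<lambda>(i,j). A $$ (i div dim_row B, j div dim_col B) * B $$ (i mod dim_row B, j mod dim_col B))"

fun tpow :: "nat \<Rightarrow> complex mat \<Rightarrow> complex mat" where
  "tpow 0 A = 1\<^sub>m 1"
| "tpow (Suc n) A = kron (tpow n A) A"

definition density :: "nat \<Rightarrow> complex mat \<Rightarrow> bool" where
  "density d \<rho> \<longleftrightarrow> \<rho> \<in> carrier_mat d d \<and> adj \<rho> = \<rho> \<and>
     (\<forall>v \<in> carrier_vec d. 0 \<le> Re (\<Sum>i<d. cnj (v $ i) * (\<rho> *\<^sub>v v) $ i)) \<and> mtrace \<rho> = 1"

text \<open>Functional calculus for Hermitian matrices via a unitary diagonalisation
  (the result does not depend on the chosen diagonalisation).\<close>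
definition mfun :: "(real \<Rightarrow> real) \<Rightarrow> complex mat \<Rightarrow> complex mat" where
  "mfun f A = (SOME M. \<exists>U D. unitary_mat (dim_row A) U \<and> D \<in> carrier_mat (dim_row A) (dim_row A)
      \<and> diagonal_mat D \<and> (\<forall>i<dim_row A. D $$ (i,i) \<in> \<real>) \<and> A = U * D * adj U
      \<and> M = U * mat (dim_row A) (dim_row A) (\<lambda>(i,j). if i = j then complex_of_real (f (Re (D $$ (i,i)))) else 0) * adj U)"

definition mlog :: "complex mat \<Rightarrow> complex mat" where
  "mlog A = mfun ln A"

definition mrange :: "complex mat \<Rightarrow> complex vec set" where
  "mrange A = {A *\<^sub>v v | v. v \<in> carrier_vec (dim_col A)}"

text \<open>Umegaki relative entropy S(rho||sigma) (value +infinity if supp rho is not below supp sigma).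
  On the kernels the value of ln 0 plays no role.\<close>
definition qrel :: "complex mat \<Rightarrow> complex mat \<Rightarrow> ereal" where
  "qrel \<rho> \<sigma> = (if mrange \<rho> \<subseteq> mrange \<sigma>
     then ereal (Re (mtrace (\<rho> * (mlog \<rho> - mlog \<sigma>)))) else \<infinity>)"

definition crel :: "'k set \<Rightarrow> ('k \<Rightarrow> real) \<Rightarrow> ('k \<Rightarrow> real) \<Rightarrow> ereal" where
  "crel K p q = (if (\<forall>k\<in>K. p k \<noteq> 0 \<longrightarrow> q k \<noteq> 0)
     then ereal (\<Sum>k\<in>K. if p k = 0 then 0 else p k * ln (p k / q k)) else \<infinity>)"

definition is_proj :: "nat \<Rightarrow> complex mat \<Rightarrow> bool" where
  "is_proj D P \<longleftrightarrow> P \<in> carrier_mat D D \<and> P * P = P \<and> adj P = P"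

definition abelian_subalg :: "nat \<Rightarrow> complex mat set \<Rightarrow> bool" where
  "abelian_subalg D B \<longleftrightarrow> B \<subseteq> carrier_mat D D \<and> 1\<^sub>m D \<in> B
     \<and> (\<forall>X\<in>B. \<forall>Y\<in>B. X + Y \<in> B \<and> X * Y \<in> B \<and> X * Y = Y * X)
     \<and> (\<forall>c. \<forall>X\<in>B. c \<cdot>\<^sub>m X \<in> B) \<and> (\<forall>X\<in>B. adj X \<in> B)"

definition min_projs :: "nat \<Rightarrow> complex mat set \<Rightarrow> complex mat set" where
  "min_projs D B = {P\<in>B. is_proj D P \<and> P \<noteq> 0\<^sub>m D D \<and>
      (\<forall>Q\<in>B. is_proj D Q \<and> Q * P = Q \<longrightarrow> Q = 0\<^sub>m D D \<or> Q = P)}"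

text \<open>Relative entropy of the restrictions to an abelian subalgebra B: classical relative entropy
  of the probability vectors on the minimal projections of B.\<close>
definition qrel_restr :: "nat \<Rightarrow> complex mat set \<Rightarrow> complex mat \<Rightarrow> complex mat \<Rightarrow> ereal" where
  "qrel_restr D B \<rho> \<sigma> = crel (min_projs D B) (\<lambda>P. Re (mtrace (\<rho> * P))) (\<lambda>P. Re (mtrace (\<sigma> * P)))"

text \<open>G is modelled as a type 'g which is a compact Hausdorff topological group (written additively);
  mu is the normalised Haar measure, i.e. a left-invariant Borel probability measure.\<close>
definition haar_prob :: "'g::{topological_group_add, t2_space} measure \<Rightarrow> bool" where
  "haar_prob \<mu> \<longleftrightarrow> prob_space \<mu> \<and> sets \<mu> = sets borel \<and> (\<forall>g. distr \<mu> \<mu> (\<lambda>h. g + h) = \<mu>)"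

definition cont_unitary_rep :: "nat \<Rightarrow> ('g::{topological_group_add, t2_space} \<Rightarrow> complex mat) \<Rightarrow> bool" where
  "cont_unitary_rep d u \<longleftrightarrow> (\<forall>g. unitary_mat d (u g)) \<and> (\<forall>g h. u (g + h) = u g * u h)
     \<and> (\<forall>i<d. \<forall>j<d. continuous_on UNIV (\<lambda>g. u g $$ (i,j)))"

definition commA :: "nat \<Rightarrow> ('g \<Rightarrow> complex mat) \<Rightarrow> nat \<Rightarrow> complex mat set" where
  "commA d u n = {A \<in> carrier_mat (d^n) (d^n). \<forall>g. A * tpow n (u g) = tpow n (u g) * A}"

definition haar_avg :: "nat \<Rightarrow> ('g \<Rightarrow> complex mat) \<Rightarrow> 'g measure \<Rightarrow> nat \<Rightarrow> complex mat \<Rightarrow> complex mat" where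
  "haar_avg d u \<mu> n X = mat (d^n) (d^n)
     (\<lambda>(i,j). \<integral>g. (tpow n (u g) * X * adj (tpow n (u g))) $$ (i,j) \<partial>\<mu>)"

end

theory Submission
  imports Defs "Jordan_Normal_Form.Schur_Decomposition" "Jordan_Normal_Form.Spectral_Radius"
begin

text \<open>
  Write \<open>\<rho>\<close> and \<open>\<sigma>\<close> for the \<open>n\<close>-fold tensor powers of the two states and \<open>\<tau>\<close> for the Haar average of
  \<open>\<rho>\<close>; by invariance \<open>\<sigma>\<close> is its own average. Restriction to an abelian subalgebra decreases the
  relative entropy, and \<open>S(\<tau>\<parallel>\<sigma>) = S(\<rho>\<parallel>\<sigma>) - S(\<rho>\<parallel>\<tau>) \<le> S(\<rho>\<parallel>\<sigma>)\<close>, which is \<open>n\<close> times the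
  one-particle value. For the converse let \<open>\<omega>\<close> be the pinching of \<open>\<tau>\<close> by the spectral projections
  of \<open>\<sigma>\<close>. It commutes with \<open>\<sigma>\<close> and with the group, and the joint spectral projections of \<open>\<omega>\<close> and
  \<open>\<sigma>\<close> span an abelian algebra on which the restricted relative entropy is \<open>S(\<rho>\<parallel>\<sigma>) - S(\<rho>\<parallel>\<omega>)\<close>.
  Finally \<open>\<rho> \<le> C \<omega>\<close> with \<open>C\<close> polynomial in \<open>n\<close>, whence \<open>S(\<rho>\<parallel>\<omega>) \<le> ln C\<close>: the pinching costs a factor
  equal to the number of eigenvalues of \<open>\<sigma>\<close>, and the averaging one equal to the dimension of the space
  of functions spanned by the matrix entries of the representation, because the reproducing kernel of a
  translation invariant function space equals its dimension on the diagonal. Both numbers are bounded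
  by numbers of monomials of degree \<open>n\<close>.
\<close>

section \<open>Matrices over the complex numbers and the spectral theorem\<close>

text \<open>No estimate manipulates matrix logarithms. In eigenbases the relative entropy is a
  double sum over the eigenvalues of both states, weighted by the squared overlaps of their
  eigenvectors, and all bounds are scalar bounds on such sums. The defects
  S(\<rho>\<parallel>\<tau>) and S(\<rho>\<parallel>\<omega>) come from trace identities: functions
  of \<tau> and \<sigma>, respectively of \<omega> and \<sigma>, have the same trace against the
  average as against \<rho>. Pinching is needed because \<tau> and \<sigma> need not commute, so no
  abelian algebra contains functions of both; it stays inside the commutant because \<sigma> lies
  there. The obstacle throughout is the value infinity. \<open>ln 0\<close> is a number, so supports
  are carried as a separate condition on overlaps and transported by the same trace identities, with
  the indicator of 0 in place of \<open>ln\<close>. The bound by ln C uses inverses and ln x \<le> x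
  - 1 instead of operator monotonicity. C stays polynomial because distinct entry functions of the
  tensor power are counted, not its exponentially many matrix positions.\<close>

no_notation inner (infix "\<bullet>" 70)

section \<open>Adjoints, traces and unitary matrices\<close>

lemma mult_index_sum:
  assumes "A \<in> carrier_mat n m" "B \<in> carrier_mat m k" "i < n" "j < k"
  shows "(A * B) $$ (i,j) = (\<Sum>l<m. A $$ (i,l) * B $$ (l,j))"
  using assms by (simp add: scalar_prod_def atLeast0LessThan)

lemma mult_cnj_cmod:
  "z * cnj z = complex_of_real ((cmod z)\<^sup>2)" "cnj z * z = complex_of_real ((cmod z)\<^sup>2)"
  by (metis complex_norm_square mult.commute)+

lemma adj_dim [simp]: "dim_row (adj A) = dim_col A" "dim_col (adj A) = dim_row A"
  by (simp_all add: adj_def)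

lemma adj_carrier [simp]: "adj A \<in> carrier_mat n m \<longleftrightarrow> A \<in> carrier_mat m n"
  by (metis adj_dim carrier_matD carrier_matI)

lemma adj_index [simp]: "i < dim_col A \<Longrightarrow> j < dim_row A \<Longrightarrow> adj A $$ (i,j) = cnj (A $$ (j,i))"
  by (simp add: adj_def)

lemma adj_adj [simp]: "adj (adj A) = A"
  by (rule eq_matI) auto

lemma adj_mult:
  assumes "A \<in> carrier_mat n m" "B \<in> carrier_mat m k"
  shows "adj (A * B) = adj B * adj A"
  using assms
  by (intro eq_matI) (auto simp: scalar_prod_def cnj_sum mult.commute intro!: sum.cong)

lemma adj_one [simp]: "adj (1\<^sub>m n) = 1\<^sub>m n"
  by (rule eq_matI) auto

lemma adj_add:
  assumes "A \<in> carrier_mat n m" "B \<in> carrier_mat n m"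
  shows "adj (A + B) = adj A + adj B"
  using assms by (intro eq_matI) auto

lemma adj_smult: "adj (c \<cdot>\<^sub>m A) = cnj c \<cdot>\<^sub>m adj A"
  by (rule eq_matI) auto

lemma adj_mat_diag [simp]: "adj (mat_diag n f) = mat_diag n (\<lambda>i. cnj (f i))"
  by (rule eq_matI) (auto simp: mat_diag_def)

lemma mat_diag_index: "i < n \<Longrightarrow> j < n \<Longrightarrow> mat_diag n f $$ (i,j) = (if i = j then f j else 0)"
  by (simp add: mat_diag_def)

lemma mtrace_comm:
  assumes "A \<in> carrier_mat n m" "B \<in> carrier_mat m n"
  shows "mtrace (A * B) = mtrace (B * A)"
proof -
  have "mtrace (A * B) = (\<Sum>i<n. \<Sum>l<m. A $$ (i,l) * B $$ (l,i))"
    using assms by (auto simp: mtrace_def mult_index_sum[OF assms] simp del: index_mult_mat(1) intro!: sum.cong)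
  also have "\<dots> = (\<Sum>l<m. \<Sum>i<n. B $$ (l,i) * A $$ (i,l))"
    by (subst sum.swap) (simp add: mult.commute)
  also have "\<dots> = mtrace (B * A)"
    using assms by (auto simp: mtrace_def mult_index_sum[OF assms(2,1)] simp del: index_mult_mat(1) intro!: sum.cong)
  finally show ?thesis .
qed

lemma mtrace_minus:
  assumes "A \<in> carrier_mat n n" "B \<in> carrier_mat n n"
  shows "mtrace (A - B) = mtrace A - mtrace B"
  using assms by (simp add: mtrace_def sum_subtractf)

lemma unitary_matD:
  assumes "unitary_mat n U"
  shows "U \<in> carrier_mat n n" "adj U \<in> carrier_mat n n" "adj U * U = 1\<^sub>m n" "U * adj U = 1\<^sub>m n"
  using assms by (auto simp: unitary_mat_def)

lemma unitary_mat_one [simp]: "unitary_mat n (1\<^sub>m n)"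
  by (simp add: unitary_mat_def)

lemma unitary_mat_adj: "unitary_mat n U \<Longrightarrow> unitary_mat n (adj U)"
  by (auto simp: unitary_mat_def)

lemma mult_cancel_mid:
  fixes A :: "complex mat"
  assumes "B * C = 1\<^sub>m n" "A \<in> carrier_mat k n" "B \<in> carrier_mat n m" "C \<in> carrier_mat m n" "D \<in> carrier_mat n l"
  shows "(A * B) * (C * D) = A * D"
proof -
  have "(A * B) * (C * D) = A * (B * (C * D))" using assms by (intro assoc_mult_mat) auto
  also have "B * (C * D) = (B * C) * D" using assms by (intro assoc_mult_mat[symmetric]) auto
  finally show ?thesis using assms by simp
qed

lemma sq_mult_carrier:
  "A \<in> carrier_mat n n \<Longrightarrow> B \<in> carrier_mat n n \<Longrightarrow> A * B \<in> carrier_mat n n"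
  by (rule mult_carrier_mat)

lemma sq_assoc:
  fixes A :: "complex mat"
  shows "A \<in> carrier_mat n n \<Longrightarrow> B \<in> carrier_mat n n \<Longrightarrow> C \<in> carrier_mat n n \<Longrightarrow> A * B * C = A * (B * C)"
  by (rule assoc_mult_mat)

lemma unitary_cancel:
  assumes "unitary_mat n U" "A \<in> carrier_mat n m"
  shows "adj U * (U * A) = A" "U * (adj U * A) = A"
proof -
  note U = unitary_matD[OF assms(1)]
  have "adj U * (U * A) = (adj U * U) * A"
    using U assms by (intro assoc_mult_mat[symmetric]) auto
  then show "adj U * (U * A) = A" using U assms by simp
  have "U * (adj U * A) = (U * adj U) * A"
    using U assms by (intro assoc_mult_mat[symmetric]) auto
  then show "U * (adj U * A) = A" using U assms by simp
qed

lemma unitary_mat_mult: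
  assumes "unitary_mat n U" "unitary_mat n V"
  shows "unitary_mat n (U * V)"
proof -
  note U = unitary_matD[OF assms(1)] and V = unitary_matD[OF assms(2)]
  have a: "adj (U * V) = adj V * adj U" using U V by (intro adj_mult)
  have 1: "adj V * adj U * (U * V) = 1\<^sub>m n"
    using mult_cancel_mid[OF U(3) V(2) U(2) U(1) V(1)] V by simp
  have 2: "U * V * (adj V * adj U) = 1\<^sub>m n"
    using mult_cancel_mid[OF V(4) U(1) V(1) V(2) U(2)] U by simp
  from 1 2 U V show ?thesis by (simp add: unitary_mat_def a)
qed

lemma unitary_mat_left_inverse:
  assumes "U \<in> carrier_mat n n" "adj U * U = 1\<^sub>m n"
  shows "unitary_mat n U"
  using assms mat_mult_left_right_inverse[of "adj U" n U] by (auto simp: unitary_mat_def)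

text \<open>Extend v to a basis, orthogonalise, and normalise the columns. The factor c is the
  length of v, since v itself is not assumed to be a unit vector.\<close>

lemma unitary_with_first_column:
  fixes v :: "complex vec"
  assumes v: "v \<in> carrier_vec n" "v \<noteq> 0\<^sub>v n"
  obtains U c where "unitary_mat n U" "\<And>i. i < n \<Longrightarrow> v $ i = c * U $$ (i,0)" "c \<noteq> 0" "n > 0"
proof -
  interpret cof_vec_space n "TYPE(complex)" .
  define b where "b = basis_completion v"
  define ws where "ws = gram_schmidt n b"
  have n: "n > 0" using v by (cases n) auto
  from basis_completion[OF v, folded b_def]
  have dist_b: "distinct b" and indep: "\<not> lin_dep (set b)" and b: "set b \<subseteq> carrier_vec n"
    and hdb: "hd b = v" and len_b: "length b = n" by auto
  from hdb len_b n obtain vs where bv: "b = v # vs" by (cases b) auto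
  from gram_schmidt_result[OF b dist_b indep refl, folded ws_def]
  have ws: "set ws \<subseteq> carrier_vec n" "corthogonal ws" "length ws = n" by (auto simp: len_b)
  from gram_schmidt_hd[OF v(1), of vs, folded bv] have hdws: "hd ws = v" unfolding ws_def .
  have ws0: "ws ! 0 = v" using hdws ws(3) n by (cases ws) auto
  have dimw: "dim_vec (ws ! i) = n" if "i < n" for i
    using ws that by (metis carrier_vecD nth_mem subsetD)
  define N where "N j = (\<Sum>i<n. (cmod (ws ! j $ i))\<^sup>2)" for j
  have ip: "ws ! i \<bullet>c ws ! j = (\<Sum>k<n. ws ! i $ k * cnj (ws ! j $ k))" if "i < n" "j < n" for i j
    using dimw[OF that(1)] dimw[OF that(2)] by (auto simp: scalar_prod_def atLeast0LessThan intro!: sum.cong)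
  have NN: "ws ! j \<bullet>c ws ! j = complex_of_real (N j)" if "j < n" for j
    unfolding ip[OF that that] N_def mult_cnj_cmod by simp
  have Npos: "N j > 0" if "j < n" for j
  proof -
    have "ws ! j \<bullet>c ws ! j \<noteq> 0" using corthogonalD[OF ws(2), of j j] that ws(3) by auto
    then have "N j \<noteq> 0" using NN[OF that] by auto
    moreover have "N j \<ge> 0" unfolding N_def by (intro sum_nonneg) auto
    ultimately show ?thesis by simp
  qed
  define U where "U = mat n n (\<lambda>(i,j). ws ! j $ i / complex_of_real (sqrt (N j)))"
  have U: "U \<in> carrier_mat n n" by (simp add: U_def)
  have "adj U * U = 1\<^sub>m n"
  proof (rule eq_matI)
    fix i j assume "i < dim_row (1\<^sub>m n :: complex mat)" "j < dim_col (1\<^sub>m n :: complex mat)"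
    then have ij: "i < n" "j < n" by auto
    have "(adj U * U) $$ (i,j) = (\<Sum>k<n. cnj (U $$ (k,i)) * U $$ (k,j))"
      using U ij by (subst mult_index_sum[of _ n n _ n]) auto
    also have "\<dots> = (\<Sum>k<n. ws ! j $ k * cnj (ws ! i $ k)) / (complex_of_real (sqrt (N j)) * complex_of_real (sqrt (N i)))"
      unfolding sum_divide_distrib using ij by (intro sum.cong refl) (simp add: U_def mult.commute)
    also have "\<dots> = (ws ! j \<bullet>c ws ! i) / (complex_of_real (sqrt (N j)) * complex_of_real (sqrt (N i)))"
      using ip ij by simp
    also have "\<dots> = (if i = j then 1 else 0)"
    proof (cases "i = j")
      case True
      have "complex_of_real (sqrt (N i)) * complex_of_real (sqrt (N i)) = complex_of_real (N i)"
        using Npos[OF ij(1)] by (simp flip: of_real_mult)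
      then show ?thesis using True NN[OF ij(1)] Npos[OF ij(1)] by simp
    next
      case False
      then show ?thesis using corthogonalD[OF ws(2), of j i] ij ws(3) by auto
    qed
    finally show "(adj U * U) $$ (i,j) = 1\<^sub>m n $$ (i,j)" using ij by simp
  qed (use U in auto)
  then have "unitary_mat n U" by (rule unitary_mat_left_inverse[OF U])
  moreover have "v $ i = complex_of_real (sqrt (N 0)) * U $$ (i,0)" if "i < n" for i
    using that n Npos[OF n] ws0 by (simp add: U_def)
  moreover have "complex_of_real (sqrt (N 0)) \<noteq> 0" using Npos[OF n] by simp
  ultimately show ?thesis using n that by blast
qed

text \<open>Deflation by one eigenvector: in a basis starting with it, normality clears the first
  row as well as the first column, so the remaining block is again normal. Normal matrices are
  needed rather than Hermitian ones, because commuting Hermitian pairs are later diagonalised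
  through A + iB.\<close>

lemma spectral_normal:
  assumes "A \<in> carrier_mat n n" "adj A * A = A * adj A"
  obtains U f where "unitary_mat n U" "A = U * mat_diag n f * adj U"
proof -
  have "\<exists>U f. unitary_mat n U \<and> A = U * mat_diag n f * adj U"
    using assms
  proof (induction n arbitrary: A)
    case 0
    then have "A = 1\<^sub>m 0 * mat_diag 0 (\<lambda>_. 0) * adj (1\<^sub>m 0)"
      by (intro eq_matI) auto
    then show ?case using unitary_mat_one by blast
  next
    case (Suc n)
    note A = Suc.prems(1)
    obtain e where "eigenvalue A e"
      using spectrum_non_empty[OF A] by (auto simp: spectrum_def)
    then obtain v where "eigenvector A v e" by (auto simp: eigenvalue_def)
    then have v: "v \<in> carrier_vec (Suc n)" "v \<noteq> 0\<^sub>v (Suc n)" "A *\<^sub>v v = e \<cdot>\<^sub>v v"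
      using A by (auto simp: eigenvector_def)
    obtain W c where W: "unitary_mat (Suc n) W"
      and vW: "\<And>i. i < Suc n \<Longrightarrow> v $ i = c * W $$ (i,0)" and c: "c \<noteq> 0"
      using unitary_with_first_column[OF v(1,2)] by metis
    note Wc = unitary_matD[OF W]
    define A' where "A' = adj W * A * W"
    have A': "A' \<in> carrier_mat (Suc n) (Suc n)" using Wc A by (auto simp: A'_def)
    have aA: "adj A \<in> carrier_mat (Suc n) (Suc n)" using A by simp
    have adjA': "adj A' = adj W * adj A * W"
      using Wc A aA by (simp add: A'_def adj_mult[of _ "Suc n" "Suc n" _ "Suc n"])
    have AA: "A = W * A' * adj W"
      using Wc A aA by (simp add: A'_def unitary_cancel[OF W, of _ "Suc n"] sq_assoc[of _ "Suc n"] sq_mult_carrier)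
    have normal: "adj A' * A' = A' * adj A'"
    proof -
      have "adj A' * A' = adj W * adj A * A * W"
        unfolding adjA' unfolding A'_def using Wc A aA
          by (simp add: unitary_cancel[OF W, of _ "Suc n"] sq_assoc[of _ "Suc n"] sq_mult_carrier)
      also have "\<dots> = adj W * (adj A * A) * W" using Wc A aA
        by (simp add: sq_assoc[of _ "Suc n"] sq_mult_carrier)
      also have "\<dots> = adj W * (A * adj A) * W" using Suc.prems(2) by simp
      also have "\<dots> = A' * adj A'"
        unfolding adjA' unfolding A'_def using Wc A aA
          by (simp add: unitary_cancel[OF W, of _ "Suc n"] sq_assoc[of _ "Suc n"] sq_mult_carrier)
      finally show ?thesis .
    qed
    have AW: "(A * W) $$ (i,0) = e * W $$ (i,0)" if "i < Suc n" for i
    proof -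
      have "c * (A * W) $$ (i,0) = (\<Sum>k<Suc n. A $$ (i,k) * v $ k)"
        using A Wc that
        by (subst mult_index_sum[of _ "Suc n" "Suc n" _ "Suc n"])
           (auto simp: sum_distrib_left vW simp del: sum.lessThan_Suc intro!: sum.cong)
      also have "\<dots> = (A *\<^sub>v v) $ i"
        using A v(1) that by (simp add: scalar_prod_def atLeast0LessThan)
      also have "\<dots> = e * (c * W $$ (i,0))" using v that vW by simp
      finally show ?thesis using c by simp
    qed
    have col0: "A' $$ (i,0) = (if i = 0 then e else 0)" if "i < Suc n" for i
    proof -
      have "A' = adj W * (A * W)" using Wc A by (simp add: A'_def)
      then have "A' $$ (i,0) = (\<Sum>k<Suc n. adj W $$ (i,k) * (e * W $$ (k,0)))"
        using A Wc that AW
        by (simp del: sum.lessThan_Suc index_mult_mat add: mult_index_sum[of _ "Suc n" "Suc n" _ "Suc n"])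
      also have "\<dots> = e * (adj W * W) $$ (i,0)"
        using A Wc that
        by (subst mult_index_sum[of _ "Suc n" "Suc n" _ "Suc n"])
           (auto simp: sum_distrib_left simp del: sum.lessThan_Suc intro!: sum.cong)
      finally show ?thesis using Wc that by simp
    qed
    \<comment> \<open>Compare the (0,0) entries of both products: the squared length of the first
      column is that of \<open>e\<close> alone, while that of the first row also contains the
      remaining entries, which must therefore vanish.\<close>
    have row0: "A' $$ (0,Suc j) = 0" if "j < n" for j
    proof -
      have "(adj A' * A') $$ (0,0) = (\<Sum>k<Suc n. cnj (A' $$ (k,0)) * A' $$ (k,0))"
        using A' by (subst mult_index_sum[of _ "Suc n" "Suc n" _ "Suc n"]) (auto intro!: sum.cong)
      also have "\<dots> = cnj e * e"
        unfolding sum.lessThan_Suc_shift using col0 by simp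
      finally have 1: "(adj A' * A') $$ (0,0) = cnj e * e" .
      have "(A' * adj A') $$ (0,0) = (\<Sum>k<Suc n. A' $$ (0,k) * cnj (A' $$ (0,k)))"
        using A' by (subst mult_index_sum[of _ "Suc n" "Suc n" _ "Suc n"]) (auto intro!: sum.cong)
      also have "\<dots> = e * cnj e + complex_of_real (\<Sum>k<n. (cmod (A' $$ (0,Suc k)))\<^sup>2)"
        unfolding sum.lessThan_Suc_shift using col0[of 0] by (simp add: mult_cnj_cmod)
      finally have "complex_of_real (\<Sum>k<n. (cmod (A' $$ (0,Suc k)))\<^sup>2) = 0"
        using 1 normal by (simp add: mult.commute)
      then have "(\<Sum>k<n. (cmod (A' $$ (0,Suc k)))\<^sup>2) = 0" using of_real_eq_0_iff by blast
      then have "(cmod (A' $$ (0,Suc j)))\<^sup>2 = 0"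
        using that by (subst (asm) sum_nonneg_eq_0_iff) auto
      then show ?thesis by simp
    qed
    define A3 where "A3 = mat n n (\<lambda>(i,j). A' $$ (Suc i, Suc j))"
    have A3: "A3 \<in> carrier_mat n n" by (simp add: A3_def)
    have "adj A3 * A3 = A3 * adj A3"
    proof (rule eq_matI)
      fix i j assume "i < dim_row (A3 * adj A3)" "j < dim_col (A3 * adj A3)"
      then have ij: "i < n" "j < n" using A3 by auto
      have "(adj A3 * A3) $$ (i,j) = (\<Sum>k<n. cnj (A' $$ (Suc k, Suc i)) * A' $$ (Suc k, Suc j))"
        using A3 ij by (subst mult_index_sum[of _ n n _ n]) (auto simp: A3_def intro!: sum.cong)
      also have "\<dots> = (adj A' * A') $$ (Suc i, Suc j)"
        using A' ij row0 by (subst mult_index_sum[of _ "Suc n" "Suc n" _ "Suc n"])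
          (auto simp: sum.lessThan_Suc_shift simp del: sum.lessThan_Suc)
      also have "\<dots> = (A' * adj A') $$ (Suc i, Suc j)" using normal by simp
      also have "\<dots> = (\<Sum>k<n. A' $$ (Suc i, Suc k) * cnj (A' $$ (Suc j, Suc k)))"
        using A' ij col0 by (subst mult_index_sum[of _ "Suc n" "Suc n" _ "Suc n"])
          (auto simp: sum.lessThan_Suc_shift simp del: sum.lessThan_Suc)
      also have "\<dots> = (A3 * adj A3) $$ (i,j)"
        using A3 ij by (subst mult_index_sum[of _ n n _ n]) (auto simp: A3_def intro!: sum.cong)
      finally show "(adj A3 * A3) $$ (i,j) = (A3 * adj A3) $$ (i,j)" .
    qed (use A3 in auto)
    from Suc.IH[OF A3 this] obtain V g where V: "unitary_mat n V" and A3V: "A3 = V * mat_diag n g * adj V"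
      by blast
    note Vc = unitary_matD[OF V]
    define V' where "V' = mat (Suc n) (Suc n) (\<lambda>(i,j). if i = 0 then (if j = 0 then 1 else 0)
        else if j = 0 then 0 else V $$ (i - 1, j - 1))"
    define f where "f i = (if i = 0 then e else g (i - 1))" for i
    have V': "V' \<in> carrier_mat (Suc n) (Suc n)" by (simp add: V'_def)
    have V'i: "V' $$ (0,0) = 1" "\<And>j. j < n \<Longrightarrow> V' $$ (0,Suc j) = 0" "\<And>j. j < n \<Longrightarrow> V' $$ (Suc j,0) = 0"
      "\<And>i j. i < n \<Longrightarrow> j < n \<Longrightarrow> V' $$ (Suc i,Suc j) = V $$ (i,j)" by (simp_all add: V'_def)
    have uV': "unitary_mat (Suc n) V'"
    proof (rule unitary_mat_left_inverse[OF V'], rule eq_matI)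
      fix i j assume "i < dim_row (1\<^sub>m (Suc n) :: complex mat)" "j < dim_col (1\<^sub>m (Suc n) :: complex mat)"
      then have ij: "i < Suc n" "j < Suc n" by auto
      have "(adj V' * V') $$ (i,j) = (\<Sum>k<Suc n. cnj (V' $$ (k,i)) * V' $$ (k,j))"
        using V' ij by (subst mult_index_sum[of _ "Suc n" "Suc n" _ "Suc n"]) (auto intro!: sum.cong)
      also have "\<dots> = (if i = j then 1 else 0)"
      proof (cases i; cases j)
        fix i' j' assume s: "i = Suc i'" "j = Suc j'"
        then have ij': "i' < n" "j' < n" using ij by auto
        have "(\<Sum>k<Suc n. cnj (V' $$ (k,i)) * V' $$ (k,j)) = (\<Sum>k<n. cnj (V $$ (k,i')) * V $$ (k,j'))"
          unfolding sum.lessThan_Suc_shift using s ij' V'i by simp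
        also have "\<dots> = (adj V * V) $$ (i',j')"
          using Vc ij' by (subst mult_index_sum[of _ n n _ n]) (auto intro!: sum.cong)
        finally show ?thesis using Vc ij' s by simp
      qed (use ij V'i in \<open>auto simp: sum.lessThan_Suc_shift simp del: sum.lessThan_Suc\<close>)
      finally show "(adj V' * V') $$ (i,j) = 1\<^sub>m (Suc n) $$ (i,j)" using ij by simp
    qed (use V' in auto)
    have md: "(V' * mat_diag (Suc n) f * adj V') $$ (i,j) = (\<Sum>k<Suc n. V' $$ (i,k) * f k * cnj (V' $$ (j,k)))"
      if "i < Suc n" "j < Suc n" for i j
      using V' that
      by (subst mult_index_sum[of _ "Suc n" "Suc n" _ "Suc n"])
         (auto simp: mat_diag_mult_right[OF V'] simp del: sum.lessThan_Suc intro!: sum.cong)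
    have md3: "(V * mat_diag n g * adj V) $$ (i,j) = (\<Sum>k<n. V $$ (i,k) * g k * cnj (V $$ (j,k)))"
      if "i < n" "j < n" for i j
      using Vc that
      by (subst mult_index_sum[of _ n n _ n])
         (auto simp: mat_diag_mult_right[OF Vc(1)] intro!: sum.cong)
    have "A' = V' * mat_diag (Suc n) f * adj V'"
    proof (rule eq_matI)
      fix i j assume "i < dim_row (V' * mat_diag (Suc n) f * adj V')" "j < dim_col (V' * mat_diag (Suc n) f * adj V')"
      then have ij: "i < Suc n" "j < Suc n" using V' by auto
      have "A' $$ (i,j) = (\<Sum>k<Suc n. V' $$ (i,k) * f k * cnj (V' $$ (j,k)))"
      proof (cases i; cases j)
        fix i' j' assume s: "i = Suc i'" "j = Suc j'"
        then have ij': "i' < n" "j' < n" using ij by auto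
        have "A' $$ (i,j) = A3 $$ (i',j')" using s ij' by (simp add: A3_def)
        then show ?thesis unfolding A3V md3[OF ij'] sum.lessThan_Suc_shift
          using s ij' V'i by (simp add: f_def)
      qed (use ij V'i col0 row0 in \<open>auto simp: sum.lessThan_Suc_shift f_def simp del: sum.lessThan_Suc\<close>)
      then show "A' $$ (i,j) = (V' * mat_diag (Suc n) f * adj V') $$ (i,j)" using md[OF ij] by simp
    qed (use V' A' in auto)
    then have "A = W * (V' * mat_diag (Suc n) f * adj V') * adj W" using AA by simp
    also have "\<dots> = (W * V') * mat_diag (Suc n) f * adj (W * V')"
    proof -
      have D: "mat_diag (Suc n) f \<in> carrier_mat (Suc n) (Suc n)" by simp
      have aV: "adj V' \<in> carrier_mat (Suc n) (Suc n)" using V' by simp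
      show ?thesis unfolding adj_mult[OF Wc(1) V'] using D aV V' Wc
        by (simp add: sq_assoc[of _ "Suc n"] sq_mult_carrier)
    qed
    finally show ?case using unitary_mat_mult[OF W uV'] by blast
  qed
  then show ?thesis using that by blast
qed

section \<open>Functional calculus and relative entropy in eigenbases\<close>

declare index_mult_mat(1) [simp del]

lemma mat_diag_dims [simp]: "dim_row (mat_diag n f) = n" "dim_col (mat_diag n f) = n"
  by (simp_all add: mat_diag_def)


definition diagc :: "nat \<Rightarrow> complex mat \<Rightarrow> (nat \<Rightarrow> complex) \<Rightarrow> complex mat" where
  "diagc n U f = U * mat_diag n f * adj U"

lemma diagc_carrier [simp]: "U \<in> carrier_mat n n \<Longrightarrow> diagc n U f \<in> carrier_mat n n"
  by (simp add: diagc_def sq_mult_carrier)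

lemma diagc_dim [simp]: "dim_row (diagc n U f) = dim_row U" "dim_col (diagc n U f) = dim_row U"
  by (simp_all add: diagc_def)

lemma diagc_cong: "(\<And>i. i < n \<Longrightarrow> f i = g i) \<Longrightarrow> diagc n U f = diagc n U g"
proof -
  assume "\<And>i. i < n \<Longrightarrow> f i = g i"
  then have "mat_diag n f = mat_diag n g" by (intro eq_matI) (auto simp: mat_diag_def)
  then show ?thesis by (simp add: diagc_def)
qed

lemma adj_diagc: "U \<in> carrier_mat n n \<Longrightarrow> adj (diagc n U f) = diagc n U (\<lambda>i. cnj (f i))"
  by (simp add: diagc_def adj_mult[of _ n n _ n] sq_assoc[of _ n] sq_mult_carrier)

text \<open>Between two different eigenbases the product is the overlap matrix with rows and columns
  scaled by the eigenvalues; whether it vanishes can be read off entry by entry.\<close>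

lemma diagc_mult_mixed:
  assumes "U \<in> carrier_mat n n" "V \<in> carrier_mat n n"
  shows "diagc n V h * diagc n U f = V * mat n n (\<lambda>(j,i). h j * (adj V * U) $$ (j,i) * f i) * adj U"
proof -
  have "mat_diag n h * ((adj V * U) * mat_diag n f) = mat n n (\<lambda>(j,i). h j * (adj V * U) $$ (j,i) * f i)"
    using assms by (subst mat_diag_mult_left[of _ n n]; simp add: mat_diag_mult_right[of _ n n] sq_mult_carrier)
      (intro eq_matI, auto)
  moreover have "diagc n V h * diagc n U f = V * (mat_diag n h * ((adj V * U) * mat_diag n f)) * adj U"
    using assms by (simp add: diagc_def sq_assoc[of _ n] sq_mult_carrier)
  ultimately show ?thesis by simp
qed

lemma diagc_mult:
  assumes "unitary_mat n U"
  shows "diagc n U f * diagc n U g = diagc n U (\<lambda>i. f i * g i)"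
proof -
  note U = unitary_matD[OF assms]
  have "mat n n (\<lambda>(j,i). f j * (adj U * U) $$ (j,i) * g i) = mat_diag n (\<lambda>i. f i * g i)"
    using U(3) by (intro eq_matI) (auto simp: mat_diag_def)
  then show ?thesis using diagc_mult_mixed[OF U(1) U(1), of f g] by (simp add: diagc_def)
qed

lemma diagc_one: "unitary_mat n U \<Longrightarrow> diagc n U (\<lambda>_. 1) = 1\<^sub>m n"
  by (auto simp: diagc_def unitary_mat_def)

lemma diagc_index:
  assumes "U \<in> carrier_mat n n" "i < n" "j < n"
  shows "diagc n U f $$ (i,j) = (\<Sum>k<n. U $$ (i,k) * f k * cnj (U $$ (j,k)))"
  unfolding diagc_def using assms
  by (subst mult_index_sum[of _ n n _ n]) (auto simp: mat_diag_mult_right[of _ n n] sq_mult_carrier intro!: sum.cong)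

lemma diagc_add:
  assumes "U \<in> carrier_mat n n"
  shows "diagc n U f + diagc n U g = diagc n U (\<lambda>i. f i + g i)"
  using assms by (intro eq_matI) (auto simp: diagc_index sum.distrib algebra_simps intro!: sum.cong)

lemma diagc_minus:
  assumes "U \<in> carrier_mat n n"
  shows "diagc n U f - diagc n U g = diagc n U (\<lambda>i. f i - g i)"
  using assms by (intro eq_matI) (auto simp: diagc_index sum_subtractf algebra_simps intro!: sum.cong)

lemma diagc_smult:
  assumes "U \<in> carrier_mat n n"
  shows "c \<cdot>\<^sub>m diagc n U f = diagc n U (\<lambda>i. c * f i)"
  using assms by (intro eq_matI) (auto simp: diagc_index sum_distrib_left algebra_simps intro!: sum.cong)

lemma diagc_zero: "U \<in> carrier_mat n n \<Longrightarrow> diagc n U (\<lambda>_. 0) = 0\<^sub>m n n"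
  by (intro eq_matI) (auto simp: diagc_index)

lemma diagc_recover:
  assumes "unitary_mat n U"
  shows "adj U * diagc n U f * U = mat_diag n f"
  using unitary_matD[OF assms]
  by (simp add: diagc_def sq_assoc[of _ n] sq_mult_carrier unitary_cancel[OF assms, of _ n])

lemma diagc_inj:
  assumes "unitary_mat n U" "diagc n U f = diagc n U g" "i < n"
  shows "f i = g i"
proof -
  have "mat_diag n f = mat_diag n g" using diagc_recover[OF assms(1)] assms(2) by metis
  then have "mat_diag n f $$ (i,i) = mat_diag n g $$ (i,i)" by simp
  then show ?thesis using assms(3) by (simp add: mat_diag_index)
qed

text \<open>Taking \<open>X = 1\<close> shows that the functional calculus does not depend on the diagonalisation, and
  \<open>U = V\<close>, \<open>f = g\<close> describes the commutant.\<close>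

lemma intertwine_iff:
  assumes "unitary_mat n U" "unitary_mat n V" "X \<in> carrier_mat n n"
  shows "X * diagc n U f = diagc n V g * X \<longleftrightarrow>
    (\<forall>i<n. \<forall>j<n. (adj V * X * U) $$ (i,j) * f j = g i * (adj V * X * U) $$ (i,j))"
proof -
  note U = unitary_matD[OF assms(1)] and V = unitary_matD[OF assms(2)]
  define Y where "Y = adj V * X * U"
  have Y: "Y \<in> carrier_mat n n" using U V assms by (simp add: Y_def sq_mult_carrier)
  note s = sq_assoc[of _ n] sq_mult_carrier unitary_cancel[OF assms(1), of _ n] unitary_cancel[OF assms(2), of _ n]
  have X: "X = V * Y * adj U" using U V assms(3) by (simp add: Y_def s)
  have 1: "X * diagc n U f = V * (Y * mat_diag n f) * adj U"
    using U V Y by (simp add: X diagc_def s)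
  have 2: "diagc n V g * X = V * (mat_diag n g * Y) * adj U"
    using U V Y by (simp add: X diagc_def s)
  have "X * diagc n U f = diagc n V g * X \<longleftrightarrow> Y * mat_diag n f = mat_diag n g * Y"
  proof
    assume "X * diagc n U f = diagc n V g * X"
    then have "adj V * (V * (Y * mat_diag n f) * adj U) * U = adj V * (V * (mat_diag n g * Y) * adj U) * U"
      using 1 2 by simp
    then show "Y * mat_diag n f = mat_diag n g * Y"
      using U V Y by (simp add: s)
  qed (simp add: 1 2)
  also have "\<dots> \<longleftrightarrow> (\<forall>i<n. \<forall>j<n. Y $$ (i,j) * f j = g i * Y $$ (i,j))"
    using Y by (auto simp: mat_diag_mult_left[OF Y] mat_diag_mult_right[OF Y] mat_eq_iff)
  finally show ?thesis by (simp add: Y_def)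
qed

text \<open>Intertwining says that an entry of X between the two eigenbases vanishes unless its two
  eigenvalues agree, a condition that survives applying any F to both eigenvalues.\<close>

lemma intertwine_fun:
  assumes "unitary_mat n U" "unitary_mat n V" "X \<in> carrier_mat n n"
    and "X * diagc n U f = diagc n V g * X"
  shows "X * diagc n U (\<lambda>i. F (f i)) = diagc n V (\<lambda>i. F (g i)) * X"
proof -
  have *: "\<forall>i<n. \<forall>j<n. (adj V * X * U) $$ (i,j) * f j = g i * (adj V * X * U) $$ (i,j)"
    using assms by (simp add: intertwine_iff)
  have "(adj V * X * U) $$ (i,j) * F (f j) = F (g i) * (adj V * X * U) $$ (i,j)" if "i < n" "j < n" for i j
  proof (cases "(adj V * X * U) $$ (i,j) = 0")
    case False
    then have "f j = g i" using *[rule_format, OF that] by (simp add: mult.commute)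
    then show ?thesis by simp
  qed simp
  then show ?thesis using assms by (simp add: intertwine_iff)
qed

definition spectral_dec :: "nat \<Rightarrow> complex mat \<Rightarrow> (nat \<Rightarrow> real) \<Rightarrow> complex mat \<Rightarrow> bool" where
  "spectral_dec n U a A \<longleftrightarrow> unitary_mat n U \<and> A = diagc n U (\<lambda>i. complex_of_real (a i))"

lemma specD:
  assumes "spectral_dec n U a A"
  shows "unitary_mat n U" "A = diagc n U (\<lambda>i. complex_of_real (a i))" "A \<in> carrier_mat n n" "adj A = A"
  using assms unitary_matD[of n U] by (auto simp: spectral_dec_def adj_diagc)

lemma spectral_hermitian:
  assumes "A \<in> carrier_mat n n" "adj A = A"
  obtains U a where "spectral_dec n U a A"
proof -
  obtain U f where U: "unitary_mat n U" and A: "A = diagc n U f"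
    using spectral_normal[OF assms(1)] assms(2) unfolding diagc_def by metis
  have "diagc n U f = diagc n U (\<lambda>i. cnj (f i))"
    using assms(2) A adj_diagc[OF unitary_matD(1)[OF U]] by metis
  then have "cnj (f i) = f i" if "i < n" for i using diagc_inj[OF U _ that] by metis
  then have "f i = complex_of_real (Re (f i))" if "i < n" for i
    using that by (metis Reals_cnj_iff of_real_Re)
  then have "A = diagc n U (\<lambda>i. complex_of_real (Re (f i)))" unfolding A by (intro diagc_cong)
  then show ?thesis using that[of U "\<lambda>i. Re (f i)"] U by (simp add: spectral_dec_def)
qed

text \<open>Replaces the choice inside \<open>mfun\<close> by whichever diagonalisation is at hand:
  the chosen one and the given one are intertwined by the identity matrix.\<close>

lemma mfun_spec:
  assumes "spectral_dec n U a A"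
  shows "mfun f A = diagc n U (\<lambda>i. complex_of_real (f (a i)))"
proof -
  note A = specD[OF assms] and U = unitary_matD[OF specD(1)[OF assms]]
  have dA: "dim_row A = n" using A by auto
  show ?thesis unfolding mfun_def dA
  proof (rule someI2)
    show "\<exists>V D. unitary_mat n V \<and> D \<in> carrier_mat n n \<and> diagonal_mat D \<and> (\<forall>i<n. D $$ (i, i) \<in> \<real>) \<and>
        A = V * D * adj V \<and> diagc n U (\<lambda>i. complex_of_real (f (a i))) = V * mat n n (\<lambda>(i, j). if i = j then complex_of_real (f (Re (D $$ (i, i)))) else 0) * adj V"
    proof (rule exI[of _ U], rule exI[of _ "mat_diag n (\<lambda>i. complex_of_real (a i))"], intro conjI)
      show "A = U * mat_diag n (\<lambda>i. complex_of_real (a i)) * adj U" using A(2) by (simp add: diagc_def)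
      have "mat_diag n (\<lambda>i. complex_of_real (f (a i))) = mat n n (\<lambda>(i, j). if i = j
          then complex_of_real (f (Re (mat_diag n (\<lambda>i. complex_of_real (a i)) $$ (i, i)))) else 0)"
        by (intro eq_matI) (auto simp: mat_diag_def)
      then show "diagc n U (\<lambda>i. complex_of_real (f (a i))) = U * mat n n (\<lambda>(i, j). if i = j
          then complex_of_real (f (Re (mat_diag n (\<lambda>i. complex_of_real (a i)) $$ (i, i)))) else 0) * adj U"
        by (simp add: diagc_def)
    qed (use A in \<open>auto simp: mat_diag_def diagonal_mat_def\<close>)
  next
    fix M assume "\<exists>V D. unitary_mat n V \<and> D \<in> carrier_mat n n \<and> diagonal_mat D \<and> (\<forall>i<n. D $$ (i, i) \<in> \<real>) \<and>
        A = V * D * adj V \<and> M = V * mat n n (\<lambda>(i, j). if i = j then complex_of_real (f (Re (D $$ (i, i)))) else 0) * adj V"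
    then obtain V D where V: "unitary_mat n V" and D: "D \<in> carrier_mat n n" "diagonal_mat D" "\<forall>i<n. D $$ (i, i) \<in> \<real>"
      and AV: "A = V * D * adj V"
      and M: "M = V * mat n n (\<lambda>(i, j). if i = j then complex_of_real (f (Re (D $$ (i, i)))) else 0) * adj V"
      by blast
    have "D = mat_diag n (\<lambda>i. D $$ (i,i))"
      using D by (intro eq_matI) (auto simp: mat_diag_def diagonal_mat_def)
    then have AV': "A = diagc n V (\<lambda>i. D $$ (i,i))" using AV by (simp add: diagc_def)
    have "mat n n (\<lambda>(i, j). if i = j then complex_of_real (f (Re (D $$ (i, i)))) else 0)
        = mat_diag n (\<lambda>i. complex_of_real (f (Re (D $$ (i,i)))))"
      by (intro eq_matI) (auto simp: mat_diag_def)
    then have M': "M = diagc n V (\<lambda>i. complex_of_real (f (Re (D $$ (i,i)))))" using M by (simp add: diagc_def)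
    have "1\<^sub>m n * diagc n U (\<lambda>i. complex_of_real (a i)) = diagc n V (\<lambda>i. D $$ (i,i)) * 1\<^sub>m n"
      unfolding A(2)[symmetric] AV'[symmetric] using A(3) by simp
    from intertwine_fun[OF A(1) V one_carrier_mat this, of "\<lambda>z. complex_of_real (f (Re z))"]
    show "M = diagc n U (\<lambda>i. complex_of_real (f (a i)))"
      using M' U unitary_matD[OF V] by simp
  qed
qed

section \<open>Traces and range inclusion in two eigenbases\<close>

lemma mtrace_mult_diagc:
  assumes "unitary_mat n V" "A \<in> carrier_mat n n"
  shows "mtrace (A * diagc n V g) = (\<Sum>j<n. (adj V * A * V) $$ (j,j) * g j)"
proof -
  note V = unitary_matD[OF assms(1)]
  have "mtrace (A * diagc n V g) = mtrace ((A * V * mat_diag n g) * adj V)"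
    using V assms(2) by (simp add: diagc_def sq_assoc[of _ n] sq_mult_carrier)
  also have "\<dots> = mtrace (adj V * (A * V * mat_diag n g))"
    using V assms(2) by (intro mtrace_comm[of _ n n]) (auto simp: sq_mult_carrier)
  also have "adj V * (A * V * mat_diag n g) = (adj V * A * V) * mat_diag n g"
    using V assms(2) by (simp add: sq_assoc[of _ n] sq_mult_carrier)
  also have "mtrace \<dots> = (\<Sum>j<n. (adj V * A * V) $$ (j,j) * g j)"
    using V assms(2) by (subst mat_diag_mult_right[of _ n n]) (auto simp: sq_mult_carrier mtrace_def)
  finally show ?thesis .
qed

lemma mtrace_diagc: "unitary_mat n U \<Longrightarrow> mtrace (diagc n U f) = (\<Sum>i<n. f i)"
  using mtrace_mult_diagc[of n U "1\<^sub>m n" f] unitary_matD[of n U] by simp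

text \<open>Transition probabilities between the eigenvectors of two diagonalisations. As squared
  entries of a unitary matrix they form a doubly stochastic matrix.\<close>

definition overlap :: "complex mat \<Rightarrow> complex mat \<Rightarrow> nat \<Rightarrow> nat \<Rightarrow> real" where
  "overlap U V i j = (cmod ((adj U * V) $$ (i,j)))\<^sup>2"

lemma overlap_nonneg [simp]: "0 \<le> overlap U V i j" by (simp add: overlap_def)

lemma conj_diagc_diag:
  assumes "U \<in> carrier_mat n n" "V \<in> carrier_mat n n" "j < n"
  shows "(adj V * diagc n U f * V) $$ (j,j) = (\<Sum>i<n. f i * complex_of_real (overlap U V i j))"
proof -
  have Y: "adj V * U \<in> carrier_mat n n" using assms by (simp add: sq_mult_carrier)
  have aY: "adj (adj V * U) = adj U * V" using assms by (simp add: adj_mult[of _ n n _ n])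
  have "adj V * diagc n U f * V = diagc n (adj V * U) f"
    using assms by (simp add: diagc_def aY sq_assoc[of _ n] sq_mult_carrier)
  then have "(adj V * diagc n U f * V) $$ (j,j) = (\<Sum>k<n. (adj V * U) $$ (j,k) * f k * cnj ((adj V * U) $$ (j,k)))"
    using diagc_index[OF Y assms(3,3)] by simp
  also have "\<dots> = (\<Sum>i<n. f i * complex_of_real (overlap U V i j))"
  proof (rule sum.cong[OF refl])
    fix k assume "k \<in> {..<n}"
    then have "adj (adj V * U) $$ (k,j) = cnj ((adj V * U) $$ (j,k))"
      using assms Y by (intro adj_index) auto
    then have "cmod ((adj U * V) $$ (k,j)) = cmod ((adj V * U) $$ (j,k))"
      unfolding aY by (metis complex_mod_cnj)
    then show "(adj V * U) $$ (j,k) * f k * cnj ((adj V * U) $$ (j,k)) = f k * complex_of_real (overlap U V k j)"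
      unfolding overlap_def mult_cnj_cmod(1)[symmetric] by (metis mult.assoc mult.commute mult_cnj_cmod(1))
  qed
  finally show ?thesis .
qed

lemma mtrace_diagc_diagc:
  assumes "unitary_mat n U" "unitary_mat n V"
  shows "mtrace (diagc n U f * diagc n V g) = (\<Sum>i<n. \<Sum>j<n. complex_of_real (overlap U V i j) * (f i * g j))"
proof -
  have "mtrace (diagc n U f * diagc n V g) = (\<Sum>j<n. (\<Sum>i<n. f i * complex_of_real (overlap U V i j)) * g j)"
    unfolding mtrace_mult_diagc[OF assms(2) diagc_carrier[OF unitary_matD(1)[OF assms(1)]]]
    by (intro sum.cong refl) (simp add: conj_diagc_diag unitary_matD(1)[OF assms(1)] unitary_matD(1)[OF assms(2)])
  also have "\<dots> = (\<Sum>j<n. \<Sum>i<n. complex_of_real (overlap U V i j) * (f i * g j))"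
    by (simp add: sum_distrib_left sum_distrib_right algebra_simps)
  finally show ?thesis by (subst sum.swap)
qed

lemma overlap_sum_right:
  assumes "unitary_mat n U" "unitary_mat n V" "i < n"
  shows "(\<Sum>j<n. overlap U V i j) = 1"
proof -
  define Y where "Y = adj U * V"
  have "unitary_mat n Y" unfolding Y_def by (intro unitary_mat_mult unitary_mat_adj assms)
  note Y = unitary_matD[OF this]
  have "complex_of_real (\<Sum>j<n. overlap U V i j) = (\<Sum>j<n. Y $$ (i,j) * cnj (Y $$ (i,j)))"
    by (simp add: overlap_def Y_def[symmetric] mult_cnj_cmod)
  also have "\<dots> = (Y * adj Y) $$ (i,i)"
    using Y assms(3) by (subst mult_index_sum[of _ n n _ n]) (auto intro!: sum.cong)
  also have "\<dots> = 1" using Y assms(3) by simp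
  finally show ?thesis using of_real_eq_1_iff by blast
qed

lemma overlap_sum_left:
  assumes "unitary_mat n U" "unitary_mat n V" "j < n"
  shows "(\<Sum>i<n. overlap U V i j) = 1"
proof -
  define Y where "Y = adj U * V"
  have "unitary_mat n Y" unfolding Y_def by (intro unitary_mat_mult unitary_mat_adj assms)
  note Y = unitary_matD[OF this]
  have "complex_of_real (\<Sum>i<n. overlap U V i j) = (\<Sum>i<n. cnj (Y $$ (i,j)) * Y $$ (i,j))"
    by (simp add: overlap_def Y_def[symmetric] mult_cnj_cmod)
  also have "\<dots> = (adj Y * Y) $$ (j,j)"
    using Y assms(3) by (subst mult_index_sum[of _ n n _ n]) (auto intro!: sum.cong)
  also have "\<dots> = 1" using Y assms(3) by simp
  finally show ?thesis using of_real_eq_1_iff by blast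
qed

text \<open>The columns of M are preimages under B of the columns of A. A factorisation is easier to
  use than an inclusion of sets, since it can be multiplied by projections.\<close>

lemma mrange_subset_iff:
  assumes "A \<in> carrier_mat n n" "B \<in> carrier_mat n n"
  shows "mrange A \<subseteq> mrange B \<longleftrightarrow> (\<exists>M \<in> carrier_mat n n. A = B * M)"
proof
  assume sub: "mrange A \<subseteq> mrange B"
  have "\<exists>w \<in> carrier_vec n. A *\<^sub>v unit_vec n k = B *\<^sub>v w" for k
  proof -
    have "A *\<^sub>v unit_vec n k \<in> mrange A" using assms by (auto simp: mrange_def)
    then show ?thesis using sub assms by (auto simp: mrange_def)
  qed
  then obtain w where w: "\<And>k. w k \<in> carrier_vec n" "\<And>k. A *\<^sub>v unit_vec n k = B *\<^sub>v w k" by metis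
  define M where "M = mat n n (\<lambda>(i,k). w k $ i)"
  have M: "M \<in> carrier_mat n n" by (simp add: M_def)
  have "A = B * M"
  proof (rule eq_matI)
    fix i j assume "i < dim_row (B * M)" "j < dim_col (B * M)"
    then have ij: "i < n" "j < n" using assms M by auto
    have cM: "col M j = w j" using w(1)[of j] ij by (intro eq_vecI) (auto simp: M_def)
    have "A $$ (i,j) = (A *\<^sub>v unit_vec n j) $ i" using assms ij by simp
    also have "\<dots> = (B *\<^sub>v w j) $ i" using w by simp
    also have "\<dots> = (B * M) $$ (i,j)" using assms M ij cM by (simp add: index_mult_mat(1))
    finally show "A $$ (i,j) = (B * M) $$ (i,j)" .
  qed (use assms M in auto)
  then show "\<exists>M \<in> carrier_mat n n. A = B * M" using M by blast
next
  assume "\<exists>M \<in> carrier_mat n n. A = B * M"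
  then obtain M where M: "M \<in> carrier_mat n n" "A = B * M" by blast
  have "A *\<^sub>v v \<in> mrange B" if "v \<in> carrier_vec n" for v
  proof -
    have "A *\<^sub>v v = B *\<^sub>v (M *\<^sub>v v)" using M assms that by simp
    moreover have "M *\<^sub>v v \<in> carrier_vec n" using M that by simp
    ultimately show ?thesis using assms by (auto simp: mrange_def)
  qed
  then show "mrange A \<subseteq> mrange B" using assms by (auto simp: mrange_def)
qed

text \<open>A factors through B exactly if the projection onto the kernel of B annihilates A, and
  this product vanishes entrywise in the two eigenbases.\<close>

lemma mrange_spec_iff:
  assumes "spectral_dec n U a A" "spectral_dec n V b B"
  shows "mrange A \<subseteq> mrange B \<longleftrightarrow> (\<forall>i<n. \<forall>j<n. a i \<noteq> 0 \<and> b j = 0 \<longrightarrow> overlap U V i j = 0)"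
proof -
  note A = specD[OF assms(1)] and B = specD[OF assms(2)]
  note U = unitary_matD[OF A(1)] and V = unitary_matD[OF B(1)]
  have overlap0: "overlap U V i j = 0 \<longleftrightarrow> (adj V * U) $$ (j,i) = 0" if "i < n" "j < n" for i j
  proof -
    have "adj (adj V * U) = adj U * V" using U V by (simp add: adj_mult[of _ n n _ n])
    moreover have "adj (adj V * U) $$ (i,j) = cnj ((adj V * U) $$ (j,i))"
      using U V that by (intro adj_index) auto
    ultimately show ?thesis by (simp add: overlap_def)
  qed
  show ?thesis unfolding mrange_subset_iff[OF A(3) B(3)]
  proof
    assume "\<exists>M \<in> carrier_mat n n. A = B * M"
    then obtain M where M: "M \<in> carrier_mat n n" "A = B * M" by blast
    \<comment> \<open>Eigenvalues of the kernel projection of B; it kills B and therefore A = B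
      M.\<close>
    define h where "h j = (if b j = 0 then 1 else 0 :: complex)" for j
    have "diagc n V h * B = diagc n V (\<lambda>_. 0)"
      unfolding B(2) diagc_mult[OF B(1)] by (intro diagc_cong) (auto simp: h_def)
    then have "diagc n V h * A = 0\<^sub>m n n"
      using M V B(3) by (simp add: diagc_zero sq_assoc[symmetric, of _ n])
    then have *: "V * mat n n (\<lambda>(j,i). h j * (adj V * U) $$ (j,i) * complex_of_real (a i)) * adj U = 0\<^sub>m n n" (is "V * ?Z * adj U = _")
      using diagc_mult_mixed[OF U(1) V(1)] A(2) by metis
    have "?Z = adj V * (V * ?Z * adj U) * U"
      using U V by (simp add: sq_assoc[of _ n] sq_mult_carrier unitary_cancel[OF B(1), of _ n])
    also have "\<dots> = 0\<^sub>m n n" unfolding * using U V by simp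
    finally have Z: "?Z = 0\<^sub>m n n" .
    show "\<forall>i<n. \<forall>j<n. a i \<noteq> 0 \<and> b j = 0 \<longrightarrow> overlap U V i j = 0"
    proof (intro allI impI)
      fix i j assume ij: "i < n" "j < n" and ab: "a i \<noteq> 0 \<and> b j = 0"
      have "?Z $$ (j,i) = 0" using Z ij by simp
      then have "(adj V * U) $$ (j,i) = 0" using ab ij by (simp add: h_def)
      then show "overlap U V i j = 0" using overlap0 ij by simp
    qed
  next
    assume *: "\<forall>i<n. \<forall>j<n. a i \<noteq> 0 \<and> b j = 0 \<longrightarrow> overlap U V i j = 0"
    \<comment> \<open>Eigenvalues of the pseudo-inverse of B. Its product with B is the support
      projection of B, which fixes A by the hypothesis on overlaps.\<close>
    define h where "h j = (if b j = 0 then 0 else inverse (complex_of_real (b j)))" for j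
    have "A = diagc n V (\<lambda>_. 1) * A" using A(3) by (simp add: diagc_one[OF B(1)])
    also have "\<dots> = V * mat n n (\<lambda>(j,i). 1 * (adj V * U) $$ (j,i) * complex_of_real (a i)) * adj U"
      unfolding A(2) diagc_mult_mixed[OF U(1) V(1)] by simp
    also have "mat n n (\<lambda>(j,i). 1 * (adj V * U) $$ (j,i) * complex_of_real (a i))
       = mat n n (\<lambda>(j,i). complex_of_real (b j) * h j * (adj V * U) $$ (j,i) * complex_of_real (a i))"
    proof (intro eq_matI)
      fix j i assume "j < dim_row (mat n n (\<lambda>(j,i). complex_of_real (b j) * h j * (adj V * U) $$ (j,i) * complex_of_real (a i)))"
        and "i < dim_col (mat n n (\<lambda>(j,i). complex_of_real (b j) * h j * (adj V * U) $$ (j,i) * complex_of_real (a i)))"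
      then have ij: "i < n" "j < n" by auto
      have "b j = 0 \<Longrightarrow> a i \<noteq> 0 \<Longrightarrow> (adj V * U) $$ (j,i) = 0" using * ij overlap0 by blast
      then show "mat n n (\<lambda>(j,i). 1 * (adj V * U) $$ (j,i) * complex_of_real (a i)) $$ (j,i) =
         mat n n (\<lambda>(j,i). complex_of_real (b j) * h j * (adj V * U) $$ (j,i) * complex_of_real (a i)) $$ (j,i)"
        using ij by (cases "b j = 0"; cases "a i = 0") (auto simp: h_def)
    qed auto
    also have "V * \<dots> * adj U = diagc n V (\<lambda>j. complex_of_real (b j) * h j) * A"
      unfolding A(2) diagc_mult_mixed[OF U(1) V(1)] by simp
    also have "\<dots> = B * (diagc n V h * A)"
      using A(3) B V(1) by (simp add: diagc_mult[OF B(1), symmetric] sq_assoc[of _ n])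
    finally show "\<exists>M \<in> carrier_mat n n. A = B * M"
      using A(3) V(1) by (intro bexI[of _ "diagc n V h * A"]) (auto simp: sq_mult_carrier)
  qed
qed

text \<open>With \<open>w\<close> the overlaps this is Umegaki's relative entropy, written as the
  classical one of the two measures with masses w i j * a i and w i j * b j (the Nussbaum-Szkola
  distributions), provided the supports are compatible.\<close>

definition rel_ent :: "nat \<Rightarrow> (nat \<Rightarrow> nat \<Rightarrow> real) \<Rightarrow> (nat \<Rightarrow> real) \<Rightarrow> (nat \<Rightarrow> real) \<Rightarrow> real" where
  "rel_ent n w a b = (\<Sum>i<n. \<Sum>j<n. w i j * (a i * (ln (a i) - ln (b j))))"

lemma qrel_spec:
  assumes "spectral_dec n U a A" "spectral_dec n V b B"
  shows "qrel A B = (if \<forall>i<n. \<forall>j<n. a i \<noteq> 0 \<and> b j = 0 \<longrightarrow> overlap U V i j = 0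
    then ereal (rel_ent n (overlap U V) a b) else \<infinity>)"
proof -
  note A = specD[OF assms(1)] and B = specD[OF assms(2)]
  note U = unitary_matD[OF A(1)] and V = unitary_matD[OF B(1)]
  have lc: "mlog A \<in> carrier_mat n n" "mlog B \<in> carrier_mat n n"
    unfolding mlog_def mfun_spec[OF assms(1)] mfun_spec[OF assms(2)] using U V by simp_all
  have "mtrace (A * (mlog A - mlog B)) = mtrace (A * mlog A) - mtrace (A * mlog B)"
    using A(3) lc by (simp add: mult_minus_distrib_mat[of _ n n _ n] mtrace_minus[of _ n] sq_mult_carrier)
  also have "mtrace (A * mlog A) = (\<Sum>i<n. complex_of_real (a i * ln (a i)))"
    unfolding mlog_def mfun_spec[OF assms(1)] unfolding A(2) diagc_mult[OF A(1)] mtrace_diagc[OF A(1)] by simp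
  also have "\<dots> = (\<Sum>i<n. complex_of_real ((\<Sum>j<n. overlap U V i j) * (a i * ln (a i))))"
    using overlap_sum_right[OF A(1) B(1)] by simp
  also have "mtrace (A * mlog B) = (\<Sum>i<n. \<Sum>j<n. complex_of_real (overlap U V i j) * (complex_of_real (a i) * complex_of_real (ln (b j))))"
    unfolding mlog_def mfun_spec[OF assms(2)] unfolding A(2) by (rule mtrace_diagc_diagc[OF A(1) B(1)])
  finally have "mtrace (A * (mlog A - mlog B)) = complex_of_real (rel_ent n (overlap U V) a b)"
    unfolding rel_ent_def
    by (simp add: sum_subtractf sum_distrib_left sum_distrib_right algebra_simps)
  then have "Re (mtrace (A * (mlog A - mlog B))) = rel_ent n (overlap U V) a b" by simp
  then show ?thesis unfolding qrel_def mrange_spec_iff[OF assms] by (simp only:)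
qed

section \<open>Tensor powers\<close>

lemma mult_add_less:
  assumes "i < n" "j < (m::nat)"
  shows "i * m + j < n * m"
proof -
  have "i * m + j < Suc i * m" using assms by simp
  also have "\<dots> \<le> n * m" using assms by (intro mult_le_mono1) simp
  finally show ?thesis .
qed

lemma sum_div_mod:
  fixes f :: "nat \<Rightarrow> nat \<Rightarrow> 'a::comm_monoid_add"
  shows "(\<Sum>k<n*m. f (k div m) (k mod m)) = (\<Sum>i<n. \<Sum>j<m. f i j)"
proof (cases "m = 0")
  case False
  then have "(\<Sum>k<n*m. f (k div m) (k mod m)) = (\<Sum>(i,j)\<in>{..<n}\<times>{..<m}. f i j)"
    by (intro sum.reindex_bij_witness[where j = "\<lambda>k. (k div m, k mod m)" and i = "\<lambda>(i,j). i * m + j"])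
       (auto simp: less_mult_imp_div_less mult_add_less)
  then show ?thesis by (simp add: sum.cartesian_product)
qed simp

lemma kron_carrier [simp]:
  "A \<in> carrier_mat n n' \<Longrightarrow> B \<in> carrier_mat m m' \<Longrightarrow> kron A B \<in> carrier_mat (n*m) (n'*m')"
  by (auto simp: kron_def)

lemma kron_index:
  assumes "A \<in> carrier_mat n n'" "B \<in> carrier_mat m m'" "i < n*m" "j < n'*m'"
  shows "kron A B $$ (i,j) = A $$ (i div m, j div m') * B $$ (i mod m, j mod m')"
  using assms by (simp add: kron_def)

lemma div_mod_less:
  assumes "i < n * (m::nat)"
  shows "i div m < n" "i mod m < m"
  using assms by (auto simp: less_mult_imp_div_less intro!: mod_less_divisor gr0I)

lemma kron_mult:
  assumes "A \<in> carrier_mat n n" "C \<in> carrier_mat n n" "B \<in> carrier_mat m m" "D \<in> carrier_mat m m"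
  shows "kron A B * kron C D = kron (A * C) (B * D)"
proof (rule eq_matI)
  fix i j assume "i < dim_row (kron (A * C) (B * D))" "j < dim_col (kron (A * C) (B * D))"
  then have ij: "i < n*m" "j < n*m" using assms by (auto simp: kron_def)
  note dm = div_mod_less[OF ij(1)] div_mod_less[OF ij(2)]
  have "(kron A B * kron C D) $$ (i,j) = (\<Sum>l<n*m. kron A B $$ (i,l) * kron C D $$ (l,j))"
    using assms ij by (intro mult_index_sum[of _ "n*m" "n*m" _ "n*m"]) auto
  also have "\<dots> = (\<Sum>l<n*m. (A $$ (i div m, l div m) * B $$ (i mod m, l mod m)) * (C $$ (l div m, j div m) * D $$ (l mod m, j mod m)))"
    using assms ij by (intro sum.cong refl) (simp add: kron_index[of _ n n _ m m])
  also have "\<dots> = (\<Sum>k<n. \<Sum>l<m. (A $$ (i div m, k) * B $$ (i mod m, l)) * (C $$ (k, j div m) * D $$ (l, j mod m)))"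
    by (rule sum_div_mod)
  also have "\<dots> = (\<Sum>k<n. A $$ (i div m, k) * C $$ (k, j div m)) * (\<Sum>l<m. B $$ (i mod m, l) * D $$ (l, j mod m))"
    by (simp add: sum_product algebra_simps)
  also have "\<dots> = (A * C) $$ (i div m, j div m) * (B * D) $$ (i mod m, j mod m)"
    using assms dm by (simp add: mult_index_sum[of _ n n _ n] mult_index_sum[of _ m m _ m])
  also have "\<dots> = kron (A * C) (B * D) $$ (i,j)"
    using assms ij by (intro kron_index[of _ n n _ m m, symmetric]) (auto simp: sq_mult_carrier)
  finally show "(kron A B * kron C D) $$ (i,j) = kron (A * C) (B * D) $$ (i,j)" .
qed (use assms in \<open>auto simp: kron_def\<close>)

lemma adj_kron:
  assumes "A \<in> carrier_mat n n" "B \<in> carrier_mat m m"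
  shows "adj (kron A B) = kron (adj A) (adj B)"
proof (rule eq_matI)
  fix i j assume "i < dim_row (kron (adj A) (adj B))" "j < dim_col (kron (adj A) (adj B))"
  then have ij: "i < n*m" "j < n*m" using assms by (auto simp: kron_def)
  note dm = div_mod_less[OF ij(1)] div_mod_less[OF ij(2)]
  have k: "kron A B \<in> carrier_mat (n*m) (n*m)" using assms by simp
  then have "adj (kron A B) $$ (i,j) = cnj (kron A B $$ (j,i))" using ij by (intro adj_index) auto
  then show "adj (kron A B) $$ (i,j) = kron (adj A) (adj B) $$ (i,j)"
    using assms ij dm by (simp add: kron_index[of _ n n _ m m])
qed (use assms in \<open>auto simp: kron_def\<close>)

lemma kron_mat_diag: "kron (mat_diag n f) (mat_diag m g) = mat_diag (n*m) (\<lambda>k. f (k div m) * g (k mod m))"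
proof (rule eq_matI)
  fix i j assume "i < dim_row (mat_diag (n*m) (\<lambda>k. f (k div m) * g (k mod m)))"
    "j < dim_col (mat_diag (n*m) (\<lambda>k. f (k div m) * g (k mod m)))"
  then have ij: "i < n*m" "j < n*m" by auto
  have "i = j \<longleftrightarrow> i div m = j div m \<and> i mod m = j mod m" by (metis div_mult_mod_eq)
  then show "kron (mat_diag n f) (mat_diag m g) $$ (i,j) = mat_diag (n*m) (\<lambda>k. f (k div m) * g (k mod m)) $$ (i,j)"
    using ij div_mod_less[OF ij(1)] div_mod_less[OF ij(2)]
    by (auto simp: kron_index[of _ n n _ m m] mat_diag_index)
qed (auto simp: kron_def)

lemma kron_one: "kron (1\<^sub>m n) (1\<^sub>m m) = 1\<^sub>m (n*m)"
  using kron_mat_diag[of n "\<lambda>_. 1" m "\<lambda>_. 1"] by simp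

lemma unitary_kron:
  assumes "unitary_mat n U" "unitary_mat m V"
  shows "unitary_mat (n*m) (kron U V)"
  using unitary_matD[OF assms(1)] unitary_matD[OF assms(2)]
  by (auto simp: unitary_mat_def adj_kron[of _ n _ m] kron_mult[of _ n _ _ m] kron_one)

lemma kron_diagc:
  assumes "U \<in> carrier_mat n n" "V \<in> carrier_mat m m"
  shows "kron (diagc n U f) (diagc m V g) = diagc (n*m) (kron U V) (\<lambda>k. f (k div m) * g (k mod m))"
  using assms
  by (simp add: diagc_def adj_kron[of _ n _ m] kron_mat_diag[symmetric] kron_mult[of _ n _ _ m] sq_mult_carrier)

lemma spec_kron:
  assumes "spectral_dec n U a A" "spectral_dec m V b B"
  shows "spectral_dec (n*m) (kron U V) (\<lambda>k. a (k div m) * b (k mod m)) (kron A B)"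
proof -
  note A = specD[OF assms(1)] and B = specD[OF assms(2)]
  show ?thesis unfolding spectral_dec_def
    using unitary_kron[OF A(1) B(1)] kron_diagc[OF unitary_matD(1)[OF A(1)] unitary_matD(1)[OF B(1)]] A(2) B(2)
    by simp
qed

lemma overlap_kron:
  assumes "U \<in> carrier_mat n n" "U' \<in> carrier_mat m m" "V \<in> carrier_mat n n" "V' \<in> carrier_mat m m"
    and "k < n*m" "l < n*m"
  shows "overlap (kron U U') (kron V V') k l = overlap U V (k div m) (l div m) * overlap U' V' (k mod m) (l mod m)"
proof -
  have "adj (kron U U') * kron V V' = kron (adj U * V) (adj U' * V')"
    using assms by (simp add: adj_kron[of _ n _ m] kron_mult[of _ n _ _ m])
  then have "(adj (kron U U') * kron V V') $$ (k,l)
      = (adj U * V) $$ (k div m, l div m) * (adj U' * V') $$ (k mod m, l mod m)"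
    using kron_index[of "adj U * V" n n "adj U' * V'" m m k l] assms by (simp add: sq_mult_carrier)
  then show ?thesis by (simp add: overlap_def norm_mult power_mult_distrib)
qed

section \<open>Spectra of tensor powers and additivity of relative entropy\<close>

lemma tpow_carrier [simp]: "A \<in> carrier_mat d d \<Longrightarrow> tpow n A \<in> carrier_mat (d^n) (d^n)"
proof (induction n)
  case (Suc n)
  then show ?case using kron_carrier[of "tpow n A" "d^n" "d^n" A d d] by (simp add: mult.commute)
qed simp

lemma tpow_mult:
  assumes "A \<in> carrier_mat d d" "B \<in> carrier_mat d d"
  shows "tpow n (A * B) = tpow n A * tpow n B"
proof (induction n)
  case (Suc n)
  then show ?case using assms kron_mult[of "tpow n A" "d^n" "tpow n B" A d B] by simp
qed simp

lemma adj_tpow: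
  assumes "A \<in> carrier_mat d d"
  shows "adj (tpow n A) = tpow n (adj A)"
proof (induction n)
  case (Suc n)
  then show ?case using assms adj_kron[of "tpow n A" "d^n" A d] by simp
qed simp

lemma tpow_one: "tpow n (1\<^sub>m d) = 1\<^sub>m (d^n)"
  by (induction n) (simp_all add: kron_one mult.commute)

lemma unitary_tpow:
  assumes "unitary_mat d U"
  shows "unitary_mat (d^n) (tpow n U)"
proof -
  note U = unitary_matD[OF assms]
  show ?thesis unfolding unitary_mat_def adj_tpow[OF U(1)] tpow_mult[OF U(1,2), symmetric] tpow_mult[OF U(2,1), symmetric]
    U(3,4) tpow_one using U by simp
qed

text \<open>The index k is read as n digits in base d, and the value is the product of the
  eigenvalues at these digits. The last digit belongs to the last tensor factor, as in
  \<open>tpow\<close>.\<close>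

fun tvec :: "nat \<Rightarrow> nat \<Rightarrow> (nat \<Rightarrow> real) \<Rightarrow> nat \<Rightarrow> real" where
  "tvec d 0 a k = 1"
| "tvec d (Suc n) a k = tvec d n a (k div d) * a (k mod d)"

lemma spec_tpow:
  assumes "spectral_dec d U a A"
  shows "spectral_dec (d^n) (tpow n U) (tvec d n a) (tpow n A)"
proof (induction n)
  case 0
  have "1\<^sub>m (Suc 0) = diagc (Suc 0) (1\<^sub>m (Suc 0)) (\<lambda>_. 1)"
    using diagc_one[of "Suc 0" "1\<^sub>m (Suc 0)"] by simp
  then show ?case by (simp add: spectral_dec_def)
next
  case (Suc n)
  from spec_kron[OF Suc assms] show ?case by (simp add: mult.commute)
qed

lemma tvec_nonneg:
  assumes "\<And>i. i < d \<Longrightarrow> 0 \<le> a i" "k < d^n"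
  shows "0 \<le> tvec d n a k"
  using assms(2)
proof (induction n arbitrary: k)
  case (Suc n)
  then have "k < d^n * d" by (simp add: mult.commute)
  from div_mod_less[OF this] show ?case using Suc.IH assms(1) by simp
qed simp

lemma tvec_sum:
  assumes "(\<Sum>i<d. a i) = 1"
  shows "(\<Sum>k<d^n. tvec d n a k) = 1"
proof (induction n)
  case (Suc n)
  have "(\<Sum>k<d^Suc n. tvec d (Suc n) a k) = (\<Sum>k<d^n*d. tvec d n a (k div d) * a (k mod d))"
    by (simp add: mult.commute)
  also have "\<dots> = (\<Sum>i<d^n. \<Sum>j<d. tvec d n a i * a j)" by (rule sum_div_mod)
  also have "\<dots> = 1" using Suc assms by (simp add: sum_distrib_left[symmetric])
  finally show ?case .
qed simp

text \<open>The range inclusion of \<open>mrange_spec_iff\<close> in terms of weights, so that it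
  can be used without reference to matrices.\<close>

definition supp_le :: "nat \<Rightarrow> (nat \<Rightarrow> nat \<Rightarrow> real) \<Rightarrow> (nat \<Rightarrow> real) \<Rightarrow> (nat \<Rightarrow> real) \<Rightarrow> bool" where
  "supp_le n w a b \<longleftrightarrow> (\<forall>i<n. \<forall>j<n. a i \<noteq> 0 \<and> b j = 0 \<longrightarrow> w i j = 0)"

lemma supp_leD: "supp_le n w a b \<Longrightarrow> i < n \<Longrightarrow> j < n \<Longrightarrow> a i \<noteq> 0 \<Longrightarrow> b j = 0 \<Longrightarrow> w i j = 0"
  by (simp add: supp_le_def)

lemma rel_ent_kron:
  assumes supp: "supp_le n w a b" "supp_le m w' a' b'"
    and nn: "\<And>i. i < n \<Longrightarrow> 0 \<le> a i" "\<And>i. i < n \<Longrightarrow> 0 \<le> b i" "\<And>i. i < m \<Longrightarrow> 0 \<le> a' i" "\<And>i. i < m \<Longrightarrow> 0 \<le> b' i"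
    and w: "\<And>i. i < n \<Longrightarrow> (\<Sum>j<n. w i j) = 1" "\<And>i. i < m \<Longrightarrow> (\<Sum>j<m. w' i j) = 1"
    and s: "(\<Sum>i<n. a i) = 1" "(\<Sum>i<m. a' i) = 1"
  defines "W \<equiv> (\<lambda>k l. w (k div m) (l div m) * w' (k mod m) (l mod m))"
    and "A \<equiv> (\<lambda>k. a (k div m) * a' (k mod m))" and "B \<equiv> (\<lambda>k. b (k div m) * b' (k mod m))"
  shows "supp_le (n*m) W A B" "rel_ent (n*m) W A B = rel_ent n w a b + rel_ent m w' a' b'"
proof -
  show "supp_le (n*m) W A B" unfolding supp_le_def
  proof (intro allI impI)
    fix k l assume kl: "k < n*m" "l < n*m" "A k \<noteq> 0 \<and> B l = 0"
    then show "W k l = 0"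
      using supp_leD[OF supp(1)] supp_leD[OF supp(2)] div_mod_less[OF kl(1)] div_mod_less[OF kl(2)]
      by (auto simp: W_def A_def B_def)
  qed
  \<comment> \<open>The logarithm of a product splits only for positive factors. If the total weight
    on the left vanishes, then so does each summand on the right; otherwise the support conditions
    make all four eigenvalues positive.\<close>
  have term_eq: "w i j * w' i' j' * (a i * a' i' * (ln (a i * a' i') - ln (b j * b' j')))
     = (w i j * (a i * (ln (a i) - ln (b j)))) * (w' i' j' * a' i') + (w i j * a i) * (w' i' j' * (a' i' * (ln (a' i') - ln (b' j'))))"
    if "i < n" "j < n" "i' < m" "j' < m" for i j i' j'
  proof (cases "w i j * a i * (w' i' j' * a' i') = 0")
    case False
    then have "a i > 0" "a' i' > 0" "w i j \<noteq> 0" "w' i' j' \<noteq> 0" using nn that by (force simp: less_le)+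
    moreover from this have "b j > 0" "b' j' > 0"
      using nn(2)[OF that(2)] nn(4)[OF that(4)] supp_leD[OF supp(1) that(1,2)] supp_leD[OF supp(2) that(3,4)]
      by (force simp: less_le)+
    ultimately show ?thesis by (simp add: ln_mult algebra_simps)
  qed auto
  have wa: "(\<Sum>i<n. \<Sum>j<n. w i j * a i) = 1" "(\<Sum>i<m. \<Sum>j<m. w' i j * a' i) = 1"
    using w s by (simp_all add: sum_distrib_right[symmetric])
  have "rel_ent (n*m) W A B = (\<Sum>k<n*m. \<Sum>l<n*m. w (k div m) (l div m) * w' (k mod m) (l mod m) *
      (a (k div m) * a' (k mod m) * (ln (a (k div m) * a' (k mod m)) - ln (b (l div m) * b' (l mod m)))))"
    by (simp add: rel_ent_def W_def A_def B_def)
  also have "\<dots> = (\<Sum>k<n*m. \<Sum>j<n. \<Sum>j'<m. w (k div m) j * w' (k mod m) j' *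
      (a (k div m) * a' (k mod m) * (ln (a (k div m) * a' (k mod m)) - ln (b j * b' j'))))"
    by (intro sum.cong refl sum_div_mod)
  also have "\<dots> = (\<Sum>i<n. \<Sum>i'<m. \<Sum>j<n. \<Sum>j'<m. w i j * w' i' j' * (a i * a' i' * (ln (a i * a' i') - ln (b j * b' j'))))"
    by (rule sum_div_mod)
  also have "\<dots> = (\<Sum>i<n. \<Sum>i'<m. \<Sum>j<n. \<Sum>j'<m. (w i j * (a i * (ln (a i) - ln (b j)))) * (w' i' j' * a' i')
      + (w i j * a i) * (w' i' j' * (a' i' * (ln (a' i') - ln (b' j')))))"
    using term_eq by (intro sum.cong refl) auto
  also have "\<dots> = (\<Sum>i<n. \<Sum>j<n. w i j * (a i * (ln (a i) - ln (b j)))) * (\<Sum>i'<m. \<Sum>j'<m. w' i' j' * a' i')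
      + (\<Sum>i<n. \<Sum>j<n. w i j * a i) * (\<Sum>i'<m. \<Sum>j'<m. w' i' j' * (a' i' * (ln (a' i') - ln (b' j'))))"
    unfolding sum.distrib by (simp only: sum_product)
  also have "\<dots> = rel_ent n w a b + rel_ent m w' a' b'" unfolding wa by (simp add: rel_ent_def)
  finally show "rel_ent (n*m) W A B = rel_ent n w a b + rel_ent m w' a' b'" .
qed

section \<open>Positivity through quadratic forms, and spectra of density matrices\<close>

definition quad_form :: "nat \<Rightarrow> complex mat \<Rightarrow> (nat \<Rightarrow> complex) \<Rightarrow> real" where
  "quad_form n A v = Re (\<Sum>i<n. \<Sum>j<n. cnj (v i) * A $$ (i,j) * v j)"

lemma density_quad_form:
  "density d \<rho> \<longleftrightarrow> \<rho> \<in> carrier_mat d d \<and> adj \<rho> = \<rho> \<and> (\<forall>v. 0 \<le> quad_form d \<rho> v) \<and> mtrace \<rho> = 1"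
proof -
  have 1: "Re (\<Sum>i<d. cnj (v $ i) * (\<rho> *\<^sub>v v) $ i) = quad_form d \<rho> (\<lambda>i. v $ i)"
    if "\<rho> \<in> carrier_mat d d" "v \<in> carrier_vec d" for v
    unfolding quad_form_def using that
    by (intro arg_cong[of _ _ Re] sum.cong refl)
       (auto simp: scalar_prod_def atLeast0LessThan sum_distrib_left mult.assoc intro!: sum.cong)
  have 2: "quad_form d \<rho> v = quad_form d \<rho> (\<lambda>i. vec d v $ i)" for v
    by (simp add: quad_form_def)
  have "(\<forall>v \<in> carrier_vec d. 0 \<le> Re (\<Sum>i<d. cnj (v $ i) * (\<rho> *\<^sub>v v) $ i)) \<longleftrightarrow> (\<forall>v. 0 \<le> quad_form d \<rho> v)"
    if \<rho>: "\<rho> \<in> carrier_mat d d"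
  proof safe
    fix v assume "\<forall>v \<in> carrier_vec d. 0 \<le> Re (\<Sum>i<d. cnj (v $ i) * (\<rho> *\<^sub>v v) $ i)"
    then have "0 \<le> Re (\<Sum>i<d. cnj (vec d v $ i) * (\<rho> *\<^sub>v vec d v) $ i)" using vec_carrier by blast
    then show "0 \<le> quad_form d \<rho> v" unfolding 1[OF \<rho> vec_carrier] 2[of v] .
  next
    fix v :: "complex vec" assume "\<forall>v. 0 \<le> quad_form d \<rho> v" "v \<in> carrier_vec d"
    then show "0 \<le> Re (\<Sum>i<d. cnj (v $ i) * (\<rho> *\<^sub>v v) $ i)" using 1[OF \<rho>] by simp
  qed
  then show ?thesis unfolding density_def by blast
qed

lemma quad_form_diagc:
  assumes "U \<in> carrier_mat n n"
  shows "quad_form n (diagc n U (\<lambda>i. complex_of_real (a i))) v = (\<Sum>k<n. a k * (cmod (\<Sum>i<n. cnj (U $$ (i,k)) * v i))\<^sup>2)"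
proof -
  have "(\<Sum>i<n. \<Sum>j<n. cnj (v i) * diagc n U (\<lambda>i. complex_of_real (a i)) $$ (i,j) * v j)
     = (\<Sum>i<n. \<Sum>j<n. \<Sum>k<n. complex_of_real (a k) * ((cnj (v i) * U $$ (i,k)) * (cnj (U $$ (j,k)) * v j)))"
    using assms by (intro sum.cong refl) (simp add: diagc_index sum_distrib_left sum_distrib_right algebra_simps)
  also have "\<dots> = (\<Sum>i<n. \<Sum>k<n. \<Sum>j<n. complex_of_real (a k) * ((cnj (v i) * U $$ (i,k)) * (cnj (U $$ (j,k)) * v j)))"
    by (intro sum.cong refl sum.swap)
  also have "\<dots> = (\<Sum>k<n. \<Sum>i<n. \<Sum>j<n. complex_of_real (a k) * ((cnj (v i) * U $$ (i,k)) * (cnj (U $$ (j,k)) * v j)))"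
    by (rule sum.swap)
  also have "\<dots> = (\<Sum>k<n. complex_of_real (a k) * (cnj (\<Sum>i<n. cnj (U $$ (i,k)) * v i) * (\<Sum>i<n. cnj (U $$ (i,k)) * v i)))"
    by (intro sum.cong refl) (simp add: sum_product sum_distrib_left cnj_sum mult.commute)
  also have "\<dots> = complex_of_real (\<Sum>k<n. a k * (cmod (\<Sum>i<n. cnj (U $$ (i,k)) * v i))\<^sup>2)"
    unfolding mult_cnj_cmod by simp
  finally show ?thesis unfolding quad_form_def by simp
qed

lemma density_spec:
  assumes "density d \<rho>"
  obtains U a where "spectral_dec d U a \<rho>" "\<And>i. i < d \<Longrightarrow> 0 \<le> a i" "(\<Sum>i<d. a i) = 1"
proof -
  note D = assms[unfolded density_quad_form]
  obtain U a where s: "spectral_dec d U a \<rho>" using D spectral_hermitian by metis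
  note S = specD[OF s] and U = unitary_matD[OF specD(1)[OF s]]
  have "0 \<le> a k" if k: "k < d" for k
  proof -
    have orth: "(\<Sum>i<d. cnj (U $$ (i,l)) * U $$ (i,k)) = (if l = k then 1 else 0)" if "l < d" for l
    proof -
      have "(\<Sum>i<d. cnj (U $$ (i,l)) * U $$ (i,k)) = (adj U * U) $$ (l,k)"
        using U k that by (subst mult_index_sum[of _ d d _ d]) (auto intro!: sum.cong)
      then show ?thesis using U k that by simp
    qed
    \<comment> \<open>The k-th column of U is an eigenvector; testing positivity on it isolates the
      eigenvalue a k.\<close>
    have "quad_form d \<rho> (\<lambda>i. U $$ (i,k)) = (\<Sum>l<d. a l * (cmod (if l = k then 1 else 0))\<^sup>2)"
      unfolding S(2) quad_form_diagc[OF U(1)] using orth by simp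
    also have "\<dots> = (\<Sum>l<d. if l = k then a l else 0)" by (intro sum.cong refl) auto
    also have "\<dots> = a k" using k by (simp add: sum.delta)
    finally show ?thesis using D by metis
  qed
  moreover have "(\<Sum>i<d. a i) = 1"
  proof -
    have "complex_of_real (\<Sum>i<d. a i) = mtrace \<rho>" unfolding S(2) mtrace_diagc[OF S(1)] by simp
    then show ?thesis using D of_real_eq_1_iff by metis
  qed
  ultimately show ?thesis using that s by blast
qed

lemma spec_density:
  assumes "spectral_dec d U a \<rho>" "\<And>i. i < d \<Longrightarrow> 0 \<le> a i" "(\<Sum>i<d. a i) = 1"
  shows "density d \<rho>"
proof -
  note S = specD[OF assms(1)]
  have "0 \<le> quad_form d \<rho> v" for v
    unfolding S(2) quad_form_diagc[OF unitary_matD(1)[OF S(1)]] using assms(2) by (intro sum_nonneg) auto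
  moreover have "mtrace \<rho> = 1" unfolding S(2) mtrace_diagc[OF S(1)] using assms(3)
    by (metis of_real_1 of_real_sum)
  ultimately show ?thesis using S unfolding density_quad_form by blast
qed

lemma density_tpow: "density d \<rho> \<Longrightarrow> density (d^n) (tpow n \<rho>)"
  by (elim density_spec) (rule spec_density[OF spec_tpow], auto intro: tvec_nonneg tvec_sum)

lemma qrel_tpow_spec:
  assumes \<rho>: "spectral_dec d U a \<rho>" "\<And>i. i < d \<Longrightarrow> 0 \<le> a i" "(\<Sum>i<d. a i) = 1"
    and \<sigma>: "spectral_dec d V b \<sigma>" "\<And>i. i < d \<Longrightarrow> 0 \<le> b i"
    and supp: "supp_le d (overlap U V) a b"
  shows "supp_le (d^n) (overlap (tpow n U) (tpow n V)) (tvec d n a) (tvec d n b) \<and>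
    rel_ent (d^n) (overlap (tpow n U) (tpow n V)) (tvec d n a) (tvec d n b) = real n * rel_ent d (overlap U V) a b"
proof (induction n)
  case 0
  show ?case by (simp add: supp_le_def rel_ent_def)
next
  case (Suc n)
  note uU = specD(1)[OF \<rho>(1)] and uV = specD(1)[OF \<sigma>(1)]
  have U: "U \<in> carrier_mat d d" "V \<in> carrier_mat d d" using unitary_matD(1) uU uV by auto
  define W where "W = (\<lambda>k l. overlap (tpow n U) (tpow n V) (k div d) (l div d) * overlap U V (k mod d) (l mod d))"
  have W: "overlap (tpow (Suc n) U) (tpow (Suc n) V) k l = W k l" if "k < d^n*d" "l < d^n*d" for k l
    using overlap_kron[of "tpow n U" "d^n" U d "tpow n V" V k l] U that by (simp add: W_def)
  note tU = unitary_tpow[OF uU] unitary_tpow[OF uV]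
  have "supp_le (d^n*d) W (\<lambda>k. tvec d n a (k div d) * a (k mod d)) (\<lambda>k. tvec d n b (k div d) * b (k mod d))
    \<and> rel_ent (d^n*d) W (\<lambda>k. tvec d n a (k div d) * a (k mod d)) (\<lambda>k. tvec d n b (k div d) * b (k mod d))
     = rel_ent (d^n) (overlap (tpow n U) (tpow n V)) (tvec d n a) (tvec d n b) + rel_ent d (overlap U V) a b"
    unfolding W_def
    using Suc supp \<rho> \<sigma> tvec_nonneg[of d a] tvec_nonneg[of d b] overlap_sum_right[OF uU uV] overlap_sum_right[OF tU] tvec_sum[OF \<rho>(3)]
    by (intro conjI rel_ent_kron) auto
  moreover have "supp_le (d^n*d) (overlap (tpow (Suc n) U) (tpow (Suc n) V)) A B = supp_le (d^n*d) W A B"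
    "rel_ent (d^n*d) (overlap (tpow (Suc n) U) (tpow (Suc n) V)) A B = rel_ent (d^n*d) W A B" for A B
    using W by (simp_all add: supp_le_def rel_ent_def del: tpow.simps)
  moreover have "tvec d (Suc n) a = (\<lambda>k. tvec d n a (k div d) * a (k mod d))"
    "tvec d (Suc n) b = (\<lambda>k. tvec d n b (k div d) * b (k mod d))" by auto
  ultimately show ?case using Suc
    by (simp add: mult.commute[of d] distrib_right del: tpow.simps tvec.simps)
qed

text \<open>A violation in one factor extends to all: take it as last digit, prepend any i whose
  product eigenvalue is nonzero (the eigenvalues sum to 1) and any j overlapping with i (the rows
  sum to 1). At least one factor is required, hence \<open>Suc n\<close>.\<close>

lemma qrel_tpow_spec_inf:
  assumes \<rho>: "spectral_dec d U a \<rho>" "(\<Sum>i<d. a i) = 1"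
    and \<sigma>: "spectral_dec d V b \<sigma>"
    and supp: "\<not> supp_le d (overlap U V) a b"
  shows "\<not> supp_le (d^Suc n) (overlap (tpow (Suc n) U) (tpow (Suc n) V)) (tvec d (Suc n) a) (tvec d (Suc n) b)"
proof -
  note uU = specD(1)[OF \<rho>(1)] and uV = specD(1)[OF \<sigma>(1)]
  have U: "U \<in> carrier_mat d d" "V \<in> carrier_mat d d" using unitary_matD(1) uU uV by auto
  note tU = unitary_tpow[OF uU] unitary_tpow[OF uV]
  obtain i' j' where ij': "i' < d" "j' < d" "a i' \<noteq> 0" "b j' = 0" "overlap U V i' j' \<noteq> 0"
    using supp by (auto simp: supp_le_def)
  have "\<exists>i<d^n. tvec d n a i \<noteq> 0" using tvec_sum[OF \<rho>(2), of n] by (metis lessThan_iff sum.neutral zero_neq_one)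
  then obtain i where i: "i < d^n" "tvec d n a i \<noteq> 0" by blast
  have "\<exists>j<d^n. overlap (tpow n U) (tpow n V) i j \<noteq> 0"
    using overlap_sum_right[OF tU i(1)] by (metis lessThan_iff sum.neutral zero_neq_one)
  then obtain j where j: "j < d^n" "overlap (tpow n U) (tpow n V) i j \<noteq> 0" by blast
  have k: "i * d + i' < d^n * d" "j * d + j' < d^n * d" using i j ij' by (simp_all add: mult_add_less)
  have dm: "(i * d + i') div d = i" "(i * d + i') mod d = i'" "(j * d + j') div d = j" "(j * d + j') mod d = j'"
    using ij' by auto
  have "overlap (tpow (Suc n) U) (tpow (Suc n) V) (i * d + i') (j * d + j') \<noteq> 0"
    using overlap_kron[of "tpow n U" "d^n" U d "tpow n V" V "i * d + i'" "j * d + j'"] U k dm ij' j by simp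
  moreover have "tvec d (Suc n) a (i * d + i') \<noteq> 0" "tvec d (Suc n) b (j * d + j') = 0"
    using dm ij' i by simp_all
  ultimately show ?thesis using k unfolding supp_le_def power_Suc2 by blast
qed

section \<open>Minimal projections of abelian subalgebras\<close>

lemma is_projD:
  assumes "is_proj D P"
  shows "P \<in> carrier_mat D D" "P * P = P" "adj P = P"
  using assms by (auto simp: is_proj_def)

lemma proj_spec:
  assumes "is_proj D P"
  obtains U e where "spectral_dec D U e P" "\<And>i. i < D \<Longrightarrow> e i = 0 \<or> e i = 1"
proof -
  note P = is_projD[OF assms]
  obtain U e where s: "spectral_dec D U e P" using spectral_hermitian[OF P(1,3)] .
  note S = specD[OF s]
  have "diagc D U (\<lambda>i. complex_of_real (e i) * complex_of_real (e i)) = diagc D U (\<lambda>i. complex_of_real (e i))"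
    using P(2) unfolding S(2) diagc_mult[OF S(1)] by simp
  then have "complex_of_real (e i) * complex_of_real (e i) = complex_of_real (e i)" if "i < D" for i
    using diagc_inj[OF S(1) _ that, of "\<lambda>i. complex_of_real (e i) * complex_of_real (e i)" "\<lambda>i. complex_of_real (e i)"] by simp
  then have "e i = 0 \<or> e i = 1" if "i < D" for i
    using that by (metis mult_cancel_right1 of_real_eq_0_iff of_real_eq_1_iff)
  then show ?thesis using that s by blast
qed

text \<open>The trace of a projection is its rank. Integrality is what makes counting and least-rank
  arguments on projections possible.\<close>

lemma proj_trace:
  assumes "is_proj D P"
  obtains k where "mtrace P = of_nat k" "k \<le> D" "k = 0 \<longleftrightarrow> P = 0\<^sub>m D D"
proof -
  obtain U e where s: "spectral_dec D U e P" and e: "\<And>i. i < D \<Longrightarrow> e i = 0 \<or> e i = 1"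
    using proj_spec[OF assms] by blast
  note S = specD[OF s] and U = unitary_matD[OF specD(1)[OF s]]
  define k where "k = card {i. i < D \<and> e i = 1}"
  have "mtrace P = (\<Sum>i<D. complex_of_real (e i))" unfolding S(2) mtrace_diagc[OF S(1)] by simp
  also have "\<dots> = (\<Sum>i<D. if e i = 1 then 1 else 0)" using e by (intro sum.cong refl) force
  also have "\<dots> = of_nat (card ({..<D} \<inter> {i. e i = 1}))" by (simp add: sum.If_cases)
  also have "{..<D} \<inter> {i. e i = 1} = {i. i < D \<and> e i = 1}" by auto
  finally have t: "mtrace P = of_nat k" by (simp add: k_def)
  have "{i. i < D \<and> e i = 1} \<subseteq> {..<D}" by auto
  from card_mono[OF _ this] have kD: "k \<le> D" by (simp add: k_def)
  have "P = 0\<^sub>m D D" if "k = 0"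
  proof -
    have "{i. i < D \<and> e i = 1} = {}" using that by (simp add: k_def)
    then have "P = diagc D U (\<lambda>_. 0)" unfolding S(2) using e by (intro diagc_cong) auto
    then show ?thesis using diagc_zero U by metis
  qed
  moreover have "k = 0" if "P = 0\<^sub>m D D"
  proof -
    have "mtrace P = 0" unfolding that mtrace_def by simp
    then show ?thesis using t by simp
  qed
  ultimately show ?thesis using that t kD by blast
qed

text \<open>Coefficients are indexed by the matrices themselves. The entrywise form fixes the
  dimension also for an empty family, where the result is the zero matrix.\<close>

definition lincomb :: "nat \<Rightarrow> complex mat set \<Rightarrow> (complex mat \<Rightarrow> complex) \<Rightarrow> complex mat" where
  "lincomb D F x = mat D D (\<lambda>(i,j). \<Sum>P\<in>F. x P * P $$ (i,j))"

lemma lincomb_carrier [simp]: "lincomb D F x \<in> carrier_mat D D" by (simp add: lincomb_def)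

lemma lincomb_index: "i < D \<Longrightarrow> j < D \<Longrightarrow> lincomb D F x $$ (i,j) = (\<Sum>P\<in>F. x P * P $$ (i,j))"
  by (simp add: lincomb_def)

lemma mtrace_mult_lincomb:
  assumes "A \<in> carrier_mat D D" "F \<subseteq> carrier_mat D D"
  shows "mtrace (A * lincomb D F x) = (\<Sum>P\<in>F. x P * mtrace (A * P))"
proof -
  have tr: "mtrace (A * P) = (\<Sum>i<D. \<Sum>j<D. A $$ (i,j) * P $$ (j,i))" if "P \<in> carrier_mat D D" for P
    using assms(1) that by (simp add: mtrace_def mult_index_sum[of _ D D _ D])
  have "mtrace (A * lincomb D F x) = (\<Sum>i<D. \<Sum>j<D. \<Sum>P\<in>F. x P * (A $$ (i,j) * P $$ (j,i)))"
    by (subst tr) (simp_all add: lincomb_index sum_distrib_left algebra_simps)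
  also have "\<dots> = (\<Sum>i<D. \<Sum>P\<in>F. \<Sum>j<D. x P * (A $$ (i,j) * P $$ (j,i)))"
    by (intro sum.cong refl sum.swap)
  also have "\<dots> = (\<Sum>P\<in>F. \<Sum>i<D. \<Sum>j<D. x P * (A $$ (i,j) * P $$ (j,i)))"
    by (rule sum.swap)
  also have "\<dots> = (\<Sum>P\<in>F. x P * mtrace (A * P))"
    using assms(2) by (intro sum.cong refl) (auto simp: tr sum_distrib_left)
  finally show ?thesis .
qed

lemma mult_lincomb_left:
  assumes "A \<in> carrier_mat D D" "F \<subseteq> carrier_mat D D" "i < D" "j < D"
  shows "(lincomb D F x * A) $$ (i,j) = (\<Sum>P\<in>F. x P * (P * A) $$ (i,j))"
proof -
  have "(lincomb D F x * A) $$ (i,j) = (\<Sum>l<D. \<Sum>P\<in>F. x P * (P $$ (i,l) * A $$ (l,j)))"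
    using assms by (simp add: mult_index_sum[of _ D D _ D] lincomb_index sum_distrib_right mult.assoc)
  also have "\<dots> = (\<Sum>P\<in>F. \<Sum>l<D. x P * (P $$ (i,l) * A $$ (l,j)))" by (rule sum.swap)
  also have "\<dots> = (\<Sum>P\<in>F. x P * (P * A) $$ (i,j))"
    using assms by (intro sum.cong refl) (auto simp: mult_index_sum[of _ D D _ D] sum_distrib_left)
  finally show ?thesis .
qed

lemma lincomb_mult_member:
  assumes "finite F" "F \<subseteq> carrier_mat D D" "Q \<in> F"
    and "\<And>P. P \<in> F \<Longrightarrow> P \<noteq> Q \<Longrightarrow> P * Q = 0\<^sub>m D D" "Q * Q = Q"
  shows "lincomb D F x * Q = x Q \<cdot>\<^sub>m Q"
proof (rule eq_matI)
  have Q: "Q \<in> carrier_mat D D" using assms by auto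
  fix i j assume "i < dim_row (x Q \<cdot>\<^sub>m Q)" "j < dim_col (x Q \<cdot>\<^sub>m Q)"
  then have ij: "i < D" "j < D" using Q by auto
  have "(lincomb D F x * Q) $$ (i,j) = (\<Sum>P\<in>F. x P * (P * Q) $$ (i,j))"
    by (rule mult_lincomb_left[OF Q assms(2) ij])
  also have "\<dots> = (\<Sum>P\<in>F. if P = Q then x Q * Q $$ (i,j) else 0)"
    using assms(4,5) ij by (intro sum.cong refl) auto
  also have "\<dots> = x Q * Q $$ (i,j)" using assms(1,3) by simp
  finally show "(lincomb D F x * Q) $$ (i,j) = (x Q \<cdot>\<^sub>m Q) $$ (i,j)" using ij Q by simp
qed (use assms in \<open>auto simp: lincomb_def\<close>)

lemma lincomb_mult:
  assumes "finite F" "F \<subseteq> carrier_mat D D" "\<And>P. P \<in> F \<Longrightarrow> P * P = P"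
    and "\<And>P Q. P \<in> F \<Longrightarrow> Q \<in> F \<Longrightarrow> P \<noteq> Q \<Longrightarrow> P * Q = 0\<^sub>m D D"
  shows "lincomb D F x * lincomb D F y = lincomb D F (\<lambda>P. x P * y P)"
proof (rule eq_matI)
  fix i j assume "i < dim_row (lincomb D F (\<lambda>P. x P * y P))" "j < dim_col (lincomb D F (\<lambda>P. x P * y P))"
  then have ij: "i < D" "j < D" by (auto simp: lincomb_def)
  have "(lincomb D F x * lincomb D F y) $$ (i,j) = (\<Sum>l<D. lincomb D F x $$ (i,l) * (\<Sum>Q\<in>F. y Q * Q $$ (l,j)))"
    using ij by (simp add: mult_index_sum[of _ D D _ D] lincomb_index)
  also have "\<dots> = (\<Sum>l<D. \<Sum>Q\<in>F. y Q * (lincomb D F x $$ (i,l) * Q $$ (l,j)))"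
    by (simp add: sum_distrib_left algebra_simps)
  also have "\<dots> = (\<Sum>Q\<in>F. \<Sum>l<D. y Q * (lincomb D F x $$ (i,l) * Q $$ (l,j)))" by (rule sum.swap)
  also have "\<dots> = (\<Sum>Q\<in>F. y Q * (lincomb D F x * Q) $$ (i,j))"
    using assms(2) ij by (intro sum.cong refl) (auto simp: mult_index_sum[of _ D D _ D] sum_distrib_left)
  also have "\<dots> = (\<Sum>Q\<in>F. y Q * (x Q * Q $$ (i,j)))"
  proof (intro sum.cong refl)
    fix Q assume Q: "Q \<in> F"
    have "lincomb D F x * Q = x Q \<cdot>\<^sub>m Q"
      using Q assms by (intro lincomb_mult_member) auto
    moreover have "Q \<in> carrier_mat D D" using Q assms by auto
    ultimately show "y Q * (lincomb D F x * Q) $$ (i,j) = y Q * (x Q * Q $$ (i,j))" using ij by simp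
  qed
  also have "\<dots> = lincomb D F (\<lambda>P. x P * y P) $$ (i,j)" using ij by (simp add: lincomb_index algebra_simps)
  finally show "(lincomb D F x * lincomb D F y) $$ (i,j) = lincomb D F (\<lambda>P. x P * y P) $$ (i,j)" .
qed (auto simp: lincomb_def)

lemma adj_lincomb:
  assumes "F \<subseteq> carrier_mat D D" "\<And>P. P \<in> F \<Longrightarrow> adj P = P"
  shows "adj (lincomb D F x) = lincomb D F (\<lambda>P. cnj (x P))"
proof (rule eq_matI)
  fix i j assume "i < dim_row (lincomb D F (\<lambda>P. cnj (x P)))" "j < dim_col (lincomb D F (\<lambda>P. cnj (x P)))"
  then have ij: "i < D" "j < D" by (auto simp: lincomb_def)
  have "cnj (P $$ (j,i)) = P $$ (i,j)" if "P \<in> F" for P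
  proof -
    have "adj P $$ (i,j) = cnj (P $$ (j,i))" using assms(1) that ij by (intro adj_index) auto
    then show ?thesis using assms(2)[OF that] by simp
  qed
  moreover have "adj (lincomb D F x) $$ (i,j) = cnj (lincomb D F x $$ (j,i))"
    using ij by (intro adj_index) (auto simp: lincomb_def)
  ultimately show "adj (lincomb D F x) $$ (i,j) = lincomb D F (\<lambda>P. cnj (x P)) $$ (i,j)"
    using ij by (simp add: lincomb_index)
qed (auto simp: lincomb_def)

lemma abelian_subalgD:
  assumes "abelian_subalg D B"
  shows "B \<subseteq> carrier_mat D D" "1\<^sub>m D \<in> B"
    "\<And>X Y. X \<in> B \<Longrightarrow> Y \<in> B \<Longrightarrow> X + Y \<in> B" "\<And>X Y. X \<in> B \<Longrightarrow> Y \<in> B \<Longrightarrow> X * Y \<in> B"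
    "\<And>X Y. X \<in> B \<Longrightarrow> Y \<in> B \<Longrightarrow> X * Y = Y * X"
    "\<And>c X. X \<in> B \<Longrightarrow> c \<cdot>\<^sub>m X \<in> B" "\<And>X. X \<in> B \<Longrightarrow> adj X \<in> B"
  using assms unfolding abelian_subalg_def by auto

lemma lincomb_in_subalg:
  assumes B: "abelian_subalg D B" and "finite F" "F \<subseteq> B"
  shows "lincomb D F x \<in> B"
  using assms(2,3)
proof (induction F)
  case empty
  have "lincomb D {} x = 0 \<cdot>\<^sub>m 1\<^sub>m D" by (intro eq_matI) (auto simp: lincomb_def)
  then show ?case using abelian_subalgD[OF B] by simp
next
  case (insert P F)
  then have P: "P \<in> carrier_mat D D" using abelian_subalgD(1)[OF B] by auto
  have "lincomb D (insert P F) x = x P \<cdot>\<^sub>m P + lincomb D F x"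
    using insert P by (intro eq_matI) (auto simp: lincomb_def)
  then show ?case using insert abelian_subalgD[OF B] by auto
qed

lemma min_projsD:
  assumes "P \<in> min_projs D B"
  shows "P \<in> B" "is_proj D P" "P \<noteq> 0\<^sub>m D D"
    "\<And>Q. Q \<in> B \<Longrightarrow> is_proj D Q \<Longrightarrow> Q * P = Q \<Longrightarrow> Q = 0\<^sub>m D D \<or> Q = P"
  using assms by (auto simp: min_projs_def)

text \<open>The product of commuting projections is a projection of B below both. If it were
  nonzero, minimality would identify it with P and with Q at once.\<close>

lemma min_projs_orthogonal:
  assumes B: "abelian_subalg D B" and P: "P \<in> min_projs D B" and Q: "Q \<in> min_projs D B" and "P \<noteq> Q"
  shows "P * Q = 0\<^sub>m D D"
proof -
  note mP = min_projsD[OF P] and mQ = min_projsD[OF Q]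
  note pP = is_projD[OF mP(2)] and pQ = is_projD[OF mQ(2)]
  have c: "P * Q = Q * P" using abelian_subalgD(5)[OF B mP(1) mQ(1)] .
  have 1: "P * Q * Q = P * Q" using pP pQ by (simp add: sq_assoc[of _ D])
  have 2: "P * Q * P = P * Q" using pP pQ by (metis c sq_assoc)
  have "P * Q * (P * Q) = P * Q" using pP pQ 1 2 by (metis sq_assoc sq_mult_carrier)
  moreover have "adj (P * Q) = P * Q" using pP pQ c by (simp add: adj_mult[of _ D D _ D])
  ultimately have "is_proj D (P * Q)" using pP pQ by (simp add: is_proj_def sq_mult_carrier)
  moreover have "P * Q \<in> B" using abelian_subalgD(4)[OF B mP(1) mQ(1)] .
  ultimately have "P * Q = 0\<^sub>m D D \<or> P * Q = P" "P * Q = 0\<^sub>m D D \<or> P * Q = Q"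
    using mP(4) mQ(4) 1 2 by blast+
  then show ?thesis using \<open>P \<noteq> Q\<close> by auto
qed

lemma lincomb_one_proj:
  assumes B: "abelian_subalg D B" and F: "finite F" "F \<subseteq> min_projs D B"
  shows "is_proj D (lincomb D F (\<lambda>_. 1))" "lincomb D F (\<lambda>_. 1) \<in> B"
proof -
  have FB: "F \<subseteq> B" using F min_projsD(1) by blast
  have FC: "F \<subseteq> carrier_mat D D" using FB abelian_subalgD(1)[OF B] by blast
  have pr: "P * P = P" "adj P = P" if "P \<in> F" for P using that F min_projsD(2) is_projD by blast+
  have "lincomb D F (\<lambda>_. 1) * lincomb D F (\<lambda>_. 1) = lincomb D F (\<lambda>_. 1)"
    using lincomb_mult[OF F(1) FC pr(1), of "\<lambda>_. 1" "\<lambda>_. 1"] min_projs_orthogonal[OF B] F by auto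
  moreover have "adj (lincomb D F (\<lambda>_. 1)) = lincomb D F (\<lambda>_. 1)"
    using adj_lincomb[OF FC pr(2), of "\<lambda>_. 1"] by simp
  ultimately show "is_proj D (lincomb D F (\<lambda>_. 1))" by (simp add: is_proj_def)
  show "lincomb D F (\<lambda>_. 1) \<in> B" using lincomb_in_subalg[OF B F(1) FB] .
qed

text \<open>D + 1 of them, being mutually orthogonal and nonzero, would add up to a projection of
  trace at least D + 1.\<close>

lemma finite_min_projs:
  assumes B: "abelian_subalg D B"
  shows "finite (min_projs D B)"
proof (rule ccontr)
  assume "infinite (min_projs D B)"
  then obtain F where F: "F \<subseteq> min_projs D B" "finite F" "card F = Suc D"
    using infinite_arbitrarily_large by blast
  have FC: "F \<subseteq> carrier_mat D D" using F min_projsD(1) abelian_subalgD(1)[OF B] by blast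
  obtain k where k: "mtrace (lincomb D F (\<lambda>_. 1)) = of_nat k" "k \<le> D"
    using proj_trace[OF lincomb_one_proj(1)[OF B F(2,1)]] by metis
  have tr: "Re (mtrace P) \<ge> 1" if P: "P \<in> F" for P
  proof -
    note m = min_projsD[OF subsetD[OF F(1) P]]
    obtain l where "mtrace P = of_nat l" "l = 0 \<longleftrightarrow> P = 0\<^sub>m D D" using proj_trace[OF m(2)] by metis
    then show ?thesis using m(3) by simp
  qed
  have "mtrace (lincomb D F (\<lambda>_. 1)) = mtrace (1\<^sub>m D * lincomb D F (\<lambda>_. 1))"
    by (simp add: lincomb_def)
  also have "\<dots> = (\<Sum>P\<in>F. mtrace P)"
    using FC by (subst mtrace_mult_lincomb) (auto intro!: sum.cong)
  finally have "real k = (\<Sum>P\<in>F. Re (mtrace P))" using k by (metis Re_sum complex_Re_of_nat)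
  also have "\<dots> \<ge> (\<Sum>P\<in>F. 1)" using tr by (intro sum_mono)
  finally show False using k F by simp
qed

text \<open>If the complement R of the sum were nonzero, a nonzero projection of least rank in B
  below R would be minimal, hence a summand of E, yet orthogonal to E.\<close>

lemma min_projs_sum:
  assumes B: "abelian_subalg D B"
  shows "lincomb D (min_projs D B) (\<lambda>_. 1) = 1\<^sub>m D"
proof -
  note b = abelian_subalgD[OF B]
  define E where "E = lincomb D (min_projs D B) (\<lambda>_. 1)"
  have E: "is_proj D E" "E \<in> B"
    unfolding E_def using lincomb_one_proj[OF B finite_min_projs[OF B]] by auto
  note pE = is_projD[OF E(1)]
  define R where "R = 1\<^sub>m D - E"
  have Rc: "R \<in> carrier_mat D D" using pE by (simp add: R_def minus_carrier_mat)
  have "R = 1\<^sub>m D + (-1) \<cdot>\<^sub>m E" using pE(1) unfolding R_def by (intro eq_matI) auto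
  then have RB: "R \<in> B" using b E by auto
  have RR: "R * R = R"
  proof -
    have "R * R = R * 1\<^sub>m D - R * E" unfolding R_def using pE Rc
      by (intro mult_minus_distrib_mat[of _ D D _ D]) (auto simp: minus_carrier_mat)
    also have "R * E = 1\<^sub>m D * E - E * E" unfolding R_def using pE
      by (intro minus_mult_distrib_mat[of _ D D _ _ D]) auto
    also have "\<dots> = 0\<^sub>m D D" using pE by simp
    finally show ?thesis using Rc by (intro eq_matI) auto
  qed
  have aR: "adj R = R"
  proof (rule eq_matI)
    fix i j assume ij: "i < dim_row R" "j < dim_col R"
    have "adj E $$ (i,j) = cnj (E $$ (j,i))" using ij Rc pE by (intro adj_index) auto
    then show "adj R $$ (i,j) = R $$ (i,j)" using ij Rc pE by (auto simp: R_def)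
  qed (use Rc in auto)
  have "R = 0\<^sub>m D D"
  proof (rule ccontr)
    assume R0: "R \<noteq> 0\<^sub>m D D"
    \<comment> \<open>The trace is a natural number on projections, so the floor returns the rank; a
      natural-valued function is wanted for the least-element argument.\<close>
    define rk where "rk P = nat \<lfloor>Re (mtrace P)\<rfloor>" for P
    define C where "C Q \<longleftrightarrow> Q \<in> B \<and> is_proj D Q \<and> Q \<noteq> 0\<^sub>m D D \<and> Q * R = Q" for Q
    have "C R" using RB R0 RR aR Rc by (simp add: C_def is_proj_def)
    then obtain Q where Q: "C Q" and Qmin: "\<And>Q'. C Q' \<Longrightarrow> rk Q \<le> rk Q'"
      using exists_least_iff[of "\<lambda>k. \<exists>Q. C Q \<and> rk Q = k"] by (metis not_le)
    have Qp: "Q \<in> B" "is_proj D Q" "Q \<noteq> 0\<^sub>m D D" "Q * R = Q" using Q by (auto simp: C_def)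
    note pQ = is_projD[OF Qp(2)]
    have "Q \<in> min_projs D B"
    proof -
      have "Q' = Q" if Q': "Q' \<in> B" "is_proj D Q'" "Q' * Q = Q'" "Q' \<noteq> 0\<^sub>m D D" for Q'
      proof -
        note pQ' = is_projD[OF Q'(2)]
        have "Q' * R = Q'" using Q'(3) Qp(4) pQ(1) pQ'(1) Rc by (metis sq_assoc)
        then have "C Q'" using Q' by (simp add: C_def)
        from Qmin[OF this] have le: "rk Q \<le> rk Q'" .
        have cQ: "Q * Q' = Q'" using b(5)[OF Qp(1) Q'(1)] Q'(3) by simp
        \<comment> \<open>Since Q' lies below Q, the difference is a projection; since Q' has at
          least the rank of Q, its trace is zero and it vanishes.\<close>
        define S where "S = Q - Q'"
        have Sc: "S \<in> carrier_mat D D" using pQ pQ' by (simp add: S_def minus_carrier_mat)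
        have "S * S = S * Q - S * Q'" unfolding S_def using pQ pQ'
          by (intro mult_minus_distrib_mat[of _ D D _ D]) (auto simp: minus_carrier_mat)
        also have "S * Q = Q * Q - Q' * Q" unfolding S_def using pQ pQ'
          by (intro minus_mult_distrib_mat[of _ D D _ _ D]) auto
        also have "S * Q' = Q * Q' - Q' * Q'" unfolding S_def using pQ pQ'
          by (intro minus_mult_distrib_mat[of _ D D _ _ D]) auto
        finally have "S * S = (Q - Q') - (Q' - Q')" using pQ pQ' cQ Q'(3) by simp
        also have "\<dots> = S" using pQ pQ' unfolding S_def by (intro eq_matI) auto
        finally have SS: "S * S = S" .
        have "adj S = S"
        proof (rule eq_matI)
          fix i j assume ij: "i < dim_row S" "j < dim_col S"
          have "adj Q $$ (i,j) = cnj (Q $$ (j,i))" "adj Q' $$ (i,j) = cnj (Q' $$ (j,i))"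
            using ij Sc pQ(1) pQ'(1) by (auto intro!: adj_index)
          then show "adj S $$ (i,j) = S $$ (i,j)" using ij Sc pQ pQ' by (auto simp: S_def)
        qed (use Sc in auto)
        then have Sp: "is_proj D S" using SS Sc by (simp add: is_proj_def)
        obtain k where k: "mtrace S = of_nat k" "k = 0 \<longleftrightarrow> S = 0\<^sub>m D D" using proj_trace[OF Sp] by metis
        obtain l where l: "mtrace Q = of_nat l" using proj_trace[OF Qp(2)] by metis
        obtain l' where l': "mtrace Q' = of_nat l'" using proj_trace[OF Q'(2)] by metis
        have "mtrace S = mtrace Q - mtrace Q'" unfolding S_def using pQ pQ' by (intro mtrace_minus)
        then have "real k = real l - real l'" using k l l' by (metis Re_complex_of_real minus_complex.simps(1) of_real_of_nat_eq)
        moreover have "l \<le> l'" using le l l' by (simp add: rk_def)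
        ultimately have "k = 0" by simp
        then have "S = 0\<^sub>m D D" using k by simp
        then have S0: "S $$ (i,j) = 0" if "i < D" "j < D" for i j using that by simp
        show "Q' = Q"
        proof (rule eq_matI)
          fix i j assume "i < dim_row Q" "j < dim_col Q"
          then have "i < D" "j < D" using pQ by auto
          then show "Q' $$ (i,j) = Q $$ (i,j)" using S0[of i j] pQ(1) pQ'(1) by (simp add: S_def)
        qed (use pQ pQ' in auto)
      qed
      then show ?thesis using Qp by (auto simp: min_projs_def)
    qed
    \<comment> \<open>As a minimal projection, Q is one of the mutually orthogonal summands of E, so
      Q E = Q. Together with Q R = Q and R = 1 - E this forces Q = 0.\<close>
    then have "E * Q = 1 \<cdot>\<^sub>m Q" unfolding E_def
      using finite_min_projs[OF B] min_projs_orthogonal[OF B] pQ b(1) min_projsD(1)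
      by (intro lincomb_mult_member) blast+
    then have QE: "Q * E = Q" using b(5)[OF Qp(1) E(2)] pQ by (metis eq_matI index_smult_mat mult_1)
    have "Q * R = Q * 1\<^sub>m D - Q * E" unfolding R_def using pQ pE
      by (intro mult_minus_distrib_mat[of _ D D _ D]) auto
    then have "Q = 0\<^sub>m D D" using QE pQ Qp(4) by simp
    then show False using Qp by simp
  qed
  then have R0: "R $$ (i,j) = 0" if "i < D" "j < D" for i j using that by simp
  have "E = 1\<^sub>m D"
  proof (rule eq_matI)
    fix i j assume "i < dim_row (1\<^sub>m D :: complex mat)" "j < dim_col (1\<^sub>m D :: complex mat)"
    then have "i < D" "j < D" by auto
    then show "E $$ (i,j) = 1\<^sub>m D $$ (i,j)" using R0[of i j] pE(1) by (simp add: R_def)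
  qed (use pE in auto)
  then show ?thesis by (simp add: E_def)
qed

section \<open>Monotonicity under restriction to an abelian subalgebra\<close>

text \<open>Writing \<open>ln A - ln B\<close> as an integral over \<open>T\<close> of \<open>A / (B + T A)\<close> (up to a common
  divergent constant), an inequality between the integrands gives one between the logarithmic sums.\<close>

lemma log_sum_compare:
  fixes c A B :: "'i \<Rightarrow> real" and c' A' B' :: "'k \<Rightarrow> real"
  assumes fin: "finite I" "finite K"
    and pos: "\<And>i. i \<in> I \<Longrightarrow> A i > 0 \<and> B i > 0" "\<And>k. k \<in> K \<Longrightarrow> A' k > 0 \<and> B' k > 0"
    and tot: "(\<Sum>i\<in>I. c i) = (\<Sum>k\<in>K. c' k)"
    and le: "\<And>T. T \<ge> 0 \<Longrightarrow> (\<Sum>k\<in>K. c' k * (A' k / (B' k + T * A' k))) \<le> (\<Sum>i\<in>I. c i * (A i / (B i + T * A i)))"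
  shows "(\<Sum>k\<in>K. c' k * (ln (A' k) - ln (B' k))) \<le> (\<Sum>i\<in>I. c i * (ln (A i) - ln (B i)))"
proof -
  \<comment> \<open>G is the difference of the two integrals from 0 to T, so it is nondecreasing
    from 0. Taking ln T out of each logarithm gives L; the equal total coefficients cancel ln T, and
    L, unlike the separate sums in G, can be followed term by term to infinity.\<close>
  define G where "G T = (\<Sum>i\<in>I. c i * (ln (B i + T * A i) - ln (B i))) - (\<Sum>k\<in>K. c' k * (ln (B' k + T * A' k) - ln (B' k)))" for T
  define L where "L T = (\<Sum>i\<in>I. c i * (ln (B i / T + A i) - ln (B i))) - (\<Sum>k\<in>K. c' k * (ln (B' k / T + A' k) - ln (B' k)))" for T
  have der: "(G has_real_derivative (\<Sum>i\<in>I. c i * (A i / (B i + T * A i))) - (\<Sum>k\<in>K. c' k * (A' k / (B' k + T * A' k)))) (at T)"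
    if "T \<ge> 0" for T
  proof -
    have p: "B i + T * A i > 0" if "i \<in> I" for i using pos(1)[OF that] \<open>T \<ge> 0\<close> by (simp add: add_pos_nonneg)
    have p': "B' k + T * A' k > 0" if "k \<in> K" for k using pos(2)[OF that] \<open>T \<ge> 0\<close> by (simp add: add_pos_nonneg)
    have 1: "((\<lambda>T. c i * (ln (B i + T * A i) - ln (B i))) has_real_derivative c i * (A i / (B i + T * A i))) (at T)"
      if "i \<in> I" for i using p[OF that] by (auto intro!: derivative_eq_intros)
    have 2: "((\<lambda>T. c' k * (ln (B' k + T * A' k) - ln (B' k))) has_real_derivative c' k * (A' k / (B' k + T * A' k))) (at T)"
      if "k \<in> K" for k using p'[OF that] by (auto intro!: derivative_eq_intros)
    show ?thesis unfolding G_def by (intro DERIV_diff DERIV_sum 1 2)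
  qed
  have G0: "G T \<ge> 0" if "T \<ge> 0" for T
  proof -
    have "G 0 \<le> G T"
      using that by (rule DERIV_nonneg_imp_nondecreasing) (use der le in \<open>fastforce\<close>)
    moreover have "G 0 = 0" by (simp add: G_def)
    ultimately show ?thesis by simp
  qed
  have GL: "G T = L T" if T: "T > 0" for T
  proof -
    have ln_eq: "ln (b + T * a) = ln T + ln (b / T + a)" if "a > 0" "b > 0" for a b :: real
    proof -
      have "b + T * a = T * (b / T + a)" using T by (simp add: field_simps)
      moreover have "b / T + a > 0" using that T by (simp add: add_pos_pos)
      ultimately show ?thesis using T by (simp add: ln_mult)
    qed
    have "(\<Sum>i\<in>I. c i * (ln (B i + T * A i) - ln (B i))) = (\<Sum>i\<in>I. c i * ln T + c i * (ln (B i / T + A i) - ln (B i)))"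
      using pos(1) by (intro sum.cong refl) (simp add: ln_eq algebra_simps)
    moreover have "(\<Sum>k\<in>K. c' k * (ln (B' k + T * A' k) - ln (B' k))) = (\<Sum>k\<in>K. c' k * ln T + c' k * (ln (B' k / T + A' k) - ln (B' k)))"
      using pos(2) by (intro sum.cong refl) (simp add: ln_eq algebra_simps)
    ultimately show ?thesis
      unfolding G_def L_def sum.distrib using tot by (simp add: sum_distrib_right[symmetric])
  qed
  have lim1: "((\<lambda>T. ln (b / T + a)) \<longlongrightarrow> ln a) at_top" if "a > 0" for a b :: real
  proof -
    have "((\<lambda>T. b / T + a) \<longlongrightarrow> 0 + a) at_top"
      by (intro tendsto_add tendsto_const real_tendsto_divide_at_top[OF tendsto_const filterlim_ident])
    then show ?thesis using that by (intro tendsto_ln) auto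
  qed
  have "(L \<longlongrightarrow> (\<Sum>i\<in>I. c i * (ln (A i) - ln (B i))) - (\<Sum>k\<in>K. c' k * (ln (A' k) - ln (B' k)))) at_top"
    unfolding L_def using pos by (intro tendsto_diff tendsto_sum tendsto_mult tendsto_const lim1) auto
  moreover have "\<forall>\<^sub>F T in at_top. 0 \<le> L T"
    using eventually_gt_at_top[of 0] by eventually_elim (metis G0 GL less_imp_le)
  ultimately have "0 \<le> (\<Sum>i\<in>I. c i * (ln (A i) - ln (B i))) - (\<Sum>k\<in>K. c' k * (ln (A' k) - ln (B' k)))"
    by (intro tendsto_lowerbound) auto
  then show ?thesis by simp
qed

text \<open>Complete the square in each entry of \<open>X\<close>, taken between the two eigenbases.\<close>

lemma quadratic_test_bound:
  assumes \<rho>: "spectral_dec n U a \<rho>" "\<And>i. i < n \<Longrightarrow> 0 \<le> a i"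
    and \<sigma>: "spectral_dec n V b \<sigma>" "\<And>i. i < n \<Longrightarrow> 0 \<le> b i"
    and supp: "supp_le n (overlap U V) a b"
    and X: "X \<in> carrier_mat n n" "adj X = X" and t: "t \<ge> 0"
  shows "2 * Re (mtrace (\<rho> * X)) - (Re (mtrace (\<sigma> * (X * X))) + t * Re (mtrace (\<rho> * (X * X))))
    \<le> (\<Sum>i<n. \<Sum>j<n. overlap U V i j * (a i)\<^sup>2 / (b j + t * a i))"
proof -
  note S\<rho> = specD[OF \<rho>(1)] and S\<sigma> = specD[OF \<sigma>(1)]
  note U = unitary_matD[OF S\<rho>(1)] and V = unitary_matD[OF S\<sigma>(1)]
  define Z where "Z = adj V * X * U"
  define Y where "Y = adj U * V"
  have Z: "Z \<in> carrier_mat n n" and Y: "Y \<in> carrier_mat n n" using U V X by (simp_all add: Z_def Y_def sq_mult_carrier)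
  note s = sq_assoc[of _ n] sq_mult_carrier unitary_cancel[OF S\<rho>(1), of _ n] unitary_cancel[OF S\<sigma>(1), of _ n]
  have aZ: "adj Z = adj U * X * V"
    using U V X by (simp add: Z_def adj_mult[of _ n n _ n] s)
  have YZ: "adj U * X * U = Y * Z" using U V X by (simp add: Y_def Z_def s)
  have ZZ: "adj U * (X * X) * U = adj Z * Z" "adj V * (X * X) * V = Z * adj Z"
    unfolding aZ using U V X by (simp_all add: Z_def s)
  have tr: "mtrace (diagc n W f * M) = (\<Sum>i<n. f i * (adj W * M * W) $$ (i,i))"
    if "unitary_mat n W" "M \<in> carrier_mat n n" for W M f
  proof -
    have "mtrace (diagc n W f * M) = mtrace (M * diagc n W f)"
      using that unitary_matD(1)[OF that(1)] by (intro mtrace_comm[of _ n n]) auto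
    then show ?thesis using mtrace_mult_diagc[OF that] by (simp add: mult.commute)
  qed
  have XX: "X * X \<in> carrier_mat n n" using X by (simp add: sq_mult_carrier)
  have "mtrace (\<rho> * X) = (\<Sum>i<n. \<Sum>j<n. complex_of_real (a i) * (Y $$ (i,j) * Z $$ (j,i)))"
    unfolding S\<rho>(2) tr[OF S\<rho>(1) X(1)] YZ using Y Z by (simp add: mult_index_sum[of _ n n _ n] sum_distrib_left)
  then have 1: "Re (mtrace (\<rho> * X)) = (\<Sum>i<n. \<Sum>j<n. a i * Re (Y $$ (i,j) * Z $$ (j,i)))" by simp
  have "mtrace (\<rho> * (X * X)) = (\<Sum>i<n. \<Sum>j<n. complex_of_real (a i) * (cnj (Z $$ (j,i)) * Z $$ (j,i)))"
    unfolding S\<rho>(2) tr[OF S\<rho>(1) XX] ZZ using Z by (simp add: mult_index_sum[of _ n n _ n] sum_distrib_left)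
  then have 2: "Re (mtrace (\<rho> * (X * X))) = (\<Sum>i<n. \<Sum>j<n. a i * (cmod (Z $$ (j,i)))\<^sup>2)"
    unfolding mult_cnj_cmod by simp
  have "mtrace (\<sigma> * (X * X)) = (\<Sum>j<n. \<Sum>i<n. complex_of_real (b j) * (Z $$ (j,i) * cnj (Z $$ (j,i))))"
    unfolding S\<sigma>(2) tr[OF S\<sigma>(1) XX] ZZ using Z by (simp add: mult_index_sum[of _ n n _ n] sum_distrib_left)
  then have "Re (mtrace (\<sigma> * (X * X))) = (\<Sum>j<n. \<Sum>i<n. b j * (cmod (Z $$ (j,i)))\<^sup>2)"
    unfolding mult_cnj_cmod by simp
  also have "\<dots> = (\<Sum>i<n. \<Sum>j<n. b j * (cmod (Z $$ (j,i)))\<^sup>2)" by (rule sum.swap)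
  finally have 3: "Re (mtrace (\<sigma> * (X * X))) = (\<Sum>i<n. \<Sum>j<n. b j * (cmod (Z $$ (j,i)))\<^sup>2)" .
  have "2 * Re (mtrace (\<rho> * X)) - (Re (mtrace (\<sigma> * (X * X))) + t * Re (mtrace (\<rho> * (X * X))))
    = (\<Sum>i<n. \<Sum>j<n. 2 * (a i * Re (Y $$ (i,j) * Z $$ (j,i))) - (b j + t * a i) * (cmod (Z $$ (j,i)))\<^sup>2)"
    unfolding 1 2 3 by (simp add: sum_distrib_left sum.distrib sum_subtractf algebra_simps)
  also have "\<dots> \<le> (\<Sum>i<n. \<Sum>j<n. overlap U V i j * (a i)\<^sup>2 / (b j + t * a i))"
  proof (intro sum_mono)
    fix i j assume "i \<in> {..<n}" "j \<in> {..<n}"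
    then have ij: "i < n" "j < n" by auto
    define y z where "y = cmod (Y $$ (i,j))" and "z = cmod (Z $$ (j,i))"
    have o: "overlap U V i j = y\<^sup>2" by (simp add: overlap_def y_def Y_def)
    have c0: "b j + t * a i \<ge> 0" using \<rho>(2) \<sigma>(2) ij t by simp
    have r: "Re (Y $$ (i,j) * Z $$ (j,i)) \<le> y * z"
      unfolding y_def z_def norm_mult[symmetric] by (rule complex_Re_le_cmod)
    show "2 * (a i * Re (Y $$ (i,j) * Z $$ (j,i))) - (b j + t * a i) * (cmod (Z $$ (j,i)))\<^sup>2
      \<le> overlap U V i j * (a i)\<^sup>2 / (b j + t * a i)"
    proof (cases "b j + t * a i = 0")
      case True
      \<comment> \<open>With a zero denominator the right side is 0 by convention, so the left side
        must not be positive: either a i = 0, or the support condition makes the overlap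
        vanish.\<close>
      then have "b j = 0" "t * a i = 0" using \<rho>(2) \<sigma>(2) ij t by (metis add_nonneg_eq_0_iff mult_nonneg_nonneg)+
      then have "a i = 0 \<or> y = 0" using supp_leD[OF supp ij] o by auto
      then have z: "a i * Re (Y $$ (i,j) * Z $$ (j,i)) = 0" by (auto simp: y_def)
      show ?thesis unfolding True z by simp
    next
      case False
      then have c: "b j + t * a i > 0" using c0 by simp
      \<comment> \<open>The square completed for the entry of modulus z, divided by its positive
        leading coefficient.\<close>
      have "0 \<le> (a i * y - (b j + t * a i) * z)\<^sup>2 / (b j + t * a i)" using c by simp
      also have "\<dots> = y\<^sup>2 * (a i)\<^sup>2 / (b j + t * a i) - 2 * (a i * (y * z)) + (b j + t * a i) * z\<^sup>2"
        using c by (simp add: power2_eq_square field_simps)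
      finally have "2 * (a i * (y * z)) - (b j + t * a i) * z\<^sup>2 \<le> y\<^sup>2 * (a i)\<^sup>2 / (b j + t * a i)" by simp
      moreover have "a i * Re (Y $$ (i,j) * Z $$ (j,i)) \<le> a i * (y * z)" using r \<rho>(2)[OF ij(1)] by (rule mult_left_mono)
      ultimately show ?thesis unfolding o z_def[symmetric] by linarith
    qed
  qed
  finally show ?thesis .
qed

lemma mtrace_proj_nonneg:
  assumes "spectral_dec n U a \<rho>" "\<And>i. i < n \<Longrightarrow> 0 \<le> a i" "is_proj n P"
  shows "0 \<le> Re (mtrace (\<rho> * P))"
proof -
  obtain W e where W: "spectral_dec n W e P" and e: "\<And>i. i < n \<Longrightarrow> e i = 0 \<or> e i = 1"
    using proj_spec[OF assms(3)] by blast
  note S = specD[OF assms(1)] and T = specD[OF W]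
  have "0 \<le> e j" if "j < n" for j using e[OF that] by auto
  then have "0 \<le> (\<Sum>i<n. \<Sum>j<n. overlap U W i j * (a i * e j))"
    using assms(2) by (intro sum_nonneg mult_nonneg_nonneg) auto
  also have "\<dots> = Re (mtrace (\<rho> * P))"
    unfolding S(2) T(2) mtrace_diagc_diagc[OF S(1) T(1)] by simp
  finally show ?thesis .
qed

text \<open>Test the quadratic bound only on elements of B. There the form splits over the minimal
  projections, and its maximum is the classical integrand at t; \<open>log_sum_compare\<close> then
  passes from integrands to entropies. The same test at t = 0 shows that finiteness carries
  over.\<close>

lemma qrel_restr_le:
  assumes \<rho>: "density n \<rho>" and \<sigma>: "density n \<sigma>" and B: "abelian_subalg n B"
  shows "qrel_restr n B \<rho> \<sigma> \<le> qrel \<rho> \<sigma>"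
proof -
  obtain U a where a: "spectral_dec n U a \<rho>" "\<And>i. i < n \<Longrightarrow> 0 \<le> a i" "(\<Sum>i<n. a i) = 1"
    using density_spec[OF \<rho>] by metis
  obtain V b where b: "spectral_dec n V b \<sigma>" "\<And>i. i < n \<Longrightarrow> 0 \<le> b i" "(\<Sum>i<n. b i) = 1"
    using density_spec[OF \<sigma>] by metis
  note Sa = specD[OF a(1)] and Sb = specD[OF b(1)]
  define M where "M = min_projs n B"
  define p where "p P = Re (mtrace (\<rho> * P))" for P
  define q where "q P = Re (mtrace (\<sigma> * P))" for P
  have fM: "finite M" unfolding M_def by (rule finite_min_projs[OF B])
  have MB: "M \<subseteq> B" unfolding M_def using min_projsD(1) by blast
  have MC: "M \<subseteq> carrier_mat n n" using MB abelian_subalgD(1)[OF B] by blast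
  have pr: "is_proj n P" "P * P = P" "adj P = P" if "P \<in> M" for P
    using that min_projsD(2) is_projD unfolding M_def by blast+
  have orth: "P * Q = 0\<^sub>m n n" if "P \<in> M" "Q \<in> M" "P \<noteq> Q" for P Q
    using min_projs_orthogonal[OF B] that unfolding M_def by blast
  have p0: "0 \<le> p P" if "P \<in> M" for P unfolding p_def using mtrace_proj_nonneg[OF a(1,2) pr(1)[OF that]] .
  have q0: "0 \<le> q P" if "P \<in> M" for P unfolding q_def using mtrace_proj_nonneg[OF b(1,2) pr(1)[OF that]] .
  have psum: "(\<Sum>P\<in>M. p P) = 1"
  proof -
    have "mtrace (\<rho> * lincomb n M (\<lambda>_. 1)) = (\<Sum>P\<in>M. mtrace (\<rho> * P))"
      using mtrace_mult_lincomb[OF Sa(3) MC, of "\<lambda>_. 1"] by simp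
    moreover have "mtrace (\<rho> * lincomb n M (\<lambda>_. 1)) = 1"
      using \<rho> Sa(3) unfolding M_def min_projs_sum[OF B] by (simp add: density_def)
    ultimately show ?thesis unfolding p_def by (metis Re_sum one_complex.sel(1))
  qed
  show ?thesis
  proof (cases "supp_le n (overlap U V) a b")
    case False
    then have "qrel \<rho> \<sigma> = \<infinity>" unfolding qrel_spec[OF a(1) b(1)] supp_le_def by auto
    then show ?thesis by simp
  next
    case supp: True
    define F where "F t = (\<Sum>i<n. \<Sum>j<n. overlap U V i j * (a i)\<^sup>2 / (b j + t * a i))" for t
    have test: "(\<Sum>P\<in>M. 2 * (x P * p P) - (q P + t * p P) * (x P)\<^sup>2) \<le> F t" if "t \<ge> 0" for x :: "complex mat \<Rightarrow> real" and t
    proof -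
      define X where "X = lincomb n M (\<lambda>P. complex_of_real (x P))"
      have X: "X \<in> carrier_mat n n" by (simp add: X_def)
      have aX: "adj X = X" unfolding X_def using adj_lincomb[OF MC pr(3)] by simp
      have XX: "X * X = lincomb n M (\<lambda>P. complex_of_real ((x P)\<^sup>2))"
        unfolding X_def using lincomb_mult[OF fM MC pr(2) orth] by (simp add: power2_eq_square)
      have tr: "Re (mtrace (A * lincomb n M (\<lambda>P. complex_of_real (y P)))) = (\<Sum>P\<in>M. y P * Re (mtrace (A * P)))"
        if "A \<in> carrier_mat n n" for A y
        unfolding mtrace_mult_lincomb[OF that MC] by simp
      have "2 * Re (mtrace (\<rho> * X)) - (Re (mtrace (\<sigma> * (X * X))) + t * Re (mtrace (\<rho> * (X * X)))) \<le> F t"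
        unfolding F_def by (rule quadratic_test_bound[OF a(1,2) b(1,2) supp X aX that])
      then have "2 * (\<Sum>P\<in>M. x P * p P) - ((\<Sum>P\<in>M. (x P)\<^sup>2 * q P) + t * (\<Sum>P\<in>M. (x P)\<^sup>2 * p P)) \<le> F t"
        unfolding XX unfolding X_def tr[OF Sa(3)] tr[OF Sb(3)] p_def q_def .
      moreover have "2 * (\<Sum>P\<in>M. x P * p P) - ((\<Sum>P\<in>M. (x P)\<^sup>2 * q P) + t * (\<Sum>P\<in>M. (x P)\<^sup>2 * p P))
         = (\<Sum>P\<in>M. 2 * (x P * p P) - (q P + t * p P) * (x P)\<^sup>2)"
        by (simp add: sum_distrib_left sum.distrib sum_subtractf algebra_simps)
      ultimately show ?thesis by simp
    qed
    have ac: "p P = 0" if P: "P \<in> M" "q P = 0" for P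
    proof (rule ccontr)
      assume "p P \<noteq> 0"
      then have pp: "p P > 0" using p0[OF P(1)] by simp
      \<comment> \<open>With q P = 0 the test is linear in the coefficient of P, so it could exceed
        every bound; this coefficient makes it exactly F 0 + 1.\<close>
      define y where "y = (F 0 + 1) / (2 * p P)"
      have "(\<Sum>Q\<in>M. 2 * ((if Q = P then y else 0) * p Q) - (q Q + 0 * p Q) * (if Q = P then y else 0)\<^sup>2) \<le> F 0"
        by (rule test) simp
      moreover have "(\<Sum>Q\<in>M. 2 * ((if Q = P then y else 0) * p Q) - (q Q + 0 * p Q) * (if Q = P then y else 0)\<^sup>2)
         = (\<Sum>Q\<in>M. if Q = P then 2 * (y * p P) else 0)"
        using P by (intro sum.cong refl) auto
      moreover have "\<dots> = F 0 + 1" using P fM pp by (simp add: y_def)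
      ultimately show False by simp
    qed
    \<comment> \<open>Only indices of nonzero weight are kept, because
      \<open>log_sum_compare\<close> requires positive arguments of the logarithms; for these
      indices the support conditions supply positivity.\<close>
    define K where "K = {P \<in> M. p P \<noteq> 0}"
    define I where "I = {(i,j). i < n \<and> j < n \<and> overlap U V i j * a i \<noteq> 0}"
    have fI: "finite I" by (rule finite_subset[of _ "{..<n} \<times> {..<n}"]) (auto simp: I_def)
    have sumI: "(\<Sum>i<n. \<Sum>j<n. f i j) = (\<Sum>(i,j)\<in>I. f i j)"
      if "\<And>i j. overlap U V i j * a i = 0 \<Longrightarrow> f i j = 0" for f :: "nat \<Rightarrow> nat \<Rightarrow> real"
    proof -
      have "(\<Sum>i<n. \<Sum>j<n. f i j) = (\<Sum>(i,j)\<in>{..<n}\<times>{..<n}. f i j)" by (simp add: sum.cartesian_product)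
      also have "\<dots> = (\<Sum>(i,j)\<in>I. f i j)"
        by (rule sum.mono_neutral_right) (use that in \<open>auto simp: I_def\<close>)
      finally show ?thesis .
    qed
    have sumK: "(\<Sum>P\<in>M. f P) = (\<Sum>P\<in>K. f P)" if "\<And>P. p P = 0 \<Longrightarrow> f P = 0" for f :: "complex mat \<Rightarrow> real"
      by (rule sum.mono_neutral_right) (use that fM in \<open>auto simp: K_def\<close>)
    have "(\<Sum>P\<in>K. p P * (ln (p P) - ln (q P))) \<le> (\<Sum>x\<in>I. (case x of (i,j) \<Rightarrow> overlap U V i j * a i) * (ln (a (fst x)) - ln (b (snd x))))"
    proof (rule log_sum_compare[where A = "\<lambda>x. a (fst x)" and B = "\<lambda>x. b (snd x)" and A' = p and B' = q])
      show "finite I" "finite K" using fI fM by (auto simp: K_def)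
      show "a (fst x) > 0 \<and> b (snd x) > 0" if "x \<in> I" for x
        using that a(2)[of "fst x"] b(2)[of "snd x"] supp_leD[OF supp, of "fst x" "snd x"]
        by (fastforce simp: I_def less_le)
      show "p P > 0 \<and> q P > 0" if "P \<in> K" for P
        using that p0[of P] q0[of P] ac[of P] by (fastforce simp: K_def less_le)
      have "(\<Sum>(i,j)\<in>I. overlap U V i j * a i) = (\<Sum>i<n. \<Sum>j<n. overlap U V i j * a i)"
        by (rule sumI[symmetric]) simp
      also have "\<dots> = 1" using overlap_sum_right[OF Sa(1) Sb(1)] a(3) by (simp add: sum_distrib_right[symmetric])
      finally show "(\<Sum>x\<in>I. case x of (i,j) \<Rightarrow> overlap U V i j * a i) = (\<Sum>P\<in>K. p P)"
        using psum sumK[of p] by simp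
      show "(\<Sum>P\<in>K. p P * (p P / (q P + T * p P)))
          \<le> (\<Sum>x\<in>I. (case x of (i,j) \<Rightarrow> overlap U V i j * a i) * (a (fst x) / (b (snd x) + T * a (fst x))))"
        if T: "T \<ge> 0" for T
      proof -
        \<comment> \<open>The maximiser of 2 x p - (q + T p) x^2, whose maximal value is p^2 / (q +
          T p). If the denominator is zero, both sides are zero by the division convention.\<close>
        define x where "x P = p P / (q P + T * p P)" for P
        have "(\<Sum>P\<in>K. p P * (p P / (q P + T * p P))) = (\<Sum>P\<in>M. p P * (p P / (q P + T * p P)))"
          by (rule sumK[symmetric]) simp
        also have "\<dots> = (\<Sum>P\<in>M. 2 * (x P * p P) - (q P + T * p P) * (x P)\<^sup>2)"
        proof (intro sum.cong refl)
          fix P assume P: "P \<in> M"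
          have "y * (y / c) = 2 * (y / c * y) - c * (y / c)\<^sup>2" for y c :: real
            by (cases "c = 0") (simp_all add: power2_eq_square)
          then show "p P * (p P / (q P + T * p P)) = 2 * (x P * p P) - (q P + T * p P) * (x P)\<^sup>2"
            unfolding x_def .
        qed
        also have "\<dots> \<le> F T" by (rule test[OF T])
        also have "F T = (\<Sum>(i,j)\<in>I. overlap U V i j * (a i)\<^sup>2 / (b j + T * a i))"
          unfolding F_def by (rule sumI) auto
        also have "\<dots> = (\<Sum>x\<in>I. (case x of (i,j) \<Rightarrow> overlap U V i j * a i) * (a (fst x) / (b (snd x) + T * a (fst x))))"
          by (intro sum.cong refl) (auto simp: power2_eq_square)
        finally show ?thesis .
      qed
    qed
    also have "\<dots> = (\<Sum>(i,j)\<in>I. overlap U V i j * (a i * (ln (a i) - ln (b j))))"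
      by (intro sum.cong refl) (auto simp: mult.assoc)
    also have "\<dots> = rel_ent n (overlap U V) a b" unfolding rel_ent_def by (rule sumI[symmetric]) auto
    finally have main: "(\<Sum>P\<in>K. p P * (ln (p P) - ln (q P))) \<le> rel_ent n (overlap U V) a b" .
    have "(\<Sum>P\<in>M. if p P = 0 then 0 else p P * ln (p P / q P)) = (\<Sum>P\<in>K. if p P = 0 then 0 else p P * ln (p P / q P))"
      by (rule sumK) simp
    also have "\<dots> = (\<Sum>P\<in>K. p P * (ln (p P) - ln (q P)))"
    proof (intro sum.cong refl)
      fix P assume P: "P \<in> K"
      then have "p P > 0" "q P > 0" using p0[of P] q0[of P] ac[of P] by (fastforce simp: K_def less_le)+
      then show "(if p P = 0 then 0 else p P * ln (p P / q P)) = p P * (ln (p P) - ln (q P))"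
        by (simp add: ln_div)
    qed
    finally have "qrel_restr n B \<rho> \<sigma> = ereal (\<Sum>P\<in>K. p P * (ln (p P) - ln (q P)))"
      unfolding qrel_restr_def crel_def M_def[symmetric] p_def[symmetric] q_def[symmetric] using ac by auto
    moreover have "qrel \<rho> \<sigma> = ereal (rel_ent n (overlap U V) a b)"
      using supp unfolding qrel_spec[OF a(1) b(1)] supp_le_def by auto
    ultimately show ?thesis using main by simp
  qed
qed

section \<open>Haar averages\<close>

declare assoc_mult_mat [simp del]

lemma haar_probD:
  assumes "haar_prob \<mu>"
  shows "prob_space \<mu>" "sets \<mu> = sets borel" "space \<mu> = UNIV" "\<And>g. distr \<mu> \<mu> (\<lambda>h. g + h) = \<mu>"
proof -
  show 1: "prob_space \<mu>" "sets \<mu> = sets borel" "\<And>g. distr \<mu> \<mu> (\<lambda>h. g + h) = \<mu>"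
    using assms by (auto simp: haar_prob_def)
  show "space \<mu> = UNIV" using sets_eq_imp_space_eq[OF 1(2)] by simp
qed

lemma continuous_measurable_haar:
  fixes f :: "'g::{topological_group_add, t2_space} \<Rightarrow> 'b::topological_space"
  assumes "haar_prob \<mu>" "continuous_on UNIV f"
  shows "f \<in> borel_measurable \<mu>"
  using borel_measurable_continuous_onI[OF assms(2)] haar_probD(2)[OF assms(1)]
  by (metis measurable_cong_sets)

lemma continuous_integrable_haar:
  fixes f :: "'g::{topological_group_add, t2_space} \<Rightarrow> 'b::{banach, second_countable_topology}"
  assumes "compact (UNIV :: 'g set)" "haar_prob \<mu>" "continuous_on UNIV f"
  shows "integrable \<mu> f"
proof -
  interpret prob_space \<mu> using haar_probD[OF assms(2)] by simp
  have "bounded (f ` UNIV)" using assms compact_continuous_image compact_imp_bounded by blast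
  then obtain C where "\<And>x. norm (f x) \<le> C" unfolding bounded_iff by blast
  then show ?thesis
    by (intro integrable_const_bound[of _ C] continuous_measurable_haar[OF assms(2,3)]) auto
qed

lemma continuous_translate:
  fixes f :: "'g::{topological_group_add, t2_space} \<Rightarrow> 'b::topological_space"
  assumes "continuous_on UNIV f"
  shows "continuous_on UNIV (\<lambda>g. f (h + g))"
proof -
  have "continuous_on UNIV (\<lambda>g. h + g)" by (intro continuous_intros)
  from continuous_on_compose2[OF assms this] show ?thesis by simp
qed

lemma haar_translate:
  fixes f :: "'g::{topological_group_add, t2_space} \<Rightarrow> 'b::{banach, second_countable_topology}"
  assumes "haar_prob \<mu>" "continuous_on UNIV f"
  shows "(\<integral>g. f (h + g) \<partial>\<mu>) = (\<integral>g. f g \<partial>\<mu>)"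
proof -
  have "(\<lambda>g. h + g) \<in> borel_measurable borel"
    by (intro borel_measurable_continuous_onI continuous_intros)
  then have "(\<lambda>g. h + g) \<in> measurable \<mu> \<mu>"
    using haar_probD(2)[OF assms(1)] by (metis measurable_cong_sets)
  from integral_distr[OF this continuous_measurable_haar[OF assms]]
  show ?thesis using haar_probD(4)[OF assms(1)] by simp
qed

lemma cont_unitary_repD:
  assumes "cont_unitary_rep N R"
  shows "unitary_mat N (R g)" "R g \<in> carrier_mat N N" "R (g + h) = R g * R h"
    "i < N \<Longrightarrow> j < N \<Longrightarrow> continuous_on UNIV (\<lambda>g. R g $$ (i,j))"
  using assms unitary_matD(1)[of N "R g"] by (auto simp: cont_unitary_rep_def)

lemma integral_double_sum:
  fixes F :: "nat \<Rightarrow> nat \<Rightarrow> 'a \<Rightarrow> complex"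
  assumes "\<And>i j. i < N \<Longrightarrow> j < N \<Longrightarrow> integrable M (F i j)"
  shows "(\<Sum>i<N. \<Sum>j<N. c i j * (\<integral>x. F i j x \<partial>M)) = (\<integral>x. (\<Sum>i<N. \<Sum>j<N. c i j * F i j x) \<partial>M)"
    and "integrable M (\<lambda>x. \<Sum>i<N. \<Sum>j<N. c i j * F i j x)"
proof -
  have 1: "integrable M (\<lambda>x. \<Sum>j<N. c i j * F i j x)" if "i < N" for i
    using assms that by (intro Bochner_Integration.integrable_sum integrable_mult_right) auto
  then show "integrable M (\<lambda>x. \<Sum>i<N. \<Sum>j<N. c i j * F i j x)"
    by (rule Bochner_Integration.integrable_sum) auto
  have "(\<Sum>j<N. c i j * (\<integral>x. F i j x \<partial>M)) = (\<integral>x. (\<Sum>j<N. c i j * F i j x) \<partial>M)" if "i < N" for i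
    using assms that by (subst Bochner_Integration.integral_sum) auto
  then show "(\<Sum>i<N. \<Sum>j<N. c i j * (\<integral>x. F i j x \<partial>M)) = (\<integral>x. (\<Sum>i<N. \<Sum>j<N. c i j * F i j x) \<partial>M)"
    using 1 by (subst Bochner_Integration.integral_sum) auto
qed

text \<open>Averages are studied for an arbitrary unitary representation R on N dimensions, so that
  the tensor structure enters only through the counting of matrix entries.\<close>

definition avg :: "nat \<Rightarrow> ('g \<Rightarrow> complex mat) \<Rightarrow> 'g measure \<Rightarrow> complex mat \<Rightarrow> complex mat" where
  "avg N R \<mu> X = mat N N (\<lambda>(i,j). \<integral>g. (R g * X * adj (R g)) $$ (i,j) \<partial>\<mu>)"

lemma haar_avg_eq: "haar_avg d u \<mu> n X = avg (d^n) (\<lambda>g. tpow n (u g)) \<mu> X"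
  by (simp add: haar_avg_def avg_def)

lemma tpow_continuous:
  assumes "\<And>g. A g \<in> carrier_mat d d" "\<And>i j. i < d \<Longrightarrow> j < d \<Longrightarrow> continuous_on UNIV (\<lambda>g. A g $$ (i,j))"
    and "i < d^n" "j < d^n"
  shows "continuous_on UNIV (\<lambda>g. tpow n (A g) $$ (i,j))"
  using assms(3,4)
proof (induction n arbitrary: i j)
  case 0
  then show ?case by simp
next
  case (Suc n)
  then have ij: "i < d^n*d" "j < d^n*d" by (simp_all add: mult.commute)
  have "tpow (Suc n) (A g) $$ (i,j) = tpow n (A g) $$ (i div d, j div d) * A g $$ (i mod d, j mod d)" for g
    using kron_index[of "tpow n (A g)" "d^n" "d^n" "A g" d d i j] ij assms(1)[of g] by simp
  then show ?case
    using Suc.IH assms(2) div_mod_less[OF ij(1)] div_mod_less[OF ij(2)] by (auto intro!: continuous_intros)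
qed

lemma cont_unitary_rep_tpow:
  assumes "cont_unitary_rep d u"
  shows "cont_unitary_rep (d^n) (\<lambda>g. tpow n (u g))"
  unfolding cont_unitary_rep_def
  using cont_unitary_repD[OF assms] unitary_tpow tpow_mult[of _ d] tpow_continuous[of u d] by auto

context
  fixes N :: nat and R :: "'g::{topological_group_add, t2_space} \<Rightarrow> complex mat" and \<mu> :: "'g measure"
  assumes cpt: "compact (UNIV :: 'g set)" and haar: "haar_prob \<mu>" and rep: "cont_unitary_rep N R"
begin

interpretation prob_space \<mu> using haar_probD[OF haar] by simp

private lemmas R = cont_unitary_repD(1,2)[OF rep]

lemma avg_carrier: "avg N R \<mu> X \<in> carrier_mat N N" by (simp add: avg_def)

lemma avg_index: "i < N \<Longrightarrow> j < N \<Longrightarrow> avg N R \<mu> X $$ (i,j) = (\<integral>g. (R g * X * adj (R g)) $$ (i,j) \<partial>\<mu>)"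
  by (simp add: avg_def)

lemma conj_index:
  assumes "X \<in> carrier_mat N N" "A \<in> carrier_mat N N" "i < N" "j < N"
  shows "(A * X * adj A) $$ (i,j) = (\<Sum>l<N. \<Sum>k<N. (A $$ (i,k) * cnj (A $$ (j,l))) * X $$ (k,l))"
  using assms by (simp add: mult_index_sum[of _ N N _ N] sq_mult_carrier sum_distrib_left sum_distrib_right mult.commute mult.left_commute)

lemma conj_continuous:
  assumes "X \<in> carrier_mat N N" "i < N" "j < N"
  shows "continuous_on UNIV (\<lambda>g. (R g * X * adj (R g)) $$ (i,j))"
  unfolding conj_index[OF assms(1) R(2) assms(2,3)]
  using assms by (intro continuous_intros cont_unitary_repD(4)[OF rep]) auto

lemma conj_integrable:
  assumes "X \<in> carrier_mat N N" "i < N" "j < N"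
  shows "integrable \<mu> (\<lambda>g. (R g * X * adj (R g)) $$ (i,j))"
  by (intro continuous_integrable_haar[OF cpt haar] conj_continuous assms)

text \<open>Conjugation by R h acts on the integrand as the translation of g to h + g, which the
  left-invariant measure does not see. Written as a double sum over entries, the conjugation can be
  moved under the integral.\<close>

lemma avg_commute:
  assumes X: "X \<in> carrier_mat N N"
  shows "avg N R \<mu> X * R h = R h * avg N R \<mu> X"
proof -
  note Rh = unitary_matD[OF R(1)[of h]]
  have "R h * avg N R \<mu> X * adj (R h) = avg N R \<mu> X"
  proof (rule eq_matI)
    fix i j assume "i < dim_row (avg N R \<mu> X)" "j < dim_col (avg N R \<mu> X)"
    then have ij: "i < N" "j < N" by (auto simp: avg_def)
    have sc: "R g * X * adj (R g) \<in> carrier_mat N N" for g using R[of g] X by (simp add: sq_mult_carrier)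
    have "(R h * avg N R \<mu> X * adj (R h)) $$ (i,j)
       = (\<Sum>l<N. \<Sum>k<N. (R h $$ (i,k) * cnj (R h $$ (j,l))) * (\<integral>g. (R g * X * adj (R g)) $$ (k,l) \<partial>\<mu>))"
      unfolding conj_index[OF avg_carrier R(2) ij] by (simp add: avg_index)
    also have "\<dots> = (\<integral>g. (\<Sum>l<N. \<Sum>k<N. (R h $$ (i,k) * cnj (R h $$ (j,l))) * (R g * X * adj (R g)) $$ (k,l)) \<partial>\<mu>)"
      by (rule integral_double_sum(1)) (intro conj_integrable[OF X])
    also have "\<dots> = (\<integral>g. (R (h + g) * X * adj (R (h + g))) $$ (i,j) \<partial>\<mu>)"
    proof (rule Bochner_Integration.integral_cong[OF refl])
      fix g
      have "R (h + g) * X * adj (R (h + g)) = R h * (R g * X * adj (R g)) * adj (R h)"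
        unfolding cont_unitary_repD(3)[OF rep] using R[of g] Rh X
        by (simp add: adj_mult[of _ N N _ N] sq_assoc[of _ N] sq_mult_carrier)
      then show "(\<Sum>l<N. \<Sum>k<N. (R h $$ (i,k) * cnj (R h $$ (j,l))) * (R g * X * adj (R g)) $$ (k,l))
          = (R (h + g) * X * adj (R (h + g))) $$ (i,j)"
        using conj_index[OF sc R(2) ij, of h g] by simp
    qed
    also have "\<dots> = avg N R \<mu> X $$ (i,j)"
      unfolding avg_index[OF ij] by (rule haar_translate[OF haar conj_continuous[OF X ij]])
    finally show "(R h * avg N R \<mu> X * adj (R h)) $$ (i,j) = avg N R \<mu> X $$ (i,j)" .
  qed (use Rh in \<open>auto simp: avg_def\<close>)
  then have "R h * avg N R \<mu> X * adj (R h) * R h = avg N R \<mu> X * R h" by simp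
  then show ?thesis using Rh avg_carrier[of X] by (simp add: sq_assoc[of _ N] sq_mult_carrier)
qed

lemma avg_fix:
  assumes X: "X \<in> carrier_mat N N" "\<And>g. X * R g = R g * X"
  shows "avg N R \<mu> X = X"
proof -
  have "R g * X * adj (R g) = X" for g
    using X unitary_matD[OF R(1)[of g]] by (simp add: X(2)[symmetric] sq_assoc[of _ N])
  then show ?thesis using X by (intro eq_matI) (auto simp: avg_def prob_space)
qed

text \<open>Averaging is the trace-preserving conditional expectation onto the commutant: by
  cyclicity of the trace and invariance of Y the integrand does not depend on g.\<close>

lemma mtrace_avg:
  assumes X: "X \<in> carrier_mat N N" and Y: "Y \<in> carrier_mat N N" "\<And>g. Y * R g = R g * Y"
  shows "mtrace (avg N R \<mu> X * Y) = mtrace (X * Y)"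
proof -
  have tr: "mtrace (A * Y) = (\<Sum>i<N. \<Sum>j<N. Y $$ (j,i) * A $$ (i,j))" if "A \<in> carrier_mat N N" for A
    using that Y by (simp add: mtrace_def mult_index_sum[of _ N N _ N] mult.commute)
  have "mtrace (avg N R \<mu> X * Y) = (\<Sum>i<N. \<Sum>j<N. Y $$ (j,i) * (\<integral>g. (R g * X * adj (R g)) $$ (i,j) \<partial>\<mu>))"
    by (simp add: tr avg_carrier avg_index)
  also have "\<dots> = (\<integral>g. (\<Sum>i<N. \<Sum>j<N. Y $$ (j,i) * (R g * X * adj (R g)) $$ (i,j)) \<partial>\<mu>)"
    by (rule integral_double_sum(1)) (intro conj_integrable[OF X])
  also have "\<dots> = (\<integral>g. mtrace (X * Y) \<partial>\<mu>)"
  proof (rule Bochner_Integration.integral_cong[OF refl])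
    fix g
    note Rg = unitary_matD[OF R(1)[of g]]
    have "(\<Sum>i<N. \<Sum>j<N. Y $$ (j,i) * (R g * X * adj (R g)) $$ (i,j)) = mtrace (R g * X * adj (R g) * Y)"
      using Rg X by (subst tr) (auto simp: sq_mult_carrier)
    also have "R g * X * adj (R g) * Y = R g * (X * (adj (R g) * Y))"
      using Rg X Y by (simp add: sq_assoc[of _ N] sq_mult_carrier)
    also have "mtrace \<dots> = mtrace (X * (adj (R g) * Y) * R g)"
      using Rg X Y by (intro mtrace_comm[of _ N N]) (auto simp: sq_mult_carrier)
    also have "X * (adj (R g) * Y) * R g = X * (adj (R g) * (R g * Y))"
      using Rg X Y by (simp add: Y(2)[symmetric] sq_assoc[of _ N] sq_mult_carrier)
    also have "\<dots> = X * Y" using unitary_cancel(1)[OF R(1) Y(1)] by simp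
    finally show "(\<Sum>i<N. \<Sum>j<N. Y $$ (j,i) * (R g * X * adj (R g)) $$ (i,j)) = mtrace (X * Y)" .
  qed
  also have "\<dots> = mtrace (X * Y)" by (simp add: prob_space)
  finally show ?thesis .
qed

lemma quad_form_avg:
  assumes X: "X \<in> carrier_mat N N"
  shows "quad_form N (avg N R \<mu> X) v = (\<integral>g. quad_form N (R g * X * adj (R g)) v \<partial>\<mu>)"
    and "integrable \<mu> (\<lambda>g. quad_form N (R g * X * adj (R g)) v)"
proof -
  have q: "quad_form N A v = Re (\<Sum>i<N. \<Sum>j<N. (cnj (v i) * v j) * A $$ (i,j))" for A
    by (simp add: quad_form_def mult.commute mult.left_commute)
  have int: "integrable \<mu> (\<lambda>g. \<Sum>i<N. \<Sum>j<N. (cnj (v i) * v j) * (R g * X * adj (R g)) $$ (i,j))"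
    by (rule integral_double_sum(2)) (intro conj_integrable[OF X])
  have "(\<Sum>i<N. \<Sum>j<N. (cnj (v i) * v j) * avg N R \<mu> X $$ (i,j))
     = (\<Sum>i<N. \<Sum>j<N. (cnj (v i) * v j) * (\<integral>g. (R g * X * adj (R g)) $$ (i,j) \<partial>\<mu>))"
    by (simp add: avg_index)
  also have "\<dots> = (\<integral>g. (\<Sum>i<N. \<Sum>j<N. (cnj (v i) * v j) * (R g * X * adj (R g)) $$ (i,j)) \<partial>\<mu>)"
    by (rule integral_double_sum(1)) (intro conj_integrable[OF X])
  finally have e: "(\<Sum>i<N. \<Sum>j<N. (cnj (v i) * v j) * avg N R \<mu> X $$ (i,j))
     = (\<integral>g. (\<Sum>i<N. \<Sum>j<N. (cnj (v i) * v j) * (R g * X * adj (R g)) $$ (i,j)) \<partial>\<mu>)" .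
  show "quad_form N (avg N R \<mu> X) v = (\<integral>g. quad_form N (R g * X * adj (R g)) v \<partial>\<mu>)"
    unfolding q e using integral_Re[OF int] by simp
  show "integrable \<mu> (\<lambda>g. quad_form N (R g * X * adj (R g)) v)"
    unfolding q using int by (rule integrable_Re)
qed

lemma conj_spec:
  assumes "spectral_dec N U a X"
  shows "R g * X * adj (R g) = diagc N (R g * U) (\<lambda>i. complex_of_real (a i))"
  using specD[OF assms] unitary_matD[OF specD(1)[OF assms]] R(2)[of g]
  by (simp add: diagc_def adj_mult[of _ N N _ N] sq_assoc[of _ N] sq_mult_carrier)

lemma density_avg:
  assumes "density N X"
  shows "density N (avg N R \<mu> X)"
proof -
  note D = assms[unfolded density_quad_form]
  have X: "X \<in> carrier_mat N N" using D by blast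
  have h: "adj (R g * X * adj (R g)) = R g * X * adj (R g)" for g
    using D R(2)[of g] by (simp add: adj_mult[of _ N N _ N] sq_assoc[of _ N] sq_mult_carrier)
  have "adj (avg N R \<mu> X) = avg N R \<mu> X"
  proof (rule eq_matI)
    fix i j assume "i < dim_row (avg N R \<mu> X)" "j < dim_col (avg N R \<mu> X)"
    then have ij: "i < N" "j < N" by (auto simp: avg_def)
    have "adj (avg N R \<mu> X) $$ (i,j) = cnj (avg N R \<mu> X $$ (j,i))"
      using ij by (intro adj_index) (auto simp: avg_def)
    also have "\<dots> = (\<integral>g. cnj ((R g * X * adj (R g)) $$ (j,i)) \<partial>\<mu>)"
      using ij by (simp add: avg_index)
    also have "\<dots> = (\<integral>g. adj (R g * X * adj (R g)) $$ (i,j) \<partial>\<mu>)"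
    proof (rule Bochner_Integration.integral_cong[OF refl])
      fix g
      have "R g * X * adj (R g) \<in> carrier_mat N N" using R(2)[of g] X by (simp add: sq_mult_carrier)
      then show "cnj ((R g * X * adj (R g)) $$ (j,i)) = adj (R g * X * adj (R g)) $$ (i,j)"
        using ij by (intro adj_index[symmetric]) auto
    qed
    finally show "adj (avg N R \<mu> X) $$ (i,j) = avg N R \<mu> X $$ (i,j)" using ij h by (simp add: avg_index)
  qed (auto simp: avg_def)
  moreover have "0 \<le> quad_form N (avg N R \<mu> X) v" for v
  proof -
    obtain U a where s: "spectral_dec N U a X" and a: "\<And>i. i < N \<Longrightarrow> 0 \<le> a i" using density_spec[OF assms] by metis
    have "R g * U \<in> carrier_mat N N" for g
      using R(2) unitary_matD(1)[OF specD(1)[OF s]] by (simp add: sq_mult_carrier)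
    then have "0 \<le> quad_form N (R g * X * adj (R g)) v" for g
      unfolding conj_spec[OF s] using a by (subst quad_form_diagc) (auto intro!: sum_nonneg)
    then show ?thesis unfolding quad_form_avg(1)[OF X] by (intro Bochner_Integration.integral_nonneg) auto
  qed
  moreover have "mtrace (avg N R \<mu> X) = 1"
  proof -
    have "1\<^sub>m N * R g = R g * 1\<^sub>m N" for g using R(2)[of g] by simp
    from mtrace_avg[OF X one_carrier_mat this] show ?thesis using D avg_carrier[of X] by (metis right_mult_one_mat)
  qed
  ultimately show ?thesis unfolding density_quad_form using avg_carrier by blast
qed

end

section \<open>Decomposition and sign of the entropy double sum\<close>

lemma rel_ent_split:
  assumes "\<And>i. i < n \<Longrightarrow> (\<Sum>j<n. w i j) = 1"
  shows "rel_ent n w a b = (\<Sum>i<n. a i * ln (a i)) - (\<Sum>i<n. \<Sum>j<n. w i j * (a i * ln (b j)))"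
proof -
  have "(\<Sum>i<n. a i * ln (a i)) = (\<Sum>i<n. \<Sum>j<n. w i j * (a i * ln (a i)))"
    using assms by (simp add: sum_distrib_right[symmetric])
  then show ?thesis unfolding rel_ent_def by (simp add: sum_subtractf[symmetric] algebra_simps)
qed

text \<open>Klein's inequality: each term satisfies a (ln a - ln b) \<ge> a - b, and doubly
  stochastic weights turn the sum of the right sides into 1 - 1.\<close>

lemma rel_ent_nonneg:
  assumes w: "\<And>i j. i < n \<Longrightarrow> j < n \<Longrightarrow> 0 \<le> w i j" "\<And>i. i < n \<Longrightarrow> (\<Sum>j<n. w i j) = 1" "\<And>j. j < n \<Longrightarrow> (\<Sum>i<n. w i j) = 1"
    and a: "\<And>i. i < n \<Longrightarrow> 0 \<le> a i" "(\<Sum>i<n. a i) = 1" and b: "\<And>i. i < n \<Longrightarrow> 0 \<le> b i" "(\<Sum>i<n. b i) = 1"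
    and supp: "supp_le n w a b"
  shows "0 \<le> rel_ent n w a b"
proof -
  have "(\<Sum>i<n. \<Sum>j<n. w i j * (a i - b j)) = (\<Sum>i<n. \<Sum>j<n. w i j * a i) - (\<Sum>i<n. \<Sum>j<n. w i j * b j)"
    by (simp add: sum_subtractf algebra_simps)
  also have "(\<Sum>i<n. \<Sum>j<n. w i j * a i) = 1" using w a by (simp add: sum_distrib_right[symmetric])
  also have "(\<Sum>i<n. \<Sum>j<n. w i j * b j) = (\<Sum>j<n. \<Sum>i<n. w i j * b j)" by (rule sum.swap)
  also have "\<dots> = 1" using w b by (simp add: sum_distrib_right[symmetric])
  finally have "0 = (\<Sum>i<n. \<Sum>j<n. w i j * (a i - b j))" by simp
  also have "\<dots> \<le> rel_ent n w a b"
    unfolding rel_ent_def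
  proof (intro sum_mono)
    fix i j assume "i \<in> {..<n}" "j \<in> {..<n}"
    then have ij: "i < n" "j < n" by auto
    show "w i j * (a i - b j) \<le> w i j * (a i * (ln (a i) - ln (b j)))"
    proof (cases "a i = 0 \<or> w i j = 0")
      case True
      then show ?thesis using w(1)[OF ij] b(1)[OF ij(2)] by auto
    next
      case False
      then have pos: "a i > 0" "b j > 0"
        using a(1)[OF ij(1)] b(1)[OF ij(2)] supp_leD[OF supp ij] by (force simp: less_le)+
      have "ln (b j / a i) \<le> b j / a i - 1" using pos by (intro ln_le_minus_one) simp
      then have "a i * (ln (b j) - ln (a i)) \<le> a i * (b j / a i - 1)"
        using pos by (intro mult_left_mono) (auto simp: ln_div)
      also have "\<dots> = b j - a i" using pos by (simp add: field_simps)
      finally have "a i - b j \<le> a i * (ln (a i) - ln (b j))" by (simp add: algebra_simps)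
      then show ?thesis using w(1)[OF ij] by (rule mult_left_mono)
    qed
  qed
  finally show ?thesis .
qed

section \<open>Relative entropy and Haar averages\<close>

lemma double_sum_zero:
  fixes f :: "nat \<Rightarrow> nat \<Rightarrow> real"
  assumes "\<And>i j. i < n \<Longrightarrow> j < n \<Longrightarrow> 0 \<le> f i j" "(\<Sum>i<n. \<Sum>j<n. f i j) = 0" "i < n" "j < n"
  shows "f i j = 0"
proof -
  have "\<forall>i\<in>{..<n}. (\<Sum>j<n. f i j) = 0"
    using assms(2) by (subst (asm) sum_nonneg_eq_0_iff) (auto intro!: sum_nonneg assms(1))
  then have "(\<Sum>j<n. f i j) = 0" using assms(3) by blast
  then have "\<forall>j\<in>{..<n}. f i j = 0"
    by (subst (asm) sum_nonneg_eq_0_iff) (auto intro!: assms(1,3))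
  then show ?thesis using assms(4) by blast
qed

lemma commute_spec:
  assumes "spectral_dec n V b S" "X \<in> carrier_mat n n" "S * X = X * S"
  shows "diagc n V (\<lambda>i. complex_of_real (F (b i))) * X = X * diagc n V (\<lambda>i. complex_of_real (F (b i)))"
proof -
  note S = specD[OF assms(1)]
  have "X * diagc n V (\<lambda>i. complex_of_real (b i)) = diagc n V (\<lambda>i. complex_of_real (b i)) * X"
    using assms(3) S(2) by simp
  from intertwine_fun[OF S(1) S(1) assms(2) this, of "\<lambda>z. complex_of_real (F (Re z))"]
  show ?thesis by simp
qed

lemma overlap_self_sum:
  assumes "unitary_mat n W"
  shows "(\<Sum>i<n. \<Sum>j<n. overlap W W i j * (c i * f j)) = (\<Sum>i<n. c i * f i)"
proof -
  have "complex_of_real (\<Sum>i<n. \<Sum>j<n. overlap W W i j * (c i * f j))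
    = mtrace (diagc n W (\<lambda>i. complex_of_real (c i)) * diagc n W (\<lambda>i. complex_of_real (f i)))"
    unfolding mtrace_diagc_diagc[OF assms assms] by simp
  also have "\<dots> = complex_of_real (\<Sum>i<n. c i * f i)"
    unfolding diagc_mult[OF assms] mtrace_diagc[OF assms] by simp
  finally show ?thesis using of_real_eq_iff by blast
qed

lemma spec_trace_sum:
  assumes "spectral_dec n U a A" "unitary_mat n V"
  shows "mtrace (A * diagc n V (\<lambda>i. complex_of_real (f i))) = complex_of_real (\<Sum>i<n. \<Sum>j<n. overlap U V i j * (a i * f j))"
  unfolding specD(2)[OF assms(1)] mtrace_diagc_diagc[OF specD(1)[OF assms(1)] assms(2)] by simp

context
  fixes N :: nat and R :: "'g::{topological_group_add, t2_space} \<Rightarrow> complex mat" and \<mu> :: "'g measure"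
  assumes cpt: "compact (UNIV :: 'g set)" and haar: "haar_prob \<mu>" and rep: "cont_unitary_rep N R"
begin

text \<open>The trace identity for F applied to \<sigma>, in eigenbases. F is left free because both
  \<open>ln\<close> and the indicator of 0 are inserted, the latter to transport supports.\<close>

lemma avg_spec_sum:
  assumes "spectral_dec N U a \<rho>" "spectral_dec N W c (avg N R \<mu> \<rho>)" "spectral_dec N V b \<sigma>" "\<And>g. \<sigma> * R g = R g * \<sigma>"
  shows "(\<Sum>i<N. \<Sum>j<N. overlap W V i j * (c i * F (b j))) = (\<Sum>i<N. \<Sum>j<N. overlap U V i j * (a i * F (b j)))"
proof -
  define Y where "Y = diagc N V (\<lambda>i. complex_of_real (F (b i)))"
  have uV: "unitary_mat N V" using specD(1)[OF assms(3)] .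
  have Y: "Y \<in> carrier_mat N N" unfolding Y_def using unitary_matD[OF uV] by simp
  have "Y * R g = R g * Y" for g
    unfolding Y_def by (rule commute_spec[OF assms(3) cont_unitary_repD(2)[OF rep] assms(4)])
  from mtrace_avg[OF cpt haar rep specD(3)[OF assms(1)] Y this]
  have "mtrace (avg N R \<mu> \<rho> * Y) = mtrace (\<rho> * Y)" .
  then show ?thesis
    unfolding Y_def spec_trace_sum[OF assms(1) uV] spec_trace_sum[OF assms(2) uV] using of_real_eq_iff by blast
qed

lemma qrel_avg_le:
  assumes \<rho>: "density N \<rho>" and \<sigma>: "density N \<sigma>" "\<And>g. \<sigma> * R g = R g * \<sigma>"
  shows "qrel (avg N R \<mu> \<rho>) \<sigma> \<le> qrel \<rho> \<sigma>"
proof -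
  obtain U a where a: "spectral_dec N U a \<rho>" "\<And>i. i < N \<Longrightarrow> 0 \<le> a i" "(\<Sum>i<N. a i) = 1"
    using density_spec[OF \<rho>] by metis
  obtain V b where b: "spectral_dec N V b \<sigma>" "\<And>i. i < N \<Longrightarrow> 0 \<le> b i" "(\<Sum>i<N. b i) = 1"
    using density_spec[OF \<sigma>(1)] by metis
  obtain W c where c: "spectral_dec N W c (avg N R \<mu> \<rho>)" "\<And>i. i < N \<Longrightarrow> 0 \<le> c i" "(\<Sum>i<N. c i) = 1"
    using density_spec[OF density_avg[OF cpt haar rep \<rho>]] by metis
  note uU = specD(1)[OF a(1)] and uV = specD(1)[OF b(1)] and uW = specD(1)[OF c(1)]
  note tV = avg_spec_sum[OF a(1) c(1) b(1) \<sigma>(2)]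
  \<comment> \<open>The average commutes with the group itself, so the identity may be used with the
    average in the place of \<sigma>.\<close>
  note tW = avg_spec_sum[OF a(1) c(1) c(1) avg_commute[OF cpt haar rep specD(3)[OF a(1)]]]
  show ?thesis
  proof (cases "supp_le N (overlap U V) a b")
    case False
    then have "qrel \<rho> \<sigma> = \<infinity>" unfolding qrel_spec[OF a(1) b(1)] supp_le_def by auto
    then show ?thesis by simp
  next
    case supp: True
    \<comment> \<open>The indicator of the eigenvalue 0, that is, the kernel projection. A sum of
      nonnegative terms weighted by it vanishes exactly if each term does, which is the support
      condition.\<close>
    define z where "z x = (if x = 0 then 1 else 0 :: real)" for x :: real
    have "(\<Sum>i<N. \<Sum>j<N. overlap U V i j * (a i * z (b j))) = 0"
      using supp_leD[OF supp] by (intro sum.neutral ballI) (force simp: z_def)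
    then have 0: "(\<Sum>i<N. \<Sum>j<N. overlap W V i j * (c i * z (b j))) = 0" using tV by simp
    have supp': "supp_le N (overlap W V) c b" unfolding supp_le_def
    proof (intro allI impI)
      fix i j assume ij: "i < N" "j < N" and cb: "c i \<noteq> 0 \<and> b j = 0"
      have "overlap W V i j * (c i * z (b j)) = 0"
        by (rule double_sum_zero[OF _ 0 ij]) (auto simp: z_def c(2))
      then show "overlap W V i j = 0" using cb by (simp add: z_def)
    qed
    have 0: "(\<Sum>i<N. \<Sum>j<N. overlap U W i j * (a i * z (c j))) = 0"
      unfolding tW[symmetric] overlap_self_sum[OF uW] by (intro sum.neutral) (auto simp: z_def)
    have supp'': "supp_le N (overlap U W) a c" unfolding supp_le_def
    proof (intro allI impI)
      fix i j assume ij: "i < N" "j < N" and cb: "a i \<noteq> 0 \<and> c j = 0"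
      have "overlap U W i j * (a i * z (c j)) = 0"
        by (rule double_sum_zero[OF _ 0 ij]) (auto simp: z_def a(2))
      then show "overlap U W i j = 0" using cb by (simp add: z_def)
    qed
    have "rel_ent N (overlap W V) c b = (\<Sum>i<N. c i * ln (c i)) - (\<Sum>i<N. \<Sum>j<N. overlap U V i j * (a i * ln (b j)))"
      using rel_ent_split[of N "overlap W V" c b] overlap_sum_right[OF uW uV] tV[of ln] by simp
    also have "(\<Sum>i<N. c i * ln (c i)) = (\<Sum>i<N. \<Sum>j<N. overlap U W i j * (a i * ln (c j)))"
      using tW[of ln] overlap_self_sum[OF uW, of c "\<lambda>j. ln (c j)"] by simp
    also have "\<dots> = (\<Sum>i<N. a i * ln (a i)) - rel_ent N (overlap U W) a c"
      using rel_ent_split[of N "overlap U W" a c] overlap_sum_right[OF uU uW] by simp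
    also have "\<dots> - (\<Sum>i<N. \<Sum>j<N. overlap U V i j * (a i * ln (b j))) = rel_ent N (overlap U V) a b - rel_ent N (overlap U W) a c"
      using rel_ent_split[of N "overlap U V" a b] overlap_sum_right[OF uU uV] by simp
    also have "\<dots> \<le> rel_ent N (overlap U V) a b"
      using rel_ent_nonneg[of N "overlap U W" a c] overlap_sum_right[OF uU uW] overlap_sum_left[OF uU uW] a c supp'' by simp
    finally show ?thesis
      using supp supp' unfolding qrel_spec[OF a(1) b(1)] qrel_spec[OF c(1) b(1)] supp_le_def[symmetric] by simp
  qed
qed

end

text \<open>Translates of the open set where f exceeds half its value at x0 cover the group, hence
  finitely many do. The corresponding finite sum of translates of f is bounded below, while its
  integral is zero. This lets functions of zero square norm be discarded pointwise.\<close>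

lemma haar_full_support:
  fixes f :: "'g::{topological_group_add, t2_space} \<Rightarrow> real"
  assumes cpt: "compact (UNIV :: 'g set)" and haar: "haar_prob \<mu>"
    and f: "continuous_on UNIV f" "\<And>x. 0 \<le> f x" "(\<integral>x. f x \<partial>\<mu>) = 0"
  shows "f x0 = 0"
proof (rule ccontr)
  interpret prob_space \<mu> using haar_probD[OF haar] by simp
  assume "f x0 \<noteq> 0"
  then have e: "f x0 > 0" using f(2)[of x0] by simp
  define e where "e = f x0 / 2"
  define V where "V h = {x. e < f (h + x)}" for h
  have "open (V h)" for h
    unfolding V_def using continuous_translate[OF f(1)] by (intro open_Collect_less) auto
  moreover have "UNIV \<subseteq> (\<Union>h. V h)"
  proof
    fix y :: 'g
    have "y \<in> V (x0 - y)" using e by (simp add: V_def e_def)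
    then show "y \<in> (\<Union>h. V h)" by blast
  qed
  ultimately obtain H where H: "finite H" "UNIV \<subseteq> (\<Union>h\<in>H. V h)"
    using compactE_image[OF cpt, of UNIV V] by metis
  have "e \<le> (\<Sum>h\<in>H. f (h + x))" for x
  proof -
    obtain h where h: "h \<in> H" "x \<in> V h" using H by blast
    then have "e \<le> f (h + x)" by (simp add: V_def)
    also have "\<dots> \<le> (\<Sum>h\<in>H. f (h + x))" using f(2) h H by (intro member_le_sum) auto
    finally show ?thesis .
  qed
  moreover have "integrable \<mu> (\<lambda>x. f (h + x))" for h
    by (rule continuous_integrable_haar[OF cpt haar continuous_translate[OF f(1)]])
  ultimately have "(\<integral>x. e \<partial>\<mu>) \<le> (\<integral>x. (\<Sum>h\<in>H. f (h + x)) \<partial>\<mu>)"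
    by (intro integral_mono) auto
  also have "\<dots> = (\<Sum>h\<in>H. (\<integral>x. f (h + x) \<partial>\<mu>))"
    by (intro Bochner_Integration.integral_sum continuous_integrable_haar[OF cpt haar] continuous_translate f(1))
  also have "\<dots> = 0" using haar_translate[OF haar f(1)] f(3) by simp
  finally show False using e by (simp add: e_def prob_space)
qed

text \<open>The reproducing kernel of a finite-dimensional translation invariant function space is
  constant on the diagonal, hence equal to the dimension.\<close>

lemma invariant_space_point_bound:
  fixes F :: "nat \<Rightarrow> 'g::{topological_group_add, t2_space} \<Rightarrow> complex"
  assumes cpt: "compact (UNIV :: 'g set)" and haar: "haar_prob \<mu>"
    and F: "\<And>a. a < M \<Longrightarrow> continuous_on UNIV (F a)"
    and trans: "\<And>a y. a < M \<Longrightarrow> \<exists>c. \<forall>g. F a (y + g) = (\<Sum>b<M. c b * F b g)"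
  shows "(cmod (\<Sum>a<M. x a * F a 0))\<^sup>2 \<le> real M * (\<integral>g. (cmod (\<Sum>a<M. x a * F a g))\<^sup>2 \<partial>\<mu>)"
proof -
  interpret prob_space \<mu> using haar_probD[OF haar] by simp
  note int = continuous_integrable_haar[OF cpt haar]
  \<comment> \<open>Gram matrix of the F a. They may be linearly dependent, so K may be singular;
    diagonalising it avoids choosing a basis.\<close>
  define K where "K = mat M M (\<lambda>(a,b). \<integral>g. cnj (F a g) * F b g \<partial>\<mu>)"
  have K: "K \<in> carrier_mat M M" by (simp add: K_def)
  have FF: "integrable \<mu> (\<lambda>g. cnj (F a g) * F b g)" if "a < M" "b < M" for a b
    using that by (intro int continuous_intros F)
  have "adj K = K"
  proof (rule eq_matI)
    fix i j assume ij: "i < dim_row K" "j < dim_col K"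
    then have "adj K $$ (i,j) = cnj (K $$ (j,i))" using K by (intro adj_index) auto
    also have "K $$ (j,i) = (\<integral>g. cnj (F j g) * F i g \<partial>\<mu>)" using ij by (simp add: K_def)
    also have "cnj \<dots> = (\<integral>g. cnj (cnj (F j g) * F i g) \<partial>\<mu>)" by (rule Bochner_Integration.integral_cnj[symmetric])
    also have "\<dots> = K $$ (i,j)" using ij by (simp add: K_def mult.commute)
    finally show "adj K $$ (i,j) = K $$ (i,j)" .
  qed (use K in auto)
  then obtain V L where s: "spectral_dec M V L K" using spectral_hermitian[OF K] by metis
  note uV = specD(1)[OF s]
  note V = unitary_matD[OF uV]
  \<comment> \<open>An orthogonal spanning family, the square norm of \<psi> i being the eigenvalue
    L i; members with L i = 0 turn out to vanish identically.\<close>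
  define \<psi> where "\<psi> i g = (\<Sum>a<M. V $$ (a,i) * F a g)" for i g
  have \<psi>c: "continuous_on UNIV (\<psi> i)" for i
    unfolding \<psi>_def by (intro continuous_intros F) auto
  have F\<psi>: "F a g = (\<Sum>i<M. cnj (V $$ (a,i)) * \<psi> i g)" if "a < M" for a g
  proof -
    have "(\<Sum>i<M. cnj (V $$ (a,i)) * \<psi> i g) = (\<Sum>i<M. \<Sum>b<M. V $$ (b,i) * cnj (V $$ (a,i)) * F b g)"
      by (simp add: \<psi>_def sum_distrib_left mult.commute mult.left_commute)
    also have "\<dots> = (\<Sum>b<M. \<Sum>i<M. V $$ (b,i) * cnj (V $$ (a,i)) * F b g)" by (rule sum.swap)
    also have "\<dots> = (\<Sum>b<M. (V * adj V) $$ (b,a) * F b g)"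
      using V(1) that by (intro sum.cong refl) (simp add: mult_index_sum[of _ M M _ M] sum_distrib_right)
    also have "\<dots> = (\<Sum>b<M. if b = a then F a g else 0)" unfolding V(4) using that by (intro sum.cong refl) auto
    also have "\<dots> = F a g" using that by simp
    finally show ?thesis by simp
  qed
  have orth: "(\<integral>g. cnj (\<psi> i g) * \<psi> j g \<partial>\<mu>) = (if i = j then complex_of_real (L j) else 0)" if ij: "i < M" "j < M" for i j
  proof -
    have "(\<integral>g. cnj (\<psi> i g) * \<psi> j g \<partial>\<mu>) = (\<integral>g. (\<Sum>a<M. \<Sum>b<M. (cnj (V $$ (a,i)) * V $$ (b,j)) * (cnj (F a g) * F b g)) \<partial>\<mu>)"
      unfolding \<psi>_def cnj_sum sum_product
      by (intro Bochner_Integration.integral_cong sum.cong refl) (simp add: mult.commute mult.left_commute)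
    also have "\<dots> = (\<Sum>a<M. \<Sum>b<M. (cnj (V $$ (a,i)) * V $$ (b,j)) * (\<integral>g. cnj (F a g) * F b g \<partial>\<mu>))"
      using FF by (intro integral_double_sum(1)[symmetric])
    also have "\<dots> = (\<Sum>a<M. \<Sum>b<M. cnj (V $$ (a,i)) * K $$ (a,b) * V $$ (b,j))"
      by (simp add: K_def mult.commute mult.left_commute)
    also have "\<dots> = (\<Sum>b<M. \<Sum>a<M. cnj (V $$ (a,i)) * K $$ (a,b) * V $$ (b,j))" by (rule sum.swap)
    also have "\<dots> = (adj V * K * V) $$ (i,j)"
      using V(1) K ij by (simp add: mult_index_sum[of _ M M _ M] sq_mult_carrier sum_distrib_right)
    also have "\<dots> = (if i = j then complex_of_real (L j) else 0)"
      unfolding specD(2)[OF s] diagc_recover[OF uV] using ij by (simp add: mat_diag_index)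
    finally show ?thesis .
  qed
  have \<psi>int: "integrable \<mu> (\<lambda>g. cnj (\<psi> i g) * \<psi> j g)" for i j
    by (intro int continuous_intros \<psi>c)
  have norm2: "(\<integral>g. (cmod (\<Sum>i<M. z i * \<psi> i g))\<^sup>2 \<partial>\<mu>) = (\<Sum>i<M. (cmod (z i))\<^sup>2 * L i)" for z
  proof -
    have "complex_of_real (\<integral>g. (cmod (\<Sum>i<M. z i * \<psi> i g))\<^sup>2 \<partial>\<mu>) = (\<integral>g. complex_of_real ((cmod (\<Sum>i<M. z i * \<psi> i g))\<^sup>2) \<partial>\<mu>)"
      by (rule integral_complex_of_real[symmetric])
    also have "\<dots> = (\<integral>g. (\<Sum>i<M. \<Sum>j<M. (cnj (z i) * z j) * (cnj (\<psi> i g) * \<psi> j g)) \<partial>\<mu>)"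
      unfolding mult_cnj_cmod(2)[symmetric] cnj_sum sum_product
      by (intro Bochner_Integration.integral_cong sum.cong refl) (simp add: mult.commute mult.left_commute)
    also have "\<dots> = (\<Sum>i<M. \<Sum>j<M. (cnj (z i) * z j) * (\<integral>g. cnj (\<psi> i g) * \<psi> j g \<partial>\<mu>))"
      by (intro integral_double_sum(1)[symmetric] \<psi>int)
    also have "\<dots> = (\<Sum>i<M. \<Sum>j<M. if i = j then (cnj (z i) * z i) * complex_of_real (L i) else 0)"
      by (intro sum.cong refl) (auto simp: orth)
    also have "\<dots> = complex_of_real (\<Sum>i<M. (cmod (z i))\<^sup>2 * L i)"
      unfolding mult_cnj_cmod by simp
    finally show ?thesis using of_real_eq_iff by blast
  qed
  have Lint: "(\<integral>g. (cmod (\<psi> i g))\<^sup>2 \<partial>\<mu>) = L i" if "i < M" for i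
  proof -
    have "\<psi> i g = (\<Sum>j<M. (if j = i then 1 else 0) * \<psi> j g)" for g
      using that by (simp add: if_distrib[of "\<lambda>x. x * _"] cong: if_cong)
    then have "(\<integral>g. (cmod (\<psi> i g))\<^sup>2 \<partial>\<mu>) = (\<Sum>j<M. (cmod (if j = i then 1 else 0))\<^sup>2 * L j)"
      using norm2[of "\<lambda>j. if j = i then 1 else 0"] by simp
    also have "\<dots> = (\<Sum>j<M. if j = i then L j else 0)" by (intro sum.cong refl) auto
    also have "\<dots> = L i" using that by simp
    finally show ?thesis .
  qed
  have L0: "0 \<le> L i" if "i < M" for i unfolding Lint[OF that, symmetric] by simp
  have \<psi>0: "\<psi> i g = 0" if "i < M" "L i = 0" for i g
  proof -
    have "(cmod (\<psi> i g))\<^sup>2 = 0"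
      using Lint[OF that(1)] that(2)
      by (intro haar_full_support[OF cpt haar, of "\<lambda>g. (cmod (\<psi> i g))\<^sup>2"] continuous_intros \<psi>c) auto
    then show ?thesis by simp
  qed
  \<comment> \<open>The reproducing kernel on the diagonal: the best constant for evaluation at y.
    For L i = 0 the quotient is 0, as it should be, since \<psi> i is then zero.\<close>
  define k where "k y = (\<Sum>i<M. (cmod (\<psi> i y))\<^sup>2 / L i)" for y
  have k0: "0 \<le> k y" for y unfolding k_def using L0 by (intro sum_nonneg) auto
  have CS: "(cmod (\<Sum>i<M. z i * \<psi> i y))\<^sup>2 \<le> k y * (\<Sum>i<M. (cmod (z i))\<^sup>2 * L i)" for z y
  proof -
    have "cmod (\<Sum>i<M. z i * \<psi> i y) \<le> (\<Sum>i<M. cmod (z i * \<psi> i y))" by (rule norm_sum)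
    also have "\<dots> = (\<Sum>i<M. (cmod (\<psi> i y) / sqrt (L i)) * (cmod (z i) * sqrt (L i)))"
    proof (intro sum.cong refl)
      fix i assume "i \<in> {..<M}"
      then show "cmod (z i * \<psi> i y) = (cmod (\<psi> i y) / sqrt (L i)) * (cmod (z i) * sqrt (L i))"
        using \<psi>0[of i y] by (cases "L i = 0") (auto simp: norm_mult)
    qed
    finally have "(cmod (\<Sum>i<M. z i * \<psi> i y))\<^sup>2 \<le> (\<Sum>i<M. (cmod (\<psi> i y) / sqrt (L i)) * (cmod (z i) * sqrt (L i)))\<^sup>2"
      by (intro power_mono) auto
    also have "\<dots> \<le> (\<Sum>i<M. (cmod (\<psi> i y) / sqrt (L i))\<^sup>2) * (\<Sum>i<M. (cmod (z i) * sqrt (L i))\<^sup>2)"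
      by (rule Cauchy_Schwarz_ineq_sum)
    also have "\<dots> = k y * (\<Sum>i<M. (cmod (z i))\<^sup>2 * L i)"
      unfolding k_def using L0 by (simp add: power_divide power_mult_distrib)
    finally show ?thesis .
  qed
  have change: "(\<Sum>a<M. x a * F a g) = (\<Sum>i<M. (\<Sum>a<M. x a * cnj (V $$ (a,i))) * \<psi> i g)" for x g
  proof -
    have "(\<Sum>a<M. x a * F a g) = (\<Sum>a<M. \<Sum>i<M. x a * cnj (V $$ (a,i)) * \<psi> i g)"
      by (simp add: F\<psi> sum_distrib_left mult.assoc)
    also have "\<dots> = (\<Sum>i<M. \<Sum>a<M. x a * cnj (V $$ (a,i)) * \<psi> i g)" by (rule sum.swap)
    finally show ?thesis by (simp add: sum_distrib_right)
  qed
  have bound: "(cmod (\<Sum>a<M. x a * F a y))\<^sup>2 \<le> k y * (\<integral>g. (cmod (\<Sum>a<M. x a * F a g))\<^sup>2 \<partial>\<mu>)" for x y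
    unfolding change norm2 by (rule CS)
  have k_le: "k 0 \<le> k y" for y
  proof (cases "k 0 = 0")
    case False
    \<comment> \<open>Coefficients of the extremal function for evaluation at 0, namely the kernel
      function there: both its value at 0 and its square norm equal k 0. Translating it moves the
      extremal point to y without changing the norm, which compares k 0 with k y.\<close>
    define z where "z i = cnj (\<psi> i 0) / complex_of_real (L i)" for i
    define h where "h g = (\<Sum>i<M. z i * \<psi> i g)" for g
    have hc: "continuous_on UNIV h" unfolding h_def by (intro continuous_intros \<psi>c)
    have "h 0 = (\<Sum>i<M. complex_of_real ((cmod (\<psi> i 0))\<^sup>2 / L i))"
      unfolding h_def z_def by (intro sum.cong refl) (simp add: mult_cnj_cmod flip: of_real_power)
    then have h0: "h 0 = complex_of_real (k 0)" by (simp add: k_def)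
    have "(\<integral>g. (cmod (h g))\<^sup>2 \<partial>\<mu>) = (\<Sum>i<M. (cmod (z i))\<^sup>2 * L i)"
      unfolding h_def by (rule norm2)
    also have "\<dots> = k 0"
      unfolding k_def z_def using L0 by (intro sum.cong refl) (auto simp: norm_divide power_divide power2_eq_square)
    finally have hn: "(\<integral>g. (cmod (h g))\<^sup>2 \<partial>\<mu>) = k 0" .
    have "\<exists>x. \<forall>g. h (- y + g) = (\<Sum>a<M. x a * F a g)"
    proof -
      obtain c where c: "\<And>a g. a < M \<Longrightarrow> F a (- y + g) = (\<Sum>b<M. c a b * F b g)"
        using trans[of _ "- y"] by metis
      have "h (- y + g) = (\<Sum>b<M. (\<Sum>i<M. \<Sum>a<M. z i * V $$ (a,i) * c a b) * F b g)" for g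
      proof -
        have "h (- y + g) = (\<Sum>i<M. \<Sum>a<M. \<Sum>b<M. z i * V $$ (a,i) * c a b * F b g)"
          by (simp add: h_def \<psi>_def c sum_distrib_left mult.assoc)
        also have "\<dots> = (\<Sum>i<M. \<Sum>b<M. \<Sum>a<M. z i * V $$ (a,i) * c a b * F b g)"
          by (intro sum.cong refl sum.swap)
        also have "\<dots> = (\<Sum>b<M. \<Sum>i<M. \<Sum>a<M. z i * V $$ (a,i) * c a b * F b g)" by (rule sum.swap)
        finally show ?thesis by (simp add: sum_distrib_right)
      qed
      then show ?thesis by (intro exI[of _ "\<lambda>b. \<Sum>i<M. \<Sum>a<M. z i * V $$ (a,i) * c a b"] allI)
    qed
    then obtain x where x: "\<And>g. h (- y + g) = (\<Sum>a<M. x a * F a g)" by blast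
    have "(cmod (h (- y + y)))\<^sup>2 \<le> k y * (\<integral>g. (cmod (h (- y + g)))\<^sup>2 \<partial>\<mu>)"
      unfolding x by (rule bound)
    also have "(\<integral>g. (cmod (h (- y + g)))\<^sup>2 \<partial>\<mu>) = k 0"
      using haar_translate[OF haar, of "\<lambda>g. (cmod (h g))\<^sup>2" "- y"] hn hc by (simp add: continuous_intros)
    finally have "k 0 * k 0 \<le> k y * k 0" using h0 by (simp add: power2_eq_square)
    then show ?thesis using False k0[of 0] by (simp add: mult_le_cancel_right)
  qed (simp add: k0)
  have kint: "integrable \<mu> (\<lambda>g. (cmod (\<psi> i g))\<^sup>2 / L i)" for i
    by (intro integrable_divide int continuous_intros \<psi>c)
  \<comment> \<open>The integral of the kernel counts the indices with L i nonzero, of which there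
    are at most M.\<close>
  have "k 0 = (\<integral>y. k 0 \<partial>\<mu>)" by (simp add: prob_space)
  also have "\<dots> \<le> (\<integral>y. k y \<partial>\<mu>)"
    using k_le by (intro integral_mono) (auto simp: k_def intro!: Bochner_Integration.integrable_sum kint)
  also have "\<dots> = (\<Sum>i<M. (\<integral>g. (cmod (\<psi> i g))\<^sup>2 / L i \<partial>\<mu>))"
    unfolding k_def by (intro Bochner_Integration.integral_sum kint)
  also have "\<dots> = (\<Sum>i<M. L i / L i)" by (intro sum.cong refl) (simp add: Lint)
  also have "\<dots> \<le> (\<Sum>i<M. 1)" by (intro sum_mono) simp
  finally have "k 0 \<le> real M" by simp
  then have "k 0 * (\<integral>g. (cmod (\<Sum>a<M. x a * F a g))\<^sup>2 \<partial>\<mu>) \<le> real M * (\<integral>g. (cmod (\<Sum>a<M. x a * F a g))\<^sup>2 \<partial>\<mu>)"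
    by (intro mult_right_mono) auto
  with bound[of x 0] show ?thesis by linarith
qed

section \<open>Domination of a tensor power by its Haar average\<close>

text \<open>Several matrix positions may carry the same function. This collects their coefficients,
  so that an expansion over positions becomes one over distinct functions.\<close>

lemma sum_regroup:
  fixes f :: "nat \<Rightarrow> complex"
  assumes "finite I" "\<And>k. k \<in> I \<Longrightarrow> \<iota> k < M"
  shows "(\<Sum>k\<in>I. c k * f (\<iota> k)) = (\<Sum>b<M. (\<Sum>k\<in>{k\<in>I. \<iota> k = b}. c k) * f b)"
proof -
  have "(\<Sum>k\<in>I. c k * f (\<iota> k)) = (\<Sum>b\<in>{..<M}. \<Sum>k\<in>{k\<in>I. \<iota> k = b}. c k * f (\<iota> k))"
    using assms by (intro sum.group[symmetric]) auto
  also have "\<dots> = (\<Sum>b<M. (\<Sum>k\<in>{k\<in>I. \<iota> k = b}. c k) * f b)"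
    unfolding sum_distrib_right by (intro sum.cong refl) auto
  finally show ?thesis .
qed

text \<open>A set of functions rather than of positions, so that coinciding entries count once. The
  conjugate appears because the quadratic form pairs v with the conjugated columns of R g U.\<close>

definition entry_funs :: "nat \<Rightarrow> ('g \<Rightarrow> complex mat) \<Rightarrow> ('g \<Rightarrow> complex) set" where
  "entry_funs N R = {\<lambda>g. cnj (R g $$ (i,j)) | i j. i < N \<and> j < N}"

lemma finite_entry_funs: "finite (entry_funs N R)"
proof -
  have "entry_funs N R = (\<lambda>(i,j) g. cnj (R g $$ (i,j))) ` ({..<N} \<times> {..<N})"
    by (auto simp: entry_funs_def)
  then show ?thesis by simp
qed

lemma rep_zero:
  assumes "cont_unitary_rep N R"
  shows "R 0 = 1\<^sub>m N"
proof -
  note u = cont_unitary_repD[OF assms]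
  have "R 0 = R 0 * R 0" using u(3)[of 0 0] by simp
  then have "adj (R 0) * R 0 = adj (R 0) * (R 0 * R 0)" by simp
  then show ?thesis using unitary_cancel(1)[OF u(1)[of 0] u(2)[of 0]] unitary_matD(3)[OF u(1)[of 0]] by simp
qed

text \<open>For every eigenvector of X, its translate paired with v is a function of g in the span
  of the entry functions. The point bound at the neutral element, weighted with the eigenvalues and
  summed, is the claim.\<close>

lemma quad_form_le_avg:
  fixes R :: "'g::{topological_group_add, t2_space} \<Rightarrow> complex mat"
  assumes cpt: "compact (UNIV :: 'g set)" and haar: "haar_prob \<mu>" and rep: "cont_unitary_rep N R"
    and X: "density N X"
  shows "quad_form N X v \<le> real (card (entry_funs N R)) * quad_form N (avg N R \<mu> X) v"
proof -
  obtain U a where s: "spectral_dec N U a X" and a: "\<And>i. i < N \<Longrightarrow> 0 \<le> a i" using density_spec[OF X] by metis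
  note S = specD[OF s] and U = unitary_matD[OF specD(1)[OF s]] and rep' = cont_unitary_repD[OF rep]
  define M where "M = card (entry_funs N R)"
  obtain F where F: "bij_betw F {0..<M} (entry_funs N R)"
    using ex_bij_betw_nat_finite[OF finite_entry_funs[of N R]] unfolding M_def by blast
  have Fi: "\<exists>i j. i < N \<and> j < N \<and> F b = (\<lambda>g. cnj (R g $$ (i,j)))" if "b < M" for b
  proof -
    have "F b \<in> entry_funs N R" using F that unfolding bij_betw_def by auto
    then show ?thesis by (auto simp: entry_funs_def)
  qed
  have "\<exists>b<M. F b = (\<lambda>g. cnj (R g $$ (i,j)))" if "i < N" "j < N" for i j
  proof -
    have "(\<lambda>g. cnj (R g $$ (i,j))) \<in> entry_funs N R" using that by (auto simp: entry_funs_def)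
    then have "(\<lambda>g. cnj (R g $$ (i,j))) \<in> F ` {0..<M}" using F unfolding bij_betw_def by simp
    then show ?thesis by auto
  qed
  then obtain \<iota> where \<iota>: "\<And>i j. i < N \<Longrightarrow> j < N \<Longrightarrow> \<iota> i j < M \<and> F (\<iota> i j) = (\<lambda>g. cnj (R g $$ (i,j)))" by metis
  have cont: "continuous_on UNIV (F b)" if "b < M" for b
    using Fi[OF that] rep'(4) by (auto intro!: continuous_intros)
  have trans: "\<exists>c. \<forall>g. F b (y + g) = (\<Sum>b'<M. c b' * F b' g)" if b: "b < M" for b y
  proof -
    obtain i j where ij: "i < N" "j < N" "F b = (\<lambda>g. cnj (R g $$ (i,j)))" using Fi[OF b] by blast
    \<comment> \<open>R (y + g) = R y * R g expands an entry of column j over the entries of R g in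
      the same column, so the span of the entry functions is translation invariant.\<close>
    define c where "c b' = (\<Sum>k\<in>{k\<in>{..<N}. \<iota> k j = b'}. cnj (R y $$ (i,k)))" for b'
    have "F b (y + g) = (\<Sum>b'<M. c b' * F b' g)" for g
    proof -
      have "F b (y + g) = (\<Sum>k<N. cnj (R y $$ (i,k)) * F (\<iota> k j) g)"
        using ij \<iota> rep'(2) by (simp add: rep'(3) mult_index_sum[of _ N N _ N])
      also have "\<dots> = (\<Sum>b'<M. c b' * F b' g)"
        unfolding c_def using \<iota> ij by (intro sum_regroup) auto
      finally show ?thesis .
    qed
    then show ?thesis by blast
  qed
  \<comment> \<open>The inner product of R g u with v, where u is the k-th column of U; at g = 0 it
    gives the quadratic form of X itself.\<close>
  define h where "h k g = (\<Sum>i<N. cnj ((R g * U) $$ (i,k)) * v i)" for k g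
  have RU: "R g * U \<in> carrier_mat N N" for g using U rep'(2) by (simp add: sq_mult_carrier)
  have hF: "\<exists>x. \<forall>g. h k g = (\<Sum>b<M. x b * F b g)" if k: "k < N" for k
  proof -
    define x where "x b = (\<Sum>p\<in>{p\<in>{..<N}\<times>{..<N}. \<iota> (fst p) (snd p) = b}. cnj (U $$ (snd p,k)) * v (fst p))" for b
    have "h k g = (\<Sum>p\<in>{..<N}\<times>{..<N}. (cnj (U $$ (snd p,k)) * v (fst p)) * F (\<iota> (fst p) (snd p)) g)" for g
    proof -
      have "h k g = (\<Sum>i<N. \<Sum>l<N. (cnj (U $$ (l,k)) * v i) * F (\<iota> i l) g)"
        unfolding h_def using k \<iota> rep'(2)[of g] U(1)
        by (intro sum.cong refl) (simp add: mult_index_sum[of _ N N _ N] sum_distrib_left sum_distrib_right mult.commute mult.left_commute)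
      then show ?thesis by (simp add: sum.cartesian_product split_def)
    qed
    moreover have "(\<Sum>p\<in>{..<N}\<times>{..<N}. (cnj (U $$ (snd p,k)) * v (fst p)) * F (\<iota> (fst p) (snd p)) g) = (\<Sum>b<M. x b * F b g)" for g
      unfolding x_def using \<iota> by (intro sum_regroup) auto
    ultimately have "\<forall>g. h k g = (\<Sum>b<M. x b * F b g)" by simp
    then show ?thesis by blast
  qed
  have hb: "(cmod (h k 0))\<^sup>2 \<le> real M * (\<integral>g. (cmod (h k g))\<^sup>2 \<partial>\<mu>)" if k: "k < N" for k
  proof -
    obtain x where "\<And>g. h k g = (\<Sum>b<M. x b * F b g)" using hF[OF k] by blast
    then show ?thesis using invariant_space_point_bound[OF cpt haar cont trans, of x] by simp
  qed
  have q: "quad_form N (R g * X * adj (R g)) v = (\<Sum>k<N. a k * (cmod (h k g))\<^sup>2)" for g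
    unfolding conj_spec[OF cpt haar rep s] quad_form_diagc[OF RU] h_def ..
  have hc: "continuous_on UNIV (h k)" if k: "k < N" for k
  proof -
    obtain x where "\<And>g. h k g = (\<Sum>b<M. x b * F b g)" using hF[OF k] by blast
    then have "h k = (\<lambda>g. \<Sum>b<M. x b * F b g)" by auto
    then show ?thesis by (auto intro!: continuous_intros cont)
  qed
  have "quad_form N X v = (\<Sum>k<N. a k * (cmod (h k 0))\<^sup>2)"
  proof -
    have "quad_form N X v = (\<Sum>k<N. a k * (cmod (\<Sum>i<N. cnj (U $$ (i,k)) * v i))\<^sup>2)"
      unfolding S(2) by (rule quad_form_diagc[OF U(1)])
    then show ?thesis unfolding h_def rep_zero[OF rep] using U(1) by simp
  qed
  also have "\<dots> \<le> (\<Sum>k<N. a k * (real M * (\<integral>g. (cmod (h k g))\<^sup>2 \<partial>\<mu>)))"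
    using hb a by (intro sum_mono mult_left_mono) auto
  also have "\<dots> = real M * (\<Sum>k<N. (\<integral>g. a k * (cmod (h k g))\<^sup>2 \<partial>\<mu>))"
    by (simp add: sum_distrib_left mult.left_commute)
  also have "(\<Sum>k<N. (\<integral>g. a k * (cmod (h k g))\<^sup>2 \<partial>\<mu>)) = (\<integral>g. (\<Sum>k<N. a k * (cmod (h k g))\<^sup>2) \<partial>\<mu>)"
    using hc by (intro Bochner_Integration.integral_sum[symmetric] continuous_integrable_haar[OF cpt haar] continuous_intros) auto
  also have "\<dots> = quad_form N (avg N R \<mu> X) v"
    unfolding quad_form_avg(1)[OF cpt haar rep S(3)] q ..
  finally show ?thesis by (simp add: M_def)
qed

section \<open>Polynomial counts for tensor powers\<close>

lemma fun_upd_Suc_PiE: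
  fixes k :: "'a \<Rightarrow> nat"
  assumes "k \<in> I \<rightarrow>\<^sub>E {..n}" "p0 \<in> I"
  shows "k(p0 := Suc (k p0)) \<in> I \<rightarrow>\<^sub>E {..Suc n}"
proof (rule PiE_I)
  fix p assume "p \<in> I"
  then have "k p \<le> n" "k p0 \<le> n" using assms PiE_mem by force+
  then show "(k(p0 := Suc (k p0))) p \<in> {..Suc n}" by simp
next
  fix p assume "p \<notin> I"
  then show "(k(p0 := Suc (k p0))) p = undefined" using assms PiE_arb by fastforce
qed

text \<open>An entry of the tensor power is a product of n entries of A, and depends only on how
  often each position (i,j) occurs. The exponents must not depend on A, because A will vary over the
  representation.\<close>

lemma tpow_entry_monomial:
  assumes "i < d^n" "j < d^n"
  shows "\<exists>k \<in> ({..<d}\<times>{..<d}) \<rightarrow>\<^sub>E {..n}. \<forall>A \<in> carrier_mat d d.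
    tpow n A $$ (i,j) = (\<Prod>p\<in>{..<d}\<times>{..<d}. A $$ p ^ k p)"
  using assms
proof (induction n arbitrary: i j)
  case 0
  then show ?case by (intro bexI[of _ "\<lambda>p\<in>{..<d}\<times>{..<d}. 0"]) auto
next
  case (Suc n)
  then have ij: "i < d^n*d" "j < d^n*d" by (simp_all add: mult.commute)
  note dm = div_mod_less[OF ij(1)] div_mod_less[OF ij(2)]
  obtain k where k: "k \<in> ({..<d}\<times>{..<d}) \<rightarrow>\<^sub>E {..n}"
    "\<And>A. A \<in> carrier_mat d d \<Longrightarrow> tpow n A $$ (i div d, j div d) = (\<Prod>p\<in>{..<d}\<times>{..<d}. A $$ p ^ k p)"
    using Suc.IH[OF dm(1,3)] by blast
  define p0 where "p0 = (i mod d, j mod d)"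
  have p0: "p0 \<in> {..<d}\<times>{..<d}" using dm by (simp add: p0_def)
  define k' where "k' = k(p0 := Suc (k p0))"
  have "k' \<in> ({..<d}\<times>{..<d}) \<rightarrow>\<^sub>E {..Suc n}"
    using fun_upd_Suc_PiE[OF k(1)] p0 unfolding k'_def by simp
  moreover have "tpow (Suc n) A $$ (i,j) = (\<Prod>p\<in>{..<d}\<times>{..<d}. A $$ p ^ k' p)" if A: "A \<in> carrier_mat d d" for A
  proof -
    have "tpow (Suc n) A $$ (i,j) = tpow n A $$ (i div d, j div d) * A $$ p0"
      using kron_index[of "tpow n A" "d^n" "d^n" A d d i j] ij A by (simp add: p0_def)
    also have "\<dots> = (\<Prod>p\<in>{..<d}\<times>{..<d}. A $$ p ^ k p) * A $$ p0" using k(2)[OF A] by simp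
    also have "\<dots> = (\<Prod>p\<in>{..<d}\<times>{..<d}. A $$ p ^ k' p)"
      using p0 by (subst (1 2) prod.remove[of _ p0]) (auto simp: k'_def)
    finally show ?thesis .
  qed
  ultimately show ?case by blast
qed

text \<open>One exponent between 0 and n for each of the d * d positions. That the exponents add up
  to n would give a sharper count, but any polynomial suffices.\<close>

lemma card_entry_funs_tpow:
  assumes "\<And>g. u g \<in> carrier_mat d d"
  shows "card (entry_funs (d^n) (\<lambda>g. tpow n (u g))) \<le> (n+1)^(d*d)"
proof -
  define \<phi> where "\<phi> k g = cnj (\<Prod>p\<in>{..<d}\<times>{..<d}. u g $$ p ^ k p)" for k g
  have "entry_funs (d^n) (\<lambda>g. tpow n (u g)) \<subseteq> \<phi> ` (({..<d}\<times>{..<d}) \<rightarrow>\<^sub>E {..n})"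
  proof
    fix f assume "f \<in> entry_funs (d^n) (\<lambda>g. tpow n (u g))"
    then obtain i j where ij: "i < d^n" "j < d^n" "f = (\<lambda>g. cnj (tpow n (u g) $$ (i,j)))"
      by (auto simp: entry_funs_def)
    obtain k where k: "k \<in> ({..<d}\<times>{..<d}) \<rightarrow>\<^sub>E {..n}"
      "\<forall>A \<in> carrier_mat d d. tpow n A $$ (i,j) = (\<Prod>p\<in>{..<d}\<times>{..<d}. A $$ p ^ k p)"
      using tpow_entry_monomial[OF ij(1,2)] by blast
    have "f = \<phi> k" unfolding ij(3) \<phi>_def using k(2) assms by auto
    then show "f \<in> \<phi> ` (({..<d}\<times>{..<d}) \<rightarrow>\<^sub>E {..n})" using k(1) by blast
  qed
  moreover have fin: "finite (({..<d}\<times>{..<d}) \<rightarrow>\<^sub>E {..n})" by (intro finite_PiE) auto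
  ultimately have "card (entry_funs (d^n) (\<lambda>g. tpow n (u g))) \<le> card (({..<d}\<times>{..<d}) \<rightarrow>\<^sub>E {..n})"
    by (meson card_image_le card_mono finite_imageI le_trans)
  also have "\<dots> = (n+1)^(d*d)" by (simp add: card_PiE)
  finally show ?thesis .
qed

lemma tvec_monomial:
  assumes "i < d^n"
  shows "\<exists>k \<in> {..<d} \<rightarrow>\<^sub>E {..n}. tvec d n b i = (\<Prod>p<d. b p ^ k p)"
  using assms
proof (induction n arbitrary: i)
  case 0
  then show ?case by (intro bexI[of _ "\<lambda>p\<in>{..<d}. 0"]) auto
next
  case (Suc n)
  then have i: "i < d^n*d" by (simp add: mult.commute)
  note dm = div_mod_less[OF i]
  obtain k where k: "k \<in> {..<d} \<rightarrow>\<^sub>E {..n}" "tvec d n b (i div d) = (\<Prod>p<d. b p ^ k p)"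
    using Suc.IH[OF dm(1)] by blast
  define p0 where "p0 = i mod d"
  have p0: "p0 < d" using dm by (simp add: p0_def)
  define k' where "k' = k(p0 := Suc (k p0))"
  have "k' \<in> {..<d} \<rightarrow>\<^sub>E {..Suc n}"
    using fun_upd_Suc_PiE[OF k(1)] p0 unfolding k'_def by simp
  moreover have "tvec d (Suc n) b i = (\<Prod>p<d. b p ^ k' p)"
  proof -
    have "tvec d (Suc n) b i = (\<Prod>p<d. b p ^ k p) * b p0" using k(2) by (simp add: p0_def)
    also have "\<dots> = (\<Prod>p<d. b p ^ k' p)"
      using p0 by (subst (1 2) prod.remove[of _ p0]) (auto simp: k'_def)
    finally show ?thesis .
  qed
  ultimately show ?case by blast
qed

text \<open>The same count for eigenvalues of the n-th tensor power: they are monomials in the d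
  eigenvalues of the single factor.\<close>

lemma card_tvec_image: "card (tvec d n b ` {..<d^n}) \<le> (n+1)^d"
proof -
  have "tvec d n b ` {..<d^n} \<subseteq> (\<lambda>k. \<Prod>p<d. b p ^ k p) ` ({..<d} \<rightarrow>\<^sub>E {..n})"
    using tvec_monomial[of _ d n b] by blast
  moreover have "finite ({..<d} \<rightarrow>\<^sub>E {..n})" by (intro finite_PiE) auto
  ultimately have "card (tvec d n b ` {..<d^n}) \<le> card ({..<d} \<rightarrow>\<^sub>E {..n})"
    by (meson card_image_le card_mono finite_imageI le_trans)
  also have "\<dots> = (n+1)^d" by (simp add: card_PiE)
  finally show ?thesis .
qed

section \<open>Pinching\<close>

definition mv :: "nat \<Rightarrow> complex mat \<Rightarrow> (nat \<Rightarrow> complex) \<Rightarrow> nat \<Rightarrow> complex" where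
  "mv n A v i = (\<Sum>j<n. A $$ (i,j) * v j)"

lemma mv_mult:
  assumes "A \<in> carrier_mat n n" "B \<in> carrier_mat n n" "i < n"
  shows "mv n (A * B) v i = mv n A (mv n B v) i"
proof -
  have "mv n (A * B) v i = (\<Sum>j<n. \<Sum>k<n. A $$ (i,k) * B $$ (k,j) * v j)"
    using assms by (simp add: mv_def mult_index_sum[of _ n n _ n] sum_distrib_right)
  also have "\<dots> = (\<Sum>k<n. \<Sum>j<n. A $$ (i,k) * B $$ (k,j) * v j)" by (rule sum.swap)
  finally show ?thesis by (simp add: mv_def sum_distrib_left mult.assoc)
qed

lemma mv_adj:
  assumes "V \<in> carrier_mat n n"
  shows "(\<Sum>i<n. cnj (v i) * mv n V w i) = (\<Sum>k<n. cnj (mv n (adj V) v k) * w k)"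
proof -
  have "(\<Sum>i<n. cnj (v i) * mv n V w i) = (\<Sum>i<n. \<Sum>k<n. cnj (v i) * V $$ (i,k) * w k)"
    by (simp add: mv_def sum_distrib_left mult.assoc)
  also have "\<dots> = (\<Sum>k<n. \<Sum>i<n. cnj (v i) * V $$ (i,k) * w k)" by (rule sum.swap)
  also have "\<dots> = (\<Sum>k<n. cnj (mv n (adj V) v k) * w k)"
    using assms by (intro sum.cong refl) (simp add: mv_def sum_distrib_left sum_distrib_right mult.commute)
  finally show ?thesis .
qed

lemma quad_form_mv: "quad_form n A v = Re (\<Sum>i<n. cnj (v i) * mv n A v i)"
  by (simp add: quad_form_def mv_def sum_distrib_left mult.assoc)

lemma quad_form_change_basis:
  assumes "V \<in> carrier_mat n n" "t \<in> carrier_mat n n"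
  shows "quad_form n (V * t * adj V) v = quad_form n t (mv n (adj V) v)"
proof -
  have "mv n (V * t * adj V) v i = mv n V (mv n t (mv n (adj V) v)) i" if "i < n" for i
  proof -
    have "mv n (V * t * adj V) v i = mv n (V * t) (mv n (adj V) v) i"
      using assms that by (intro mv_mult) (auto simp: sq_mult_carrier)
    also have "\<dots> = mv n V (mv n t (mv n (adj V) v)) i" using assms that by (intro mv_mult)
    finally show ?thesis .
  qed
  then show ?thesis unfolding quad_form_mv using mv_adj[OF assms(1)] by simp
qed

text \<open>If u is an eigenvector of \<rho> with eigenvalue a, domination tested on the
  pseudo-inverse of \<omega> applied to u bounds a times the expectation of that inverse in u by C.
  Then ln x \<le> x - 1 with x = a / (C o), averaged over the overlaps, leaves only ln C.\<close>

lemma rel_ent_dominated: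
  assumes \<rho>: "spectral_dec n U a \<rho>" "\<And>i. i < n \<Longrightarrow> 0 \<le> a i" "(\<Sum>i<n. a i) = 1"
    and \<omega>: "spectral_dec n W o' \<omega>" "\<And>i. i < n \<Longrightarrow> 0 \<le> o' i"
    and C: "C > 0" and dom: "\<And>v. quad_form n \<rho> v \<le> C * quad_form n \<omega> v"
  shows "supp_le n (overlap U W) a o'" "rel_ent n (overlap U W) a o' \<le> ln C"
proof -
  note S = specD[OF \<rho>(1)] and T = specD[OF \<omega>(1)]
  note U = unitary_matD[OF S(1)] and W = unitary_matD[OF T(1)]
  define Y where "Y = adj U * W"
  have Y: "Y \<in> carrier_mat n n" using U W by (simp add: Y_def sq_mult_carrier)
  have D: "(\<Sum>l<n. a l * (cmod (\<Sum>j<n. Y $$ (l,j) * y j))\<^sup>2) \<le> C * (\<Sum>i<n. o' i * (cmod (y i))\<^sup>2)" for y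
  proof -
    define v where "v = mv n W y"
    have 1: "(\<Sum>x<n. cnj (U $$ (x,l)) * v x) = (\<Sum>j<n. Y $$ (l,j) * y j)" if "l < n" for l
    proof -
      have "(\<Sum>x<n. cnj (U $$ (x,l)) * v x) = mv n (adj U) v l" using U that by (simp add: mv_def)
      also have "\<dots> = mv n Y y l" unfolding v_def Y_def using U W that by (intro mv_mult[symmetric])
      finally show ?thesis by (simp add: mv_def)
    qed
    have 2: "(\<Sum>x<n. cnj (W $$ (x,l)) * v x) = y l" if "l < n" for l
    proof -
      have "(\<Sum>x<n. cnj (W $$ (x,l)) * v x) = mv n (adj W) v l" using W that by (simp add: mv_def)
      also have "\<dots> = mv n (adj W * W) y l" unfolding v_def using W that by (intro mv_mult[symmetric])
      also have "\<dots> = (\<Sum>j<n. if l = j then y j else 0)"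
        unfolding W(3) mv_def using that by (intro sum.cong refl) auto
      finally show ?thesis using that by simp
    qed
    have "quad_form n \<rho> v = (\<Sum>l<n. a l * (cmod (\<Sum>j<n. Y $$ (l,j) * y j))\<^sup>2)"
      unfolding S(2) quad_form_diagc[OF U(1)] using 1 by simp
    moreover have "quad_form n \<omega> v = (\<Sum>i<n. o' i * (cmod (y i))\<^sup>2)"
      unfolding T(2) quad_form_diagc[OF W(1)] using 2 by simp
    ultimately show ?thesis using dom[of v] by simp
  qed
  have D1: "a k * (cmod (\<Sum>j<n. Y $$ (k,j) * y j))\<^sup>2 \<le> C * (\<Sum>i<n. o' i * (cmod (y i))\<^sup>2)" if "k < n" for k y
  proof -
    have "a k * (cmod (\<Sum>j<n. Y $$ (k,j) * y j))\<^sup>2 \<le> (\<Sum>l<n. a l * (cmod (\<Sum>j<n. Y $$ (l,j) * y j))\<^sup>2)"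
      using that \<rho>(2) by (intro member_le_sum[of k "{..<n}" "\<lambda>l. a l * (cmod (\<Sum>j<n. Y $$ (l,j) * y j))\<^sup>2"]) auto
    then show ?thesis using D[of y] by linarith
  qed
  have overlapY: "overlap U W k j = (cmod (Y $$ (k,j)))\<^sup>2" for k j by (simp add: overlap_def Y_def)
  show supp: "supp_le n (overlap U W) a o'" unfolding supp_le_def
  proof (intro allI impI)
    fix k i assume ki: "k < n" "i < n" "a k \<noteq> 0 \<and> o' i = 0"
    have e: "(\<Sum>j<n. Y $$ (k,j) * (if j = i then 1 else 0)) = Y $$ (k,i)"
      using ki by (simp add: if_distrib[of "\<lambda>x. _ * x"] cong: if_cong)
    have "(\<Sum>j<n. o' j * (cmod (if j = i then 1 else 0))\<^sup>2) = 0" using ki by (intro sum.neutral) auto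
    then have "a k * overlap U W k i \<le> 0" using D1[OF ki(1), of "\<lambda>j. if j = i then 1 else 0"] unfolding e overlapY by simp
    moreover have "a k > 0" using \<rho>(2)[OF ki(1)] ki by simp
    ultimately show "overlap U W k i = 0" using overlap_nonneg[of U W k i] by (simp add: mult_le_0_iff)
  qed
  \<comment> \<open>The expectation of the pseudo-inverse of \<omega> in the k-th eigenvector of
    \<rho>; zero eigenvalues of \<omega> contribute 0 by the division convention.\<close>
  define z where "z k = (\<Sum>i<n. overlap U W k i / o' i)" for k
  have z0: "0 \<le> z k" for k unfolding z_def using \<omega>(2) by (intro sum_nonneg) auto
  have az: "a k * z k \<le> C" if k: "k < n" for k
  proof (cases "z k = 0")
    case True
    then show ?thesis using C by simp
  next
    case False
    \<comment> \<open>Coordinates, in the eigenbasis of \<omega>, of the pseudo-inverse applied to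
      the k-th eigenvector of \<rho>. For this vector both the pairing with that eigenvector and the
      form of \<omega> equal z k.\<close>
    define y where "y i = cnj (Y $$ (k,i)) / complex_of_real (o' i)" for i
    have "(\<Sum>j<n. Y $$ (k,j) * y j) = (\<Sum>j<n. complex_of_real (overlap U W k j / o' j))"
      by (intro sum.cong refl) (simp add: y_def overlapY mult_cnj_cmod)
    then have 1: "(\<Sum>j<n. Y $$ (k,j) * y j) = complex_of_real (z k)" by (simp add: z_def)
    have 2: "(\<Sum>i<n. o' i * (cmod (y i))\<^sup>2) = z k"
      unfolding z_def using \<omega>(2)
      by (intro sum.cong refl) (auto simp: y_def overlapY norm_divide power_divide power2_eq_square)
    have "a k * (z k * z k) \<le> C * z k" using D1[OF k, of y] unfolding 1 2 by (simp add: power2_eq_square)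
    then have "a k * z k * z k \<le> C * z k" by (simp add: mult.assoc)
    then show ?thesis using False z0[of k] by (simp add: mult_le_cancel_right)
  qed
  have "rel_ent n (overlap U W) a o' \<le> (\<Sum>k<n. \<Sum>i<n. overlap U W k i * (a k * (ln C - 1 + (a k / C) / o' i)))"
    unfolding rel_ent_def
  proof (intro sum_mono)
    fix k i assume "k \<in> {..<n}" "i \<in> {..<n}"
    then have ki: "k < n" "i < n" by auto
    show "overlap U W k i * (a k * (ln (a k) - ln (o' i))) \<le> overlap U W k i * (a k * (ln C - 1 + (a k / C) / o' i))"
    proof (cases "overlap U W k i = 0 \<or> a k = 0")
      case False
      then have pos: "a k > 0" "o' i > 0"
        using \<rho>(2)[OF ki(1)] \<omega>(2)[OF ki(2)] supp_leD[OF supp ki] by (force simp: less_le)+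
      \<comment> \<open>The -1 from this tangent bound is later cancelled by the quotient, whose
        average is at most 1 by \<open>az\<close>.\<close>
      have "ln (a k / (C * o' i)) \<le> a k / (C * o' i) - 1" using pos C by (intro ln_le_minus_one) simp
      then have "ln (a k) - ln (o' i) \<le> ln C - 1 + (a k / C) / o' i" using pos C by (simp add: ln_div ln_mult)
      then show ?thesis using pos by (intro mult_left_mono) auto
    qed auto
  qed
  also have "\<dots> = (\<Sum>k<n. \<Sum>i<n. a k * (ln C - 1) * overlap U W k i + (a k * a k / C) * (overlap U W k i / o' i))"
    by (intro sum.cong refl) (simp add: algebra_simps)
  also have "\<dots> = (\<Sum>k<n. a k * (ln C - 1) * (\<Sum>i<n. overlap U W k i) + a k * (a k * z k / C))"
    unfolding sum.distrib sum_distrib_left[symmetric] z_def[symmetric] by (simp add: mult.assoc)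
  also have "\<dots> \<le> (\<Sum>k<n. a k * (ln C - 1) * 1 + a k * 1)"
  proof (intro sum_mono add_mono)
    fix k assume "k \<in> {..<n}"
    then have k: "k < n" by simp
    show "a k * (ln C - 1) * (\<Sum>i<n. overlap U W k i) \<le> a k * (ln C - 1) * 1" using overlap_sum_right[OF S(1) T(1) k] by simp
    show "a k * (a k * z k / C) \<le> a k * 1"
      using az[OF k] C \<rho>(2)[OF k] by (intro mult_left_mono) (auto simp: divide_le_eq)
  qed
  also have "\<dots> = (\<Sum>k<n. a k) * ln C" unfolding sum_distrib_right by (simp add: algebra_simps)
  also have "\<dots> = ln C" using \<rho>(3) by simp
  finally show "rel_ent n (overlap U W) a o' \<le> ln C" .
qed

text \<open>In the eigenbasis of \<open>\<sigma>\<close>, pinching deletes the entries linking different eigenvalues.\<close>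

definition pinch :: "nat \<Rightarrow> complex mat \<Rightarrow> (nat \<Rightarrow> real) \<Rightarrow> complex mat \<Rightarrow> complex mat" where
  "pinch n V b X = V * mat n n (\<lambda>(i,j). if b i = b j then (adj V * X * V) $$ (i,j) else 0) * adj V"

context
  fixes n :: nat and V :: "complex mat" and b :: "nat \<Rightarrow> real" and \<sigma> X :: "complex mat"
  assumes \<sigma>: "spectral_dec n V b \<sigma>" and X: "X \<in> carrier_mat n n"
begin

private lemma V: "unitary_mat n V" "V \<in> carrier_mat n n" "adj V \<in> carrier_mat n n"
  using specD(1)[OF \<sigma>] unitary_matD by auto

private abbreviation "t \<equiv> adj V * X * V"
private abbreviation "t' \<equiv> mat n n (\<lambda>(i,j). if b i = b j then (adj V * X * V) $$ (i,j) else 0)"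

private lemma t: "t \<in> carrier_mat n n" using V X by (simp add: sq_mult_carrier)

lemma pinch_carrier: "pinch n V b X \<in> carrier_mat n n"
  unfolding pinch_def using V by (simp add: sq_mult_carrier)

private lemma pinch_conj: "adj V * pinch n V b X * V = t'"
  unfolding pinch_def using V unitary_matD(3)[OF V(1)]
  by (simp add: sq_assoc[of _ n] sq_mult_carrier unitary_cancel[OF V(1), of _ n])

text \<open>Whatever commutes with \<sigma> is block diagonal in its eigenbasis, one block per
  eigenvalue.\<close>

private lemma blocks:
  assumes "Z \<in> carrier_mat n n" "\<sigma> * Z = Z * \<sigma>" "i < n" "j < n" "(adj V * Z * V) $$ (i,j) \<noteq> 0"
  shows "b i = b j"
proof -
  have "Z * diagc n V (\<lambda>i. complex_of_real (b i)) = diagc n V (\<lambda>i. complex_of_real (b i)) * Z"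
    using assms(2) specD(2)[OF \<sigma>] by simp
  from intertwine_iff[OF V(1) V(1) assms(1), THEN iffD1, OF this, rule_format, OF assms(3,4)]
  show ?thesis using assms(5) by (simp add: mult.commute)
qed

lemma pinch_commute_sigma: "pinch n V b X * \<sigma> = \<sigma> * pinch n V b X"
proof -
  have "pinch n V b X * diagc n V (\<lambda>i. complex_of_real (b i)) = diagc n V (\<lambda>i. complex_of_real (b i)) * pinch n V b X"
    unfolding intertwine_iff[OF V(1) V(1) pinch_carrier] pinch_conj by auto
  then show ?thesis using specD(2)[OF \<sigma>] by simp
qed

text \<open>Multiplication by a block diagonal matrix preserves blocks, hence commutes with deleting
  off-diagonal blocks. Applied to group elements, this keeps the pinched state invariant.\<close>

lemma pinch_commute:
  assumes Z: "Z \<in> carrier_mat n n" "\<sigma> * Z = Z * \<sigma>" "X * Z = Z * X"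
  shows "pinch n V b X * Z = Z * pinch n V b X"
proof -
  define z where "z = adj V * Z * V"
  have z: "z \<in> carrier_mat n n" using V Z by (simp add: z_def sq_mult_carrier)
  note s = sq_assoc[of _ n] sq_mult_carrier unitary_cancel[OF V(1), of _ n]
  have tz: "t * z = z * t"
  proof -
    have "t * z = adj V * (X * Z) * V" using V X Z(1) by (simp add: z_def s)
    also have "\<dots> = z * t" unfolding Z(3) using V X Z(1) by (simp add: z_def s)
    finally show ?thesis .
  qed
  have "t' * z = z * t'"
  proof (rule eq_matI)
    fix i j assume "i < dim_row (z * t')" "j < dim_col (z * t')"
    then have ij: "i < n" "j < n" using z by auto
    have blk: "z $$ (k,l) \<noteq> 0 \<Longrightarrow> b k = b l" if "k < n" "l < n" for k l
      using blocks[OF Z(1,2) that] unfolding z_def .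
    have "(t' * z) $$ (i,j) = (\<Sum>k<n. t' $$ (i,k) * z $$ (k,j))"
      using z ij by (intro mult_index_sum) auto
    \<comment> \<open>Where z (k,j) is nonzero, b k = b j, so the condition b i = b k in the pinched
      matrix may be replaced by b i = b j, which does not depend on k.\<close>
    also have "\<dots> = (\<Sum>k<n. (if b i = b j then 1 else 0) * (t $$ (i,k) * z $$ (k,j)))"
    proof (intro sum.cong refl)
      fix k assume "k \<in> {..<n}"
      then have k: "k < n" by simp
      show "t' $$ (i,k) * z $$ (k,j) = (if b i = b j then 1 else 0) * (t $$ (i,k) * z $$ (k,j))"
        using blk[OF k ij(2)] k ij by (cases "z $$ (k,j) = 0") auto
    qed
    also have "\<dots> = (if b i = b j then 1 else 0) * (t * z) $$ (i,j)"
      using mult_index_sum[OF t z ij] by (simp add: sum_distrib_left)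
    also have "\<dots> = (if b i = b j then 1 else 0) * (z * t) $$ (i,j)" by (simp add: tz)
    also have "\<dots> = (\<Sum>k<n. (if b i = b j then 1 else 0) * (z $$ (i,k) * t $$ (k,j)))"
      using mult_index_sum[OF z t ij] by (simp add: sum_distrib_left)
    also have "\<dots> = (\<Sum>k<n. z $$ (i,k) * t' $$ (k,j))"
    proof (intro sum.cong refl)
      fix k assume "k \<in> {..<n}"
      then have k: "k < n" by simp
      show "(if b i = b j then 1 else 0) * (z $$ (i,k) * t $$ (k,j)) = z $$ (i,k) * t' $$ (k,j)"
        using blk[OF ij(1) k] k ij by (cases "z $$ (i,k) = 0") auto
    qed
    also have "\<dots> = (z * t') $$ (i,j)" using z ij by (intro mult_index_sum[symmetric]) auto
    finally show "(t' * z) $$ (i,j) = (z * t') $$ (i,j)" .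
  qed (use z in auto)
  moreover have "pinch n V b X * Z = V * (t' * z) * adj V"
  proof -
    have "Z = V * z * adj V" using V Z(1) unitary_matD(4)[OF V(1)] by (simp add: z_def s)
    then show ?thesis unfolding pinch_def using V z by (simp add: s)
  qed
  moreover have "Z * pinch n V b X = V * (z * t') * adj V"
  proof -
    have "Z = V * z * adj V" using V Z(1) unitary_matD(4)[OF V(1)] by (simp add: z_def s)
    then show ?thesis unfolding pinch_def using V z by (simp add: s)
  qed
  ultimately show ?thesis by simp
qed

text \<open>The deleted entries of X would only be paired with entries of Z outside the blocks,
  which are zero.\<close>

lemma mtrace_pinch:
  assumes Z: "Z \<in> carrier_mat n n" "\<sigma> * Z = Z * \<sigma>"
  shows "mtrace (pinch n V b X * Z) = mtrace (X * Z)"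
proof -
  define z where "z = adj V * Z * V"
  have z: "z \<in> carrier_mat n n" using V Z by (simp add: z_def sq_mult_carrier)
  note s = sq_assoc[of _ n] sq_mult_carrier unitary_cancel[OF V(1), of _ n]
  have tr: "mtrace (A * Z) = (\<Sum>i<n. \<Sum>j<n. (adj V * A * V) $$ (i,j) * z $$ (j,i))" if A: "A \<in> carrier_mat n n" for A
  proof -
    have "mtrace (A * Z) = mtrace (V * (adj V * A * Z))" using V A Z(1) by (simp add: s)
    also have "\<dots> = mtrace ((adj V * A * Z) * V)"
      using V A Z(1) by (intro mtrace_comm[of _ n n]) (auto simp: sq_mult_carrier)
    also have "(adj V * A * Z) * V = (adj V * A * V) * z"
      using V A Z(1) by (simp add: z_def s)
    also have "mtrace \<dots> = (\<Sum>i<n. \<Sum>j<n. (adj V * A * V) $$ (i,j) * z $$ (j,i))"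
      using V A z by (simp add: mtrace_def mult_index_sum[of _ n n _ n] sq_mult_carrier)
    finally show ?thesis .
  qed
  have "mtrace (pinch n V b X * Z) = (\<Sum>i<n. \<Sum>j<n. t' $$ (i,j) * z $$ (j,i))"
    unfolding tr[OF pinch_carrier] pinch_conj ..
  also have "\<dots> = (\<Sum>i<n. \<Sum>j<n. t $$ (i,j) * z $$ (j,i))"
  proof (intro sum.cong refl)
    fix i j assume "i \<in> {..<n}" "j \<in> {..<n}"
    then have ij: "i < n" "j < n" by auto
    show "t' $$ (i,j) * z $$ (j,i) = t $$ (i,j) * z $$ (j,i)"
      using blocks[OF Z ij(2,1)] ij unfolding z_def[symmetric] by (cases "z $$ (j,i) = 0") auto
  qed
  also have "\<dots> = mtrace (X * Z)" unfolding tr[OF X] ..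
  finally show ?thesis .
qed

lemma adj_pinch:
  assumes "adj X = X"
  shows "adj (pinch n V b X) = pinch n V b X"
proof -
  have "adj t = t" using V X assms by (simp add: adj_mult[of _ n n _ n] sq_assoc[of _ n] sq_mult_carrier)
  have "adj t' = t'"
  proof (rule eq_matI)
    fix i j assume "i < dim_row t'" "j < dim_col t'"
    then have ij: "i < n" "j < n" by auto
    have "cnj (t $$ (j,i)) = adj t $$ (i,j)" using t ij by (intro adj_index[symmetric]) auto
    also have "\<dots> = t $$ (i,j)" using \<open>adj t = t\<close> by simp
    finally show "adj t' $$ (i,j) = t' $$ (i,j)" using ij by auto
  qed auto
  then show ?thesis unfolding pinch_def
    using V by (simp add: adj_mult[of _ n n _ n] sq_assoc[of _ n] sq_mult_carrier)
qed

text \<open>The pinching inequality. A vector splits into one component per eigenvalue of \<sigma>,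
  and Cauchy-Schwarz bounds the square of a sum of m terms by m times the sum of squares. The forms
  of the components add up to the form of the pinched matrix.\<close>

lemma quad_form_le_pinch:
  assumes W: "spectral_dec n W c X" "\<And>i. i < n \<Longrightarrow> 0 \<le> c i"
  shows "quad_form n X v \<le> real (card (b ` {..<n})) * quad_form n (pinch n V b X) v"
proof -
  define S where "S = b ` {..<n}"
  define y where "y = mv n (adj V) v"
  define ys where "ys s i = (if b i = s then y i else 0)" for s i
  define Q where "Q = adj V * W"
  note Wc = unitary_matD[OF specD(1)[OF W(1)]]
  have Q: "Q \<in> carrier_mat n n" using V Wc by (simp add: Q_def sq_mult_carrier)
  have fS: "finite S" by (simp add: S_def)
  have tQ: "t = diagc n Q (\<lambda>i. complex_of_real (c i))"
    unfolding specD(2)[OF W(1)] diagc_def Q_def using V Wc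
    by (simp add: adj_mult[of _ n n _ n] sq_assoc[of _ n] sq_mult_carrier)
  have XV: "X = V * t * adj V"
    using V X unitary_matD(4)[OF V(1)] by (simp add: sq_assoc[of _ n] sq_mult_carrier unitary_cancel[OF V(1), of _ n])
  have q: "quad_form n t w = (\<Sum>k<n. c k * (cmod (\<Sum>i<n. cnj (Q $$ (i,k)) * w i))\<^sup>2)" for w
    unfolding tQ by (rule quad_form_diagc[OF Q])
  have split: "(\<Sum>i<n. cnj (Q $$ (i,k)) * y i) = (\<Sum>s\<in>S. \<Sum>i<n. cnj (Q $$ (i,k)) * ys s i)" for k
  proof -
    have "y i = (\<Sum>s\<in>S. ys s i)" if "i < n" for i
      unfolding ys_def using fS that by (simp add: S_def)
    then show ?thesis by (subst sum.swap) (simp add: sum_distrib_left)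
  qed
  have "quad_form n X v = quad_form n t y" unfolding y_def by (subst XV) (rule quad_form_change_basis[OF V(2) t])
  also have "\<dots> \<le> (\<Sum>k<n. c k * (real (card S) * (\<Sum>s\<in>S. (cmod (\<Sum>i<n. cnj (Q $$ (i,k)) * ys s i))\<^sup>2)))"
    unfolding q split
  proof (intro sum_mono mult_left_mono)
    fix k
    have "(cmod (\<Sum>s\<in>S. \<Sum>i<n. cnj (Q $$ (i,k)) * ys s i))\<^sup>2 \<le> (\<Sum>s\<in>S. 1 * cmod (\<Sum>i<n. cnj (Q $$ (i,k)) * ys s i))\<^sup>2"
      by (intro power_mono order_trans[OF norm_sum]) auto
    also have "\<dots> \<le> (\<Sum>s\<in>S. 1\<^sup>2) * (\<Sum>s\<in>S. (cmod (\<Sum>i<n. cnj (Q $$ (i,k)) * ys s i))\<^sup>2)"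
      by (rule Cauchy_Schwarz_ineq_sum)
    finally show "(cmod (\<Sum>s\<in>S. \<Sum>i<n. cnj (Q $$ (i,k)) * ys s i))\<^sup>2
      \<le> real (card S) * (\<Sum>s\<in>S. (cmod (\<Sum>i<n. cnj (Q $$ (i,k)) * ys s i))\<^sup>2)" by simp
  qed (use W(2) in auto)
  also have "\<dots> = real (card S) * (\<Sum>k<n. \<Sum>s\<in>S. c k * (cmod (\<Sum>i<n. cnj (Q $$ (i,k)) * ys s i))\<^sup>2)"
    by (simp add: sum_distrib_left mult.left_commute)
  also have "(\<Sum>k<n. \<Sum>s\<in>S. c k * (cmod (\<Sum>i<n. cnj (Q $$ (i,k)) * ys s i))\<^sup>2) = (\<Sum>s\<in>S. quad_form n t (ys s))"
    unfolding q by (rule sum.swap)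
  also have "(\<Sum>s\<in>S. quad_form n t (ys s)) = quad_form n t' y"
  proof -
    have "(\<Sum>s\<in>S. \<Sum>i<n. \<Sum>j<n. cnj (ys s i) * t $$ (i,j) * ys s j)
      = (\<Sum>i<n. \<Sum>s\<in>S. \<Sum>j<n. cnj (ys s i) * t $$ (i,j) * ys s j)" by (rule sum.swap)
    also have "\<dots> = (\<Sum>i<n. \<Sum>j<n. \<Sum>s\<in>S. cnj (ys s i) * t $$ (i,j) * ys s j)"
      by (intro sum.cong refl sum.swap)
    also have "\<dots> = (\<Sum>i<n. \<Sum>j<n. cnj (y i) * t' $$ (i,j) * y j)"
    proof (intro sum.cong refl)
      fix i j assume "i \<in> {..<n}" "j \<in> {..<n}"
      then have ij: "i < n" "j < n" by auto
      have "(\<Sum>s\<in>S. cnj (ys s i) * t $$ (i,j) * ys s j) = (\<Sum>s\<in>S. if b i = s then (if b i = b j then cnj (y i) * t $$ (i,j) * y j else 0) else 0)"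
        by (intro sum.cong refl) (auto simp: ys_def)
      also have "\<dots> = (if b i = b j then cnj (y i) * t $$ (i,j) * y j else 0)" using fS ij by (simp add: S_def)
      finally show "(\<Sum>s\<in>S. cnj (ys s i) * t $$ (i,j) * ys s j) = cnj (y i) * t' $$ (i,j) * y j" using ij by auto
    qed
    finally show ?thesis unfolding quad_form_def Re_sum[symmetric] by simp
  qed
  also have "quad_form n t' y = quad_form n (pinch n V b X) v"
    unfolding y_def pinch_def by (rule quad_form_change_basis[OF V(2), symmetric]) simp
  finally show ?thesis by (simp add: S_def)
qed

end

text \<open>A + iB is normal because A and B commute; the real and imaginary parts of its
  eigenvalues are the eigenvalues of A and of B in a common basis.\<close>

lemma joint_spec:
  assumes A: "A \<in> carrier_mat n n" "adj A = A" and B: "B \<in> carrier_mat n n" "adj B = B" and AB: "A * B = B * A"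
  obtains U a b where "spectral_dec n U a A" "spectral_dec n U b B"
proof -
  define Z where "Z = A + \<i> \<cdot>\<^sub>m B"
  have iB: "\<i> \<cdot>\<^sub>m B \<in> carrier_mat n n" "(- \<i>) \<cdot>\<^sub>m B \<in> carrier_mat n n" using B by auto
  have Z: "Z \<in> carrier_mat n n" using A B by (simp add: Z_def)
  have aZ: "adj Z = A + (- \<i>) \<cdot>\<^sub>m B"
    unfolding Z_def adj_add[OF A(1) iB(1)] adj_smult using A B by simp
  have "adj Z * Z = A * A + B * B"
  proof -
    have "adj Z * Z = (A * A + (- \<i>) \<cdot>\<^sub>m B * A) + (A * (\<i> \<cdot>\<^sub>m B) + (- \<i>) \<cdot>\<^sub>m B * (\<i> \<cdot>\<^sub>m B))"
      unfolding aZ unfolding Z_def using A(1) iB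
      by (simp add: add_mult_distrib_mat[of _ n n _ _ n] mult_add_distrib_mat[of _ n n _ n] sq_mult_carrier del: smult_carrier_mat)
    also have "\<dots> = A * A + B * B"
      using A(1) B(1) AB by (intro eq_matI) (auto simp: mult_smult_distrib[of _ n n _ n] mult_smult_assoc_mat[of _ n n _ n])
    finally show ?thesis .
  qed
  moreover have "Z * adj Z = A * A + B * B"
  proof -
    have "Z * adj Z = (A * A + \<i> \<cdot>\<^sub>m B * A) + (A * ((- \<i>) \<cdot>\<^sub>m B) + \<i> \<cdot>\<^sub>m B * ((- \<i>) \<cdot>\<^sub>m B))"
      unfolding aZ unfolding Z_def using A(1) iB
      by (simp add: add_mult_distrib_mat[of _ n n _ _ n] mult_add_distrib_mat[of _ n n _ n] sq_mult_carrier del: smult_carrier_mat)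
    also have "\<dots> = A * A + B * B"
      using A(1) B(1) AB by (intro eq_matI) (auto simp: mult_smult_distrib[of _ n n _ n] mult_smult_assoc_mat[of _ n n _ n])
    finally show ?thesis .
  qed
  ultimately have "adj Z * Z = Z * adj Z" by simp
  then obtain U f where U: "unitary_mat n U" and ZU: "Z = diagc n U f"
    using spectral_normal[OF Z] unfolding diagc_def by metis
  note Uc = unitary_matD(1)[OF U]
  have aZU: "adj Z = diagc n U (\<lambda>i. cnj (f i))" unfolding ZU by (rule adj_diagc[OF Uc])
  have "A = (1/2) \<cdot>\<^sub>m (Z + adj Z)"
    unfolding aZ unfolding Z_def using A(1) B(1) by (intro eq_matI) auto
  also have "\<dots> = diagc n U (\<lambda>i. complex_of_real (Re (f i)))"
    unfolding aZU unfolding ZU diagc_add[OF Uc] diagc_smult[OF Uc] by (intro diagc_cong) (simp add: complex_add_cnj)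
  finally have 1: "spectral_dec n U (\<lambda>i. Re (f i)) A" using U by (simp add: spectral_dec_def)
  have "B = (- \<i> / 2) \<cdot>\<^sub>m (Z - adj Z)"
    unfolding aZ unfolding Z_def using A(1) B(1) by (intro eq_matI) (auto simp: algebra_simps)
  also have "\<dots> = diagc n U (\<lambda>i. complex_of_real (Im (f i)))"
    unfolding aZU unfolding ZU diagc_minus[OF Uc] diagc_smult[OF Uc] by (intro diagc_cong) (simp add: complex_eq_iff)
  finally have "spectral_dec n U (\<lambda>i. Im (f i)) B" using U by (simp add: spectral_dec_def)
  with 1 that show ?thesis by blast
qed

section \<open>A measurement commuting with the group\<close>

text \<open>The matrices diagonal in W whose entries depend on the index only through
  \<open>key\<close>. With joint eigenvalues as keys this is the algebra of functions of the
  commuting pair; the full diagonal algebra would depend on the basis chosen inside joint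
  eigenspaces and need not commute with the group.\<close>

definition keyalg :: "nat \<Rightarrow> complex mat \<Rightarrow> (nat \<Rightarrow> 'k) \<Rightarrow> complex mat set" where
  "keyalg n W key = {diagc n W (\<lambda>i. f (key i)) | f. True}"

definition keyproj :: "nat \<Rightarrow> complex mat \<Rightarrow> (nat \<Rightarrow> 'k) \<Rightarrow> 'k \<Rightarrow> complex mat" where
  "keyproj n W key k = diagc n W (\<lambda>i. if key i = k then 1 else 0)"

lemma keyalgI: "diagc n W (\<lambda>i. f (key i)) \<in> keyalg n W key"
  unfolding keyalg_def by blast

context
  fixes n :: nat and W :: "complex mat" and key :: "nat \<Rightarrow> 'k"
  assumes W: "unitary_mat n W"
begin

private lemma Wc: "W \<in> carrier_mat n n" using unitary_matD(1)[OF W] .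

lemma abelian_keyalg: "abelian_subalg n (keyalg n W key)"
  unfolding abelian_subalg_def
proof (intro conjI ballI allI)
  show "keyalg n W key \<subseteq> carrier_mat n n" using Wc by (auto simp: keyalg_def)
  show "1\<^sub>m n \<in> keyalg n W key" using keyalgI[of n W "\<lambda>_. 1" key] by (simp add: diagc_one[OF W])
  fix X assume "X \<in> keyalg n W key"
  then obtain f where f: "X = diagc n W (\<lambda>i. f (key i))" by (auto simp: keyalg_def)
  show "c \<cdot>\<^sub>m X \<in> keyalg n W key" for c
    unfolding f diagc_smult[OF Wc] by (rule keyalgI[of n W "\<lambda>k. c * f k"])
  show "adj X \<in> keyalg n W key"
    unfolding f adj_diagc[OF Wc] by (rule keyalgI[of n W "\<lambda>k. cnj (f k)"])
  fix Y assume "Y \<in> keyalg n W key"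
  then obtain g where g: "Y = diagc n W (\<lambda>i. g (key i))" by (auto simp: keyalg_def)
  show "X + Y \<in> keyalg n W key"
    unfolding f g diagc_add[OF Wc] by (rule keyalgI[of n W "\<lambda>k. f k + g k"])
  show "X * Y \<in> keyalg n W key"
    unfolding f g diagc_mult[OF W] by (rule keyalgI[of n W "\<lambda>k. f k * g k"])
  show "X * Y = Y * X" unfolding f g diagc_mult[OF W] by (simp add: mult.commute)
qed

lemma keyproj_in: "keyproj n W key k \<in> keyalg n W key"
  unfolding keyproj_def by (rule keyalgI[of n W "\<lambda>l. if l = k then 1 else 0"])

lemma keyproj_proj: "is_proj n (keyproj n W key k)"
  unfolding is_proj_def keyproj_def diagc_mult[OF W] adj_diagc[OF Wc]
  using Wc by (auto intro!: diagc_cong)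

lemma keyproj_inj: "inj_on (keyproj n W key) (key ` {..<n})"
proof (rule inj_onI)
  fix k l assume k: "k \<in> key ` {..<n}" and eq: "keyproj n W key k = keyproj n W key l"
  then obtain i where i: "i < n" "key i = k" by auto
  have "(if key i = k then 1 else 0 :: complex) = (if key i = l then 1 else 0)"
    using diagc_inj[OF W eq[unfolded keyproj_def] i(1)] .
  then show "k = l" using i by (simp split: if_splits)
qed

text \<open>Projections in this algebra are indicators of sets of keys, so the minimal ones belong
  to single keys attained by some index.\<close>

lemma min_projs_keyalg: "min_projs n (keyalg n W key) = keyproj n W key ` (key ` {..<n})"
proof (intro equalityI subsetI)
  fix P assume P: "P \<in> min_projs n (keyalg n W key)"
  note m = min_projsD[OF P]
  obtain f where f: "P = diagc n W (\<lambda>i. f (key i))" using m(1) by (auto simp: keyalg_def)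
  have "\<exists>i<n. f (key i) \<noteq> 0"
  proof (rule ccontr)
    assume "\<not> (\<exists>i<n. f (key i) \<noteq> 0)"
    then have "P = diagc n W (\<lambda>_. 0)" unfolding f by (intro diagc_cong) auto
    then show False using m(3) diagc_zero[OF Wc] by simp
  qed
  then obtain i where i: "i < n" "f (key i) \<noteq> 0" by blast
  have "diagc n W (\<lambda>i. f (key i) * f (key i)) = diagc n W (\<lambda>i. f (key i))"
    using is_projD(2)[OF m(2)] unfolding f diagc_mult[OF W] .
  from diagc_inj[OF W this i(1)] have "f (key i) = 1" using i(2) by simp
  then have "keyproj n W key (key i) * P = keyproj n W key (key i)"
    unfolding keyproj_def f diagc_mult[OF W] by (intro diagc_cong) auto
  from m(4)[OF keyproj_in keyproj_proj this]
  have "keyproj n W key (key i) = 0\<^sub>m n n \<or> keyproj n W key (key i) = P" .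
  moreover have "keyproj n W key (key i) \<noteq> 0\<^sub>m n n"
  proof
    assume "keyproj n W key (key i) = 0\<^sub>m n n"
    then have "diagc n W (\<lambda>j. if key j = key i then 1 else 0) = diagc n W (\<lambda>_. 0)"
      unfolding keyproj_def diagc_zero[OF Wc] .
    from diagc_inj[OF W this i(1)] show False by simp
  qed
  ultimately show "P \<in> keyproj n W key ` (key ` {..<n})" using i(1) by blast
next
  fix P assume "P \<in> keyproj n W key ` (key ` {..<n})"
  then obtain i where i: "i < n" "P = keyproj n W key (key i)" by auto
  have "P \<noteq> 0\<^sub>m n n"
  proof
    assume "P = 0\<^sub>m n n"
    then have "diagc n W (\<lambda>j. if key j = key i then 1 else 0) = diagc n W (\<lambda>_. 0)"
      unfolding i(2) keyproj_def diagc_zero[OF Wc] .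
    from diagc_inj[OF W this i(1)] show False by simp
  qed
  moreover have "Q = 0\<^sub>m n n \<or> Q = P" if Q: "Q \<in> keyalg n W key" "is_proj n Q" "Q * P = Q" for Q
  proof -
    obtain f where f: "Q = diagc n W (\<lambda>i. f (key i))" using Q(1) by (auto simp: keyalg_def)
    have e: "diagc n W (\<lambda>j. f (key j) * (if key j = key i then 1 else 0)) = diagc n W (\<lambda>j. f (key j))"
      using Q(3) unfolding f i(2) keyproj_def diagc_mult[OF W] .
    have s: "f (key j) = 0" if "j < n" "key j \<noteq> key i" for j
      using diagc_inj[OF W e that(1)] that(2) by simp
    have "diagc n W (\<lambda>i. f (key i) * f (key i)) = diagc n W (\<lambda>i. f (key i))"
      using is_projD(2)[OF Q(2)] unfolding f diagc_mult[OF W] .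
    from diagc_inj[OF W this i(1)] have "f (key i) = 0 \<or> f (key i) = 1" by simp
    then show ?thesis
    proof
      assume "f (key i) = 0"
      then have "Q = diagc n W (\<lambda>_. 0)" unfolding f using s by (intro diagc_cong) metis
      then show ?thesis using diagc_zero[OF Wc] by simp
    next
      assume "f (key i) = 1"
      then have "Q = P" unfolding f i(2) keyproj_def using s by (intro diagc_cong) auto
      then show ?thesis by simp
    qed
  qed
  ultimately show "P \<in> min_projs n (keyalg n W key)"
    unfolding min_projs_def using i(2) keyproj_in keyproj_proj by blast
qed

end

text \<open>On a fibre the masses are m r and m s with m its size; m cancels inside the logarithm,
  so merging indices with equal masses does not change the relative entropy.\<close>

lemma crel_fibers:
  fixes s r :: "nat \<Rightarrow> real"
  assumes p: "\<And>k. k \<in> key ` {..<n} \<Longrightarrow> p k = (\<Sum>i\<in>{i\<in>{..<n}. key i = k}. r i)"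
    and q: "\<And>k. k \<in> key ` {..<n} \<Longrightarrow> q k = (\<Sum>i\<in>{i\<in>{..<n}. key i = k}. s i)"
    and const: "\<And>i j. i < n \<Longrightarrow> j < n \<Longrightarrow> key i = key j \<Longrightarrow> r i = r j \<and> s i = s j"
  shows "crel (key ` {..<n}) p q = (if \<forall>i<n. r i \<noteq> 0 \<longrightarrow> s i \<noteq> 0
    then ereal (\<Sum>i<n. if r i = 0 then 0 else r i * ln (r i / s i)) else \<infinity>)"
proof -
  define m where "m k = real (card {i\<in>{..<n}. key i = k})" for k
  have pk: "p (key j) = m (key j) * r j" "q (key j) = m (key j) * s j" and mpos: "m (key j) > 0" if j: "j < n" for j
  proof -
    have k: "key j \<in> key ` {..<n}" using j by simp
    have "p (key j) = (\<Sum>i\<in>{i\<in>{..<n}. key i = key j}. r j)"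
      unfolding p[OF k] by (rule sum.cong[OF refl]) (use const[OF _ j] in blast)
    then show "p (key j) = m (key j) * r j" by (simp add: m_def)
    have "q (key j) = (\<Sum>i\<in>{i\<in>{..<n}. key i = key j}. s j)"
      unfolding q[OF k] by (rule sum.cong[OF refl]) (use const[OF _ j] in blast)
    then show "q (key j) = m (key j) * s j" by (simp add: m_def)
    show "m (key j) > 0" unfolding m_def using j by (auto simp: card_gt_0_iff)
  qed
  have cond: "(\<forall>k\<in>key ` {..<n}. p k \<noteq> 0 \<longrightarrow> q k \<noteq> 0) \<longleftrightarrow> (\<forall>i<n. r i \<noteq> 0 \<longrightarrow> s i \<noteq> 0)"
    using pk mpos by force
  define T where "T i = (if r i = 0 then 0 else r i * ln (r i / s i))" for i
  have "(\<Sum>i<n. T i) = (\<Sum>k\<in>key ` {..<n}. \<Sum>i\<in>{i\<in>{..<n}. key i = k}. T i)"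
    by (intro sum.group[symmetric]) auto
  also have "\<dots> = (\<Sum>k\<in>key ` {..<n}. if p k = 0 then 0 else p k * ln (p k / q k))"
  proof (intro sum.cong refl)
    fix k assume "k \<in> key ` {..<n}"
    then obtain j where j: "j < n" "k = key j" by auto
    have "(\<Sum>i\<in>{i\<in>{..<n}. key i = k}. T i) = (\<Sum>i\<in>{i\<in>{..<n}. key i = k}. T j)"
    proof (rule sum.cong[OF refl])
      fix i assume "i \<in> {i\<in>{..<n}. key i = k}"
      then have "r i = r j" "s i = s j" using const[OF _ j(1)] j(2) by blast+
      then show "T i = T j" by (simp add: T_def)
    qed
    also have "\<dots> = m k * T j" by (simp add: m_def)
    also have "\<dots> = (if p k = 0 then 0 else p k * ln (p k / q k))"
      using pk[OF j(1)] mpos[OF j(1)] unfolding j(2) by (auto simp: T_def)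
    finally show "(\<Sum>i\<in>{i\<in>{..<n}. key i = k}. T i) = (if p k = 0 then 0 else p k * ln (p k / q k))" .
  qed
  finally show ?thesis unfolding crel_def cond T_def by (simp only:)
qed

text \<open>Here the pinching is applied after the averaging. The logarithm is the loss
  S(\<rho>\<parallel>\<omega>), bounded by the product of the two domination constants.\<close>

lemma measured_lower_bound:
  fixes R :: "'g::{topological_group_add, t2_space} \<Rightarrow> complex mat"
  assumes cpt: "compact (UNIV :: 'g set)" and haar: "haar_prob \<mu>" and rep: "cont_unitary_rep N R"
    and \<rho>: "density N \<rho>" and \<sigma>: "\<And>g. \<sigma> * R g = R g * \<sigma>" "spectral_dec N V b \<sigma>" "\<And>i. i < N \<Longrightarrow> 0 \<le> b i"
  obtains B where "abelian_subalg N B" "\<And>X g. X \<in> B \<Longrightarrow> X * R g = R g * X"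
    "qrel \<rho> \<sigma> \<le> qrel_restr N B (avg N R \<mu> \<rho>) \<sigma>
       + ereal (ln (real (card (entry_funs N R)) * real (card (b ` {..<N}))))"
proof -
  obtain U a where a: "spectral_dec N U a \<rho>" "\<And>i. i < N \<Longrightarrow> 0 \<le> a i" "(\<Sum>i<N. a i) = 1"
    using density_spec[OF \<rho>] by metis
  have N: "N > 0" using a(3) by (cases N) auto
  note uU = specD(1)[OF a(1)]
  define \<tau> where "\<tau> = avg N R \<mu> \<rho>"
  have d\<tau>: "density N \<tau>" unfolding \<tau>_def by (rule density_avg[OF cpt haar rep \<rho>])
  obtain W0 c where c: "spectral_dec N W0 c \<tau>" "\<And>i. i < N \<Longrightarrow> 0 \<le> c i" using density_spec[OF d\<tau>] by metis
  note \<tau> = specD(3,4)[OF c(1)] and Rc = cont_unitary_repD(2)[OF rep]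
  have \<tau>R: "\<tau> * R g = R g * \<tau>" for g
    unfolding \<tau>_def by (rule avg_commute[OF cpt haar rep specD(3)[OF a(1)]])
  define \<omega> where "\<omega> = pinch N V b \<tau>"
  have \<omega>: "\<omega> \<in> carrier_mat N N" "adj \<omega> = \<omega>" "\<omega> * \<sigma> = \<sigma> * \<omega>"
    unfolding \<omega>_def using pinch_carrier[OF \<sigma>(2) \<tau>(1)] adj_pinch[OF \<sigma>(2) \<tau>] pinch_commute_sigma[OF \<sigma>(2) \<tau>(1)] by auto
  \<comment> \<open>Both the average and \<sigma> commute with R g, as \<open>pinch_commute\<close>
    requires; this is where invariance of \<sigma> keeps the pinching inside the commutant.\<close>
  have \<omega>R: "\<omega> * R g = R g * \<omega>" for g
    unfolding \<omega>_def by (rule pinch_commute[OF \<sigma>(2) \<tau>(1) Rc \<sigma>(1) \<tau>R])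
  define C where "C = real (card (entry_funs N R)) * real (card (b ` {..<N}))"
  have "entry_funs N R \<noteq> {}" using N by (auto simp: entry_funs_def)
  then have C: "C > 0" unfolding C_def using N finite_entry_funs[of N R] by (auto simp: card_gt_0_iff intro!: mult_pos_pos)
  have dom: "quad_form N \<rho> v \<le> C * quad_form N \<omega> v" for v
  proof -
    have "quad_form N \<rho> v \<le> real (card (entry_funs N R)) * quad_form N \<tau> v"
      unfolding \<tau>_def by (rule quad_form_le_avg[OF cpt haar rep \<rho>])
    also have "\<dots> \<le> real (card (entry_funs N R)) * (real (card (b ` {..<N})) * quad_form N \<omega> v)"
      unfolding \<omega>_def by (intro mult_left_mono quad_form_le_pinch[OF \<sigma>(2) \<tau>(1) c]) auto
    finally show ?thesis by (simp add: C_def mult.assoc)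
  qed
  obtain W s r where s: "spectral_dec N W s \<sigma>" and r: "spectral_dec N W r \<omega>"
    using joint_spec[OF specD(3,4)[OF \<sigma>(2)] \<omega>(1,2) \<omega>(3)[symmetric]] by metis
  note uW = specD(1)[OF s]
  note Wc = unitary_matD(1)[OF uW]
  have eig: "quad_form N (diagc N W (\<lambda>i. complex_of_real (f i))) (\<lambda>x. W $$ (x,i)) = f i" if i: "i < N" for f i
  proof -
    have "(\<Sum>x<N. cnj (W $$ (x,k)) * W $$ (x,i)) = (if k = i then 1 else 0)" if "k < N" for k
    proof -
      have "(\<Sum>x<N. cnj (W $$ (x,k)) * W $$ (x,i)) = (adj W * W) $$ (k,i)"
        using Wc i that by (simp add: mult_index_sum[of _ N N _ N])
      then show ?thesis using unitary_matD(3)[OF uW] i that by simp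
    qed
    then have "quad_form N (diagc N W (\<lambda>i. complex_of_real (f i))) (\<lambda>x. W $$ (x,i)) = (\<Sum>k<N. f k * (cmod (if k = i then 1 else 0))\<^sup>2)"
      unfolding quad_form_diagc[OF Wc] by simp
    also have "\<dots> = (\<Sum>k<N. if k = i then f k else 0)" by (intro sum.cong refl) auto
    finally show ?thesis using i by simp
  qed
  \<comment> \<open>Positivity of the pinched state is read off from its domination of the positive
    \<rho>, tested on the eigenvector belonging to r i.\<close>
  have r0: "0 \<le> r i" if "i < N" for i
  proof -
    have "0 \<le> quad_form N \<rho> (\<lambda>x. W $$ (x,i))" using \<rho> unfolding density_quad_form by blast
    also have "\<dots> \<le> C * quad_form N \<omega> (\<lambda>x. W $$ (x,i))" by (rule dom)
    also have "\<dots> = C * r i" unfolding specD(2)[OF r] eig[OF that] ..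
    finally show ?thesis using C by (simp add: zero_le_mult_iff)
  qed
  have s0: "0 \<le> s i" if "i < N" for i
  proof -
    have "0 \<le> quad_form N \<sigma> (\<lambda>x. W $$ (x,i))"
      unfolding specD(2)[OF \<sigma>(2)] quad_form_diagc[OF unitary_matD(1)[OF specD(1)[OF \<sigma>(2)]]] using \<sigma>(3) by (intro sum_nonneg) auto
    also have "\<dots> = s i" unfolding specD(2)[OF s] eig[OF that] ..
    finally show ?thesis .
  qed
  \<comment> \<open>Indices are told apart only by their pair of eigenvalues of \<omega> and
    \<sigma>, so B is spanned by the joint spectral projections.\<close>
  define key where "key i = (r i, s i)" for i
  define B where "B = keyalg N W key"
  \<comment> \<open>B lies in the bicommutant of \<omega> and \<sigma>: an entry of Z between two
    joint eigenvectors vanishes unless their keys agree. It is used with group elements and with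
    \<sigma> as Z.\<close>
  have comm: "X * Z = Z * X" if X: "X \<in> B" and Z: "Z \<in> carrier_mat N N" "\<sigma> * Z = Z * \<sigma>" "\<omega> * Z = Z * \<omega>" for X Z
  proof -
    obtain f where f: "X = diagc N W (\<lambda>i. f (key i))" using X by (auto simp: B_def keyalg_def)
    define y where "y = adj W * Z * W"
    have 1: "\<forall>i<N. \<forall>j<N. y $$ (i,j) * complex_of_real (s j) = complex_of_real (s i) * y $$ (i,j)"
      unfolding y_def intertwine_iff[OF uW uW Z(1), symmetric] using Z(2) specD(2)[OF s] by simp
    have 2: "\<forall>i<N. \<forall>j<N. y $$ (i,j) * complex_of_real (r j) = complex_of_real (r i) * y $$ (i,j)"
      unfolding y_def intertwine_iff[OF uW uW Z(1), symmetric] using Z(3) specD(2)[OF r] by simp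
    have "y $$ (i,j) * f (key j) = f (key i) * y $$ (i,j)" if "i < N" "j < N" for i j
    proof (cases "y $$ (i,j) = 0")
      case False
      then have "s j = s i" "r j = r i"
        using 1[rule_format, OF that] 2[rule_format, OF that] by (simp_all add: mult.commute)
      then show ?thesis by (simp add: key_def mult.commute)
    qed simp
    then have "Z * diagc N W (\<lambda>i. f (key i)) = diagc N W (\<lambda>i. f (key i)) * Z"
      unfolding intertwine_iff[OF uW uW Z(1)] y_def by blast
    then show ?thesis by (simp add: f)
  qed
  have BR: "X * R g = R g * X" if "X \<in> B" for X g using comm[OF that Rc \<sigma>(1) \<omega>R] .
  have B\<sigma>: "\<sigma> * X = X * \<sigma>" if "X \<in> B" for X
    using comm[OF that specD(3)[OF s] refl \<omega>(3)] by simp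
  have BC: "X \<in> carrier_mat N N" if "X \<in> B" for X
    using that Wc by (auto simp: B_def keyalg_def)
  have tr: "mtrace (\<omega> * X) = mtrace (\<tau> * X)" "mtrace (\<tau> * X) = mtrace (\<rho> * X)" if X: "X \<in> B" for X
  proof -
    show "mtrace (\<omega> * X) = mtrace (\<tau> * X)" unfolding \<omega>_def by (rule mtrace_pinch[OF \<sigma>(2) \<tau>(1) BC[OF X] B\<sigma>[OF X]])
    show "mtrace (\<tau> * X) = mtrace (\<rho> * X)" unfolding \<tau>_def
      by (rule mtrace_avg[OF cpt haar rep specD(3)[OF a(1)] BC[OF X] BR[OF X]])
  qed
  \<comment> \<open>Any function of the joint eigenvalues has the same trace against \<omega> and
    \<rho>. Taking ln r - ln s gives the entropy, taking the indicator of s = 0 gives the support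
    condition.\<close>
  have sums: "(\<Sum>i<N. r i * f (r i) (s i)) = (\<Sum>i<N. \<Sum>j<N. overlap U W i j * (a i * f (r j) (s j)))" for f :: "real \<Rightarrow> real \<Rightarrow> real"
  proof -
    define X where "X = diagc N W (\<lambda>i. complex_of_real (f (r i) (s i)))"
    have "X \<in> B" using keyalgI[of N W "\<lambda>k. complex_of_real (f (fst k) (snd k))" key] by (simp add: X_def B_def key_def)
    then have "mtrace (\<omega> * X) = mtrace (\<rho> * X)" using tr by simp
    moreover have "mtrace (\<omega> * X) = complex_of_real (\<Sum>i<N. r i * f (r i) (s i))"
      unfolding X_def specD(2)[OF r] diagc_mult[OF uW] mtrace_diagc[OF uW] by simp
    moreover have "mtrace (\<rho> * X) = complex_of_real (\<Sum>i<N. \<Sum>j<N. overlap U W i j * (a i * f (r j) (s j)))"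
      unfolding X_def by (rule spec_trace_sum[OF a(1) uW])
    ultimately have "complex_of_real (\<Sum>i<N. r i * f (r i) (s i)) = complex_of_real (\<Sum>i<N. \<Sum>j<N. overlap U W i j * (a i * f (r j) (s j)))"
      by (simp only:)
    then show ?thesis by (simp only: of_real_eq_iff)
  qed
  have restr: "qrel_restr N B \<tau> \<sigma> = (if \<forall>i<N. r i \<noteq> 0 \<longrightarrow> s i \<noteq> 0
    then ereal (\<Sum>i<N. if r i = 0 then 0 else r i * ln (r i / s i)) else \<infinity>)"
  proof -
    have fiber: "mtrace (diagc N W (\<lambda>i. complex_of_real (f i)) * keyproj N W key k)
        = complex_of_real (\<Sum>i\<in>{i\<in>{..<N}. key i = k}. f i)" for f k
    proof -
      have "mtrace (diagc N W (\<lambda>i. complex_of_real (f i)) * keyproj N W key k)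
        = (\<Sum>i<N. if key i = k then complex_of_real (f i) else 0)"
        unfolding keyproj_def diagc_mult[OF uW] mtrace_diagc[OF uW] by (intro sum.cong refl) auto
      also have "\<dots> = (\<Sum>i\<in>{i\<in>{..<N}. key i = k}. complex_of_real (f i))" by (rule sum.inter_filter[symmetric]) simp
      finally show ?thesis by simp
    qed
    have p: "Re (mtrace (\<tau> * keyproj N W key k)) = (\<Sum>i\<in>{i\<in>{..<N}. key i = k}. r i)" for k
    proof -
      have "keyproj N W key k \<in> B" unfolding B_def by (rule keyproj_in[OF uW])
      from tr(1)[OF this] show ?thesis using fiber[of r k] specD(2)[OF r] by (metis Re_complex_of_real)
    qed
    have q: "Re (mtrace (\<sigma> * keyproj N W key k)) = (\<Sum>i\<in>{i\<in>{..<N}. key i = k}. s i)" for k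
      using fiber[of s k] specD(2)[OF s] by simp
    have "qrel_restr N B \<tau> \<sigma> = crel (key ` {..<N}) (\<lambda>k. Re (mtrace (\<tau> * keyproj N W key k))) (\<lambda>k. Re (mtrace (\<sigma> * keyproj N W key k)))"
      unfolding qrel_restr_def B_def min_projs_keyalg[OF uW] crel_def
      by (auto simp: sum.reindex[OF keyproj_inj[OF uW]])
    also have "\<dots> = (if \<forall>i<N. r i \<noteq> 0 \<longrightarrow> s i \<noteq> 0
      then ereal (\<Sum>i<N. if r i = 0 then 0 else r i * ln (r i / s i)) else \<infinity>)"
      using p q by (intro crel_fibers) (auto simp: key_def)
    finally show ?thesis .
  qed
  define z where "z x = (if x = 0 then 1 else 0 :: real)" for x :: real
  have zs: "(\<Sum>i<N. r i * z (s i)) = (\<Sum>i<N. \<Sum>j<N. overlap U W i j * (a i * z (s j)))"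
    using sums[of "\<lambda>_ y. z y"] .
  have "qrel \<rho> \<sigma> \<le> qrel_restr N B \<tau> \<sigma> + ereal (ln C)"
  proof (cases "\<forall>i<N. r i \<noteq> 0 \<longrightarrow> s i \<noteq> 0")
    case False
    then have "qrel_restr N B \<tau> \<sigma> = \<infinity>" using restr by auto
    then show ?thesis by simp
  next
    case True
    have "(\<Sum>i<N. r i * z (s i)) = 0" using True by (intro sum.neutral) (auto simp: z_def)
    then have 0: "(\<Sum>i<N. \<Sum>j<N. overlap U W i j * (a i * z (s j))) = 0" using zs by simp
    have supp: "supp_le N (overlap U W) a s" unfolding supp_le_def
    proof (intro allI impI)
      fix i j assume ij: "i < N" "j < N" and cb: "a i \<noteq> 0 \<and> s j = 0"
      have "overlap U W i j * (a i * z (s j)) = 0"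
        by (rule double_sum_zero[OF _ 0 ij]) (auto simp: z_def a(2))
      then show "overlap U W i j = 0" using cb by (simp add: z_def)
    qed
    have q: "qrel \<rho> \<sigma> = ereal (rel_ent N (overlap U W) a s)"
      using supp unfolding qrel_spec[OF a(1) s] supp_le_def by auto
    have "(\<Sum>i<N. if r i = 0 then 0 else r i * ln (r i / s i)) = (\<Sum>i<N. r i * (ln (r i) - ln (s i)))"
    proof (intro sum.cong refl)
      fix i assume "i \<in> {..<N}"
      then have i: "i < N" by simp
      show "(if r i = 0 then 0 else r i * ln (r i / s i)) = r i * (ln (r i) - ln (s i))"
      proof (cases "r i = 0")
        case False
        then have "r i > 0" "s i > 0" using r0[OF i] s0[OF i] True i by (force simp: less_le)+
        then show ?thesis by (simp add: ln_div)
      qed simp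
    qed
    also have "\<dots> = (\<Sum>i<N. \<Sum>j<N. overlap U W i j * (a i * (ln (r j) - ln (s j))))"
      using sums[of "\<lambda>x y. ln x - ln y"] .
    also have "\<dots> = rel_ent N (overlap U W) a s - rel_ent N (overlap U W) a r"
      unfolding rel_ent_def by (simp add: sum_subtractf[symmetric] algebra_simps)
    finally have "qrel_restr N B \<tau> \<sigma> = ereal (rel_ent N (overlap U W) a s - rel_ent N (overlap U W) a r)"
      using restr True by simp
    moreover have "rel_ent N (overlap U W) a r \<le> ln C" by (rule rel_ent_dominated(2)[OF a r r0 C dom])
    ultimately show ?thesis using q by simp
  qed
  then show ?thesis using that[OF _ BR] abelian_keyalg[OF uW, of key] unfolding B_def \<tau>_def C_def by blast
qed

section \<open>Asymptotics\<close>

text \<open>Invariance of \<rho>1 is given through \<open>commA\<close> at n = 1, that is, against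
  \<open>tpow 1\<close>, which formally is a Kronecker product with a 1 x 1 matrix.\<close>

lemma tpow_1:
  assumes "A \<in> carrier_mat d d"
  shows "tpow 1 A = A"
proof (rule eq_matI)
  fix i j assume ij: "i < dim_row A" "j < dim_col A"
  then have "i < 1 * d" "j < 1 * d" using assms by auto
  then show "tpow 1 A $$ (i,j) = A $$ (i,j)"
    using kron_index[of "1\<^sub>m 1" 1 1 A d d i j] assms by simp
qed (use assms in \<open>auto simp: kron_def\<close>)

lemma ereal_scale_bound:
  assumes "c > 0" "Q \<le> S + ereal x"
  shows "ereal c * Q - ereal (c * x) \<le> ereal c * S"
proof (cases Q; cases S)
  fix q s assume e: "Q = ereal q" "S = ereal s"
  then have "c * q \<le> c * (s + x)" using assms by (intro mult_left_mono) auto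
  then show ?thesis using e by (simp add: algebra_simps)
qed (use assms in auto)

lemma ln_Suc_over_n: "(\<lambda>n. K * ln (real (n + 1)) / real n) \<longlonglongrightarrow> 0"
proof -
  have "(\<lambda>n. ln (real (Suc n)) / real (Suc n) + ln (real (Suc n)) / real (Suc n)) \<longlonglongrightarrow> 0 + 0"
    by (intro tendsto_add LIMSEQ_Suc[OF lim_ln_over_n])
  then have up: "(\<lambda>n. ln (real (Suc n)) / real (Suc n) + ln (real (Suc n)) / real (Suc n)) \<longlonglongrightarrow> 0" by simp
  have "(\<lambda>n. ln (real (n + 1)) / real n) \<longlonglongrightarrow> 0"
  proof (rule tendsto_sandwich[OF _ _ tendsto_const up])
    show "\<forall>\<^sub>F n in sequentially. ln (real (n + 1)) / real n \<le> ln (real (Suc n)) / real (Suc n) + ln (real (Suc n)) / real (Suc n)"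
      using eventually_ge_at_top[of 1]
    proof eventually_elim
      case (elim n)
      \<comment> \<open>For n \<ge> 1 the denominator n is at least half of n + 1, so the quotient
        is at most twice a term of the known null sequence.\<close>
      have "ln (real (n + 1)) / real n \<le> ln (real (n + 1)) / (real (Suc n) / 2)"
        using elim by (intro divide_left_mono) auto
      then show ?case by (simp add: mult.commute)
    qed
  qed auto
  from tendsto_mult_left[OF this, of K] show ?thesis by simp
qed

lemma qrel_tpow:
  assumes \<rho>: "density d \<rho>" and \<sigma>: "density d \<sigma>" and n: "n \<ge> 1"
  shows "ereal (1 / real n) * qrel (tpow n \<rho>) (tpow n \<sigma>) = qrel \<rho> \<sigma>"
proof -
  obtain U a where a: "spectral_dec d U a \<rho>" "\<And>i. i < d \<Longrightarrow> 0 \<le> a i" "(\<Sum>i<d. a i) = 1"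
    using density_spec[OF \<rho>] by metis
  obtain V b where b: "spectral_dec d V b \<sigma>" "\<And>i. i < d \<Longrightarrow> 0 \<le> b i"
    using density_spec[OF \<sigma>] by metis
  note q = qrel_spec[OF a(1) b(1), folded supp_le_def]
  note qn = qrel_spec[OF spec_tpow[OF a(1)] spec_tpow[OF b(1)], of n, folded supp_le_def]
  show ?thesis
  proof (cases "supp_le d (overlap U V) a b")
    case True
    from qrel_tpow_spec[OF a b True, of n] show ?thesis unfolding q qn using True n by simp
  next
    case False
    obtain m where m: "n = Suc m" using n by (cases n) auto
    from qrel_tpow_spec_inf[OF a(1,3) b(1) False, of m] show ?thesis
      unfolding q qn using False m n by simp
  qed
qed

theorem theorem5p1:
  fixes d :: nat and u :: "'g::{topological_group_add, t2_space} \<Rightarrow> complex mat"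
    and \<mu> :: "'g measure" and \<rho>0 \<rho>1 :: "complex mat"
  assumes "d > 0"
    and "compact (UNIV :: 'g set)"
    and "haar_prob \<mu>"
    and "cont_unitary_rep d u"
    and "density d \<rho>0" and "density d \<rho>1"
    and "\<rho>1 \<in> commA d u 1"
  shows "((\<lambda>n. ereal (1 / real n) *
            qrel (haar_avg d u \<mu> n (tpow n \<rho>0)) (haar_avg d u \<mu> n (tpow n \<rho>1)))
          \<longlongrightarrow> qrel \<rho>0 \<rho>1) sequentially
    \<and> ((\<lambda>n. ereal (1 / real n) *
            Sup {qrel_restr (d^n) B (haar_avg d u \<mu> n (tpow n \<rho>0)) (haar_avg d u \<mu> n (tpow n \<rho>1)) | B.
                   abelian_subalg (d^n) B \<and> B \<subseteq> commA d u n})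
          \<longlongrightarrow> qrel \<rho>0 \<rho>1) sequentially"
proof -
  note cpt = assms(2) and haar = assms(3)
  define q where "q = qrel \<rho>0 \<rho>1"
  define M where "M n = qrel (haar_avg d u \<mu> n (tpow n \<rho>0)) (haar_avg d u \<mu> n (tpow n \<rho>1))" for n
  define L where "L n = Sup {qrel_restr (d^n) B (haar_avg d u \<mu> n (tpow n \<rho>0)) (haar_avg d u \<mu> n (tpow n \<rho>1)) | B.
                   abelian_subalg (d^n) B \<and> B \<subseteq> commA d u n}" for n
  \<comment> \<open>Degree of the polynomial bound on C: d * d from the entry functions of the
    representation, d from the eigenvalues of the tensor power of \<rho>1.\<close>
  define K where "K = real (d*d + d)"
  note uc = cont_unitary_repD(2)[OF assms(4)]
  obtain V b where b: "spectral_dec d V b \<rho>1" "\<And>i. i < d \<Longrightarrow> 0 \<le> b i"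
    using density_spec[OF assms(6)] by metis
  note \<rho>1c = specD(3)[OF b(1)]
  have inv1: "\<rho>1 * u g = u g * \<rho>1" for g
    using assms(7) tpow_1[OF uc[of g]] unfolding commA_def by (metis (mono_tags, lifting) mem_Collect_eq)
  \<comment> \<open>One chain squeezes both sequences: measured entropy below averaged entropy below
    the constant value q, and q minus a null sequence below the measured one.\<close>
  have bounds: "q - ereal (K * ln (real (n + 1)) / real n) \<le> ereal (1 / real n) * L n \<and>
      ereal (1 / real n) * L n \<le> ereal (1 / real n) * M n \<and> ereal (1 / real n) * M n \<le> q" if n: "n \<ge> 1" for n
  proof -
    define N where "N = d^n"
    define R where "R g = tpow n (u g)" for g
    define \<rho> where "\<rho> = tpow n \<rho>0"
    define \<sigma> where "\<sigma> = tpow n \<rho>1"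
    have rep: "cont_unitary_rep N R" unfolding N_def R_def by (rule cont_unitary_rep_tpow[OF assms(4)])
    have d\<rho>: "density N \<rho>" "density N \<sigma>" unfolding N_def \<rho>_def \<sigma>_def by (intro density_tpow assms)+
    have \<sigma>R: "\<sigma> * R g = R g * \<sigma>" for g
      unfolding \<sigma>_def R_def tpow_mult[OF \<rho>1c uc, symmetric] tpow_mult[OF uc \<rho>1c, symmetric] inv1 ..
    have s\<sigma>: "spectral_dec N (tpow n V) (tvec d n b) \<sigma>" unfolding N_def \<sigma>_def by (rule spec_tpow[OF b(1)])
    have \<sigma>fix: "avg N R \<mu> \<sigma> = \<sigma>" by (rule avg_fix[OF cpt haar rep specD(3)[OF s\<sigma>] \<sigma>R])
    have avgs: "haar_avg d u \<mu> n (tpow n \<rho>0) = avg N R \<mu> \<rho>" "haar_avg d u \<mu> n (tpow n \<rho>1) = \<sigma>"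
      unfolding haar_avg_eq N_def[symmetric] R_def[symmetric] \<rho>_def[symmetric] \<sigma>_def[symmetric] \<sigma>fix by auto
    have Mn: "M n = qrel (avg N R \<mu> \<rho>) \<sigma>" unfolding M_def avgs ..
    have Ln: "L n = Sup {qrel_restr N B (avg N R \<mu> \<rho>) \<sigma> | B. abelian_subalg N B \<and> B \<subseteq> commA d u n}"
      unfolding L_def avgs N_def[symmetric] ..
    have Q: "ereal (1 / real n) * qrel \<rho> \<sigma> = q"
      unfolding \<rho>_def \<sigma>_def q_def by (rule qrel_tpow[OF assms(5,6) n])
    have LM: "L n \<le> M n" unfolding Ln Mn
      by (rule Sup_least) (auto intro!: qrel_restr_le density_avg[OF cpt haar rep] d\<rho>)
    have MQ: "M n \<le> qrel \<rho> \<sigma>" unfolding Mn by (rule qrel_avg_le[OF cpt haar rep d\<rho> \<sigma>R])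
    have tv: "0 \<le> tvec d n b i" if "i < N" for i
      using tvec_nonneg[of d b, OF b(2)] that unfolding N_def by blast
    obtain B where B: "abelian_subalg N B" "\<And>X g. X \<in> B \<Longrightarrow> X * R g = R g * X"
      "qrel \<rho> \<sigma> \<le> qrel_restr N B (avg N R \<mu> \<rho>) \<sigma>
         + ereal (ln (real (card (entry_funs N R)) * real (card (tvec d n b ` {..<N}))))"
      using measured_lower_bound[OF cpt haar rep d\<rho>(1) \<sigma>R s\<sigma> tv] by blast
    have "B \<subseteq> commA d u n"
      using B(2) abelian_subalgD(1)[OF B(1)] unfolding commA_def R_def N_def by blast
    then have BL: "qrel_restr N B (avg N R \<mu> \<rho>) \<sigma> \<le> L n"
      unfolding Ln using B(1) by (intro Sup_upper) blast
    have N0: "N > 0" using assms(1) by (simp add: N_def)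
    have "entry_funs N R \<noteq> {}" using N0 by (auto simp: entry_funs_def)
    then have pos: "card (entry_funs N R) > 0" "card (tvec d n b ` {..<N}) > 0"
      using N0 finite_entry_funs[of N R] by (auto simp: card_gt_0_iff)
    have "card (entry_funs N R) * card (tvec d n b ` {..<N}) \<le> (n+1)^(d*d) * (n+1)^d"
      unfolding N_def R_def by (intro mult_le_mono card_entry_funs_tpow card_tvec_image uc)
    also have "\<dots> = (n+1)^(d*d + d)" by (simp add: power_add)
    finally have "real (card (entry_funs N R)) * real (card (tvec d n b ` {..<N})) \<le> real (n+1)^(d*d + d)"
      by (metis of_nat_le_iff of_nat_mult of_nat_power)
    then have "ln (real (card (entry_funs N R)) * real (card (tvec d n b ` {..<N}))) \<le> ln (real (n+1)^(d*d + d))"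
      using pos by (intro ln_mono) auto
    also have "\<dots> = K * ln (real (n+1))" unfolding K_def by (rule ln_realpow)
    finally have "qrel_restr N B (avg N R \<mu> \<rho>) \<sigma> + ereal (ln (real (card (entry_funs N R)) * real (card (tvec d n b ` {..<N}))))
      \<le> L n + ereal (K * ln (real (n+1)))" using BL by (intro add_mono) auto
    with B(3) have "qrel \<rho> \<sigma> \<le> L n + ereal (K * ln (real (n+1)))" by (rule order_trans)
    from ereal_scale_bound[OF _ this, of "1 / real n"] n
    have "q - ereal (K * ln (real (n+1)) / real n) \<le> ereal (1 / real n) * L n" unfolding Q by simp
    moreover have "ereal (1 / real n) * L n \<le> ereal (1 / real n) * M n"
      using LM by (intro ereal_mult_left_mono) auto
    moreover have "ereal (1 / real n) * M n \<le> q"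
      unfolding Q[symmetric] using MQ by (intro ereal_mult_left_mono) auto
    ultimately show ?thesis by blast
  qed
  \<comment> \<open>If q is infinite, subtracting a finite number leaves it unchanged; only for
    finite q is the limit of the correction needed.\<close>
  have lower: "(\<lambda>n. q - ereal (K * ln (real (n + 1)) / real n)) \<longlonglongrightarrow> q"
  proof (cases q)
    case (real x)
    have "(\<lambda>n. ereal (x - K * ln (real (n + 1)) / real n)) \<longlonglongrightarrow> ereal (x - 0)"
      by (intro tendsto_ereal tendsto_diff tendsto_const ln_Suc_over_n)
    then show ?thesis using real by simp
  qed auto
  have ev: "\<forall>\<^sub>F n in sequentially. n \<ge> (1::nat)" by (rule eventually_ge_at_top)
  have "\<forall>\<^sub>F n in sequentially. q - ereal (K * ln (real (n + 1)) / real n) \<le> ereal (1 / real n) * M n"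
    "\<forall>\<^sub>F n in sequentially. ereal (1 / real n) * M n \<le> q"
    "\<forall>\<^sub>F n in sequentially. q - ereal (K * ln (real (n + 1)) / real n) \<le> ereal (1 / real n) * L n"
    "\<forall>\<^sub>F n in sequentially. ereal (1 / real n) * L n \<le> q"
    using ev by (eventually_elim, meson bounds order_trans)+
  then have "(\<lambda>n. ereal (1 / real n) * M n) \<longlonglongrightarrow> q" "(\<lambda>n. ereal (1 / real n) * L n) \<longlonglongrightarrow> q"
    by (auto intro: tendsto_sandwich[OF _ _ lower tendsto_const])
  then show ?thesis unfolding M_def L_def q_def by blast
qed

end
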